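(* Let $U$ be a finite set with $n:=|U|\ge 8$, let $v:2^U\to\mathbb{R}_+$ be a monotone subadditive function with $v(\emptyset)=0$, let $B\in\mathbb{R}_+$, and let $S^*\subseteq U$. Using a demand oracle for $v$, one can compute in polynomial time a distribution $\mathcal{D}[S^*]$ over vectors $d\in\Delta^{S^*}(B)$ such that $$\mathbb{E}_{d\sim\mathcal{D}[S^*]}\bigl[v(\{e\in S^*: c_e\le d_e\})\bigr]\ \ge\ \frac{v(S^* )}{16\log\log n}\qquad\text{for all vectors } c\in\Delta^{S^*}\!\left(\frac{B}{16\log\log n}\right).$$
   Context: For a set $S$ and vector $x$, $x(S)=\sum_{e\in S}x_e$. For $B\in\mathbb{R}_+$ and $S\subseteq U$, $\Delta^S(B)=\{x\in\mathbb{R}^S_+: x(S)\le B\}$. The function $v$ is subadditive if $v(S)+v(T)\ge v(S\cup T)$ for all $S,T\subseteq U$, and monotone if $v(S)\le v(T)$ whenever $S\subseteq T\subseteq U$. A demand oracle for $v$ takes prices $p\in\mathbb{R}_+^U$ and returns a set in $\operatorname{argmax}_{S\subseteq U}\{v(S)-p(S)\}$. Computing a distribution means outputting an explicit list of the (polynomially many) vectors in its support together with their probabilities; polynomial time means time and number of demand-oracle queries polynomial in $n$ and the bit-size of the numerical data. The logarithm is base 2. *)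

theory Defs
  imports "HOL-Probability.Probability" "HOL-Computational_Algebra.Polynomial" "HOL-Library.Log_Nat"
begin

definition subadditive_on :: "'a set \<Rightarrow> ('a set \<Rightarrow> real) \<Rightarrow> bool" where
  "subadditive_on U v \<longleftrightarrow> (\<forall>S T. S \<subseteq> U \<longrightarrow> T \<subseteq> U \<longrightarrow> v (S \<union> T) \<le> v S + v T)"

text \<open>Vectors indexed by \<open>S\<close> are functions on the whole type that vanish off \<open>S\<close>, so that
  distinct vectors are distinct functions.\<close>

definition budget_simplex :: "'a set \<Rightarrow> real \<Rightarrow> ('a \<Rightarrow> real) set" where
  "budget_simplex S B = {x. (\<forall>e\<in>S. 0 \<le> x e) \<and> (\<forall>e. e \<notin> S \<longrightarrow> x e = 0) \<and> sum x S \<le> B}"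

text \<open>Ties are broken arbitrarily.\<close>

definition demand_oracle :: "'a set \<Rightarrow> ('a set \<Rightarrow> real) \<Rightarrow> (('a \<Rightarrow> real) \<Rightarrow> 'a set) \<Rightarrow> bool" where
  "demand_oracle U v dem \<longleftrightarrow>
     (\<forall>p. (\<forall>e\<in>U. 0 \<le> p e) \<longrightarrow> is_arg_max (\<lambda>S. v S - sum p S) (\<lambda>S. S \<subseteq> U) (dem p))"


section \<open>Model of computation\<close>

text \<open>
  Algorithms are structured programs over integers and integer-indexed arrays (a scalar \<open>x\<close> is the
  cell \<open>x[0]\<close>), run with logarithmic cost: every operation is charged the number of binary digits
  of its result.  Since leaves and addresses are charged as well, this is the logarithmic-cost
  random access machine, and running times agree with those of (oracle) Turing machines up to a
  polynomial.
\<close>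

type_synonym state = "string \<Rightarrow> int \<Rightarrow> int"

definition bits :: "int \<Rightarrow> nat" where
  "bits k = 1 + floorlog 2 (nat \<bar>k\<bar>)"

datatype aexp =
    Cst int
  | Cell string aexp
  | Add aexp aexp
  | Sub aexp aexp
  | Mul aexp aexp
  | Quo aexp aexp

fun aval :: "state \<Rightarrow> aexp \<Rightarrow> int" where
  "aval s (Cst k) = k"
| "aval s (Cell x a) = s x (aval s a)"
| "aval s (Add a b) = aval s a + aval s b"
| "aval s (Sub a b) = aval s a - aval s b"
| "aval s (Mul a b) = aval s a * aval s b"
| "aval s (Quo a b) = aval s a div aval s b"

fun acost :: "state \<Rightarrow> aexp \<Rightarrow> nat" where
  "acost s (Cst k) = bits k"
| "acost s (Cell x a) = acost s a + bits (aval s (Cell x a))"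
| "acost s (Add a b) = acost s a + acost s b + bits (aval s (Add a b))"
| "acost s (Sub a b) = acost s a + acost s b + bits (aval s (Sub a b))"
| "acost s (Mul a b) = acost s a + acost s b + bits (aval s (Mul a b))"
| "acost s (Quo a b) = acost s a + acost s b + bits (aval s (Quo a b))"

datatype com =
    Skip
  | Assign string aexp aexp   \<comment> \<open>\<open>x[a] := b\<close>\<close>
  | Seq com com
  | Cond aexp com com         \<comment> \<open>the test is \<open>a > 0\<close>\<close>
  | While aexp com
  | Query string string string

text \<open>
  \<open>exec n orc c s t s'\<close>: started in \<open>s\<close>, the program \<open>c\<close> terminates in \<open>s'\<close> at cost \<open>t\<close>.  The only
  access to the oracle is \<open>Query P Q R\<close>: the prices of the elements \<open>0, \<dots>, n - 1\<close> are the
  nonnegative rationals \<open>P[i] / Q[i]\<close>, and the characteristic vector of the answer is written to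
  \<open>R[0], \<dots>, R[n - 1]\<close>.  Every query is charged at least \<open>1\<close>, so the cost also bounds the
  number of queries.
\<close>

inductive exec ::
  "nat \<Rightarrow> ((nat \<Rightarrow> real) \<Rightarrow> nat set) \<Rightarrow> com \<Rightarrow> state \<Rightarrow> nat \<Rightarrow> state \<Rightarrow> bool"
  for n :: nat and orc :: "(nat \<Rightarrow> real) \<Rightarrow> nat set" where
  Skip: "exec n orc Skip s 1 s"
| Assign: "exec n orc (Assign x a b) s (1 + acost s a + acost s b)
             (s(x := (s x)(aval s a := aval s b)))"
| Seq: "exec n orc c1 s1 t1 s2 \<Longrightarrow> exec n orc c2 s2 t2 s3 \<Longrightarrow>
          exec n orc (Seq c1 c2) s1 (1 + t1 + t2) s3"
| CondTrue: "0 < aval s a \<Longrightarrow> exec n orc c1 s t s' \<Longrightarrow>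
               exec n orc (Cond a c1 c2) s (1 + acost s a + t) s'"
| CondFalse: "\<not> 0 < aval s a \<Longrightarrow> exec n orc c2 s t s' \<Longrightarrow>
                exec n orc (Cond a c1 c2) s (1 + acost s a + t) s'"
| WhileFalse: "\<not> 0 < aval s a \<Longrightarrow> exec n orc (While a c) s (1 + acost s a) s"
| WhileTrue: "0 < aval s1 a \<Longrightarrow> exec n orc c s1 t1 s2 \<Longrightarrow> exec n orc (While a c) s2 t2 s3 \<Longrightarrow>
                exec n orc (While a c) s1 (1 + acost s1 a + t1 + t2) s3"
| Query: "(\<And>i. i < n \<Longrightarrow> 0 \<le> s P (int i) \<and> 0 < s Q (int i)) \<Longrightarrow>
            exec n orc (Query P Q R) s
              (1 + (\<Sum>i<n. bits (s P (int i)) + bits (s Q (int i))))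
              (s(R := (\<lambda>k. if 0 \<le> k \<and> k < int n
                  then of_bool (nat k \<in> orc (\<lambda>i. of_int (s P (int i)) / of_int (s Q (int i))))
                  else s R k)))"

text \<open>Programs are deterministic, so a terminating run with some property is the only run.\<close>

inductive_cases exec_SkipE: "exec n orc Skip s t s'"
inductive_cases exec_AssignE: "exec n orc (Assign x a b) s t s'"
inductive_cases exec_SeqE: "exec n orc (Seq c1 c2) s t s'"
inductive_cases exec_CondE: "exec n orc (Cond a c1 c2) s t s'"
inductive_cases exec_WhileE: "exec n orc (While a c) s t s'"
inductive_cases exec_QueryE: "exec n orc (Query P Q R) s t s'"

lemma exec_deterministic:
  "exec n orc c s t s' \<Longrightarrow> exec n orc c s u s'' \<Longrightarrow> u = t \<and> s'' = s'"
proof (induction arbitrary: u s'' rule: exec.induct)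
  case (Skip s)
  show ?case by (rule exec_SkipE[OF Skip.prems]) simp
next
  case (Assign s x a b)
  show ?case by (rule exec_AssignE[OF Assign.prems]) simp
next
  case (Seq c1 s1 t1 s2 c2 t2 s3)
  show ?case by (rule exec_SeqE[OF Seq.prems]) (auto dest!: Seq.IH)
next
  case (CondTrue s a c1 t s' c2)
  show ?case
    by (rule exec_CondE[OF CondTrue.prems]) (use CondTrue.hyps in \<open>auto dest!: CondTrue.IH\<close>)
next
  case (CondFalse s a c2 t s' c1)
  show ?case
    by (rule exec_CondE[OF CondFalse.prems]) (use CondFalse.hyps in \<open>auto dest!: CondFalse.IH\<close>)
next
  case (WhileFalse s a c)
  show ?case by (rule exec_WhileE[OF WhileFalse.prems]) (use WhileFalse.hyps in auto)
next
  case (WhileTrue s1 a c t1 s2 t2 s3)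
  show ?case
    by (rule exec_WhileE[OF WhileTrue.prems]) (use WhileTrue.hyps in \<open>auto dest!: WhileTrue.IH\<close>)
next
  case (Query s P Q R)
  show ?case by (rule exec_QueryE[OF Query.prems]) simp
qed


section \<open>Encoding of instances and of distributions\<close>

text \<open>
  A program refers to the elements of \<open>U\<close> through an arbitrary numbering \<open>u\<close>, a bijection from
  \<open>{..<card U}\<close> onto \<open>U\<close>.
\<close>

definition index_vector :: "'a set \<Rightarrow> (nat \<Rightarrow> 'a) \<Rightarrow> (nat \<Rightarrow> real) \<Rightarrow> 'a \<Rightarrow> real" where
  "index_vector U u p = (\<lambda>e. if e \<in> U then p (inv_into {..<card U} u e) else 0)"

definition index_oracle ::
  "'a set \<Rightarrow> (nat \<Rightarrow> 'a) \<Rightarrow> (('a \<Rightarrow> real) \<Rightarrow> 'a set) \<Rightarrow> (nat \<Rightarrow> real) \<Rightarrow> nat set" where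
  "index_oracle U u dem p = {i. i < card U \<and> u i \<in> dem (index_vector U u p)}"

text \<open>\<open>frac_code L x p q\<close>: the fraction \<open>p / q\<close> is an encoding of \<open>x \<ge> 0\<close> with at most \<open>L\<close> bits.\<close>

definition frac_code :: "nat \<Rightarrow> real \<Rightarrow> int \<Rightarrow> int \<Rightarrow> bool" where
  "frac_code L x p q \<longleftrightarrow> 0 \<le> p \<and> 0 < q \<and> x = of_int p / of_int q \<and> bits p + bits q \<le> L"

text \<open>
  The numerical data, namely the budget \<open>B\<close> (given as \<open>Bp / Bq\<close>) and the values of \<open>v\<close>, are
  rationals of bit-size at most \<open>L\<close>.  As usual for problems given by oracles, the bound \<open>L\<close> is part
  of the input: a demand oracle reveals \<open>v\<close> only through comparisons, and without \<open>L\<close> no algorithm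
  could tell \<open>v = 0\<close> from functions with arbitrarily small positive values.
\<close>

definition numerical_data :: "'a set \<Rightarrow> ('a set \<Rightarrow> real) \<Rightarrow> real \<Rightarrow> nat \<Rightarrow> int \<Rightarrow> int \<Rightarrow> bool" where
  "numerical_data U v B L Bp Bq \<longleftrightarrow>
     frac_code L B Bp Bq \<and> (\<forall>T\<subseteq>U. \<exists>p q. frac_code L (v T) p q)"

definition scalar :: "int \<Rightarrow> int \<Rightarrow> int" where
  "scalar k = (\<lambda>_. 0)(0 := k)"

definition input_state ::
  "'a set \<Rightarrow> (nat \<Rightarrow> 'a) \<Rightarrow> 'a set \<Rightarrow> nat \<Rightarrow> int \<Rightarrow> int \<Rightarrow> state" where
  "input_state U u S L Bp Bq = (\<lambda>_ _. 0)
     (''n'' := scalar (int (card U)),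
      ''L'' := scalar (int L),
      ''Bp'' := scalar Bp,
      ''Bq'' := scalar Bq,
      ''S'' := (\<lambda>k. of_bool (0 \<le> k \<and> k < int (card U) \<and> u (nat k) \<in> S)))"

text \<open>
  The output consists of \<open>m\<close> vectors and their probabilities.  Vector number \<open>k\<close> has the probability
  \<open>pp[k] / pq[k]\<close> and the coordinates \<open>dp[k * n + i] / dq[k * n + i]\<close> for \<open>i < n\<close>.  All
  denominators have to be positive while arrays initially contain \<open>0\<close>, so each entry of the list
  has been written explicitly; in particular the length of the list is at most the running time.
\<close>

definition output_ok :: "nat \<Rightarrow> state \<Rightarrow> bool" where
  "output_ok n s \<longleftrightarrow>
     (\<forall>k < nat (s ''m'' 0). 0 < s ''pq'' (int k) \<and> (\<forall>i<n. 0 < s ''dq'' (int (k * n + i))))"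

definition output_list :: "'a set \<Rightarrow> (nat \<Rightarrow> 'a) \<Rightarrow> state \<Rightarrow> (('a \<Rightarrow> real) \<times> real) list" where
  "output_list U u s =
     map (\<lambda>k. (index_vector U u (\<lambda>i. of_int (s ''dp'' (int (k * card U + i)))
                                      / of_int (s ''dq'' (int (k * card U + i)))),
               of_int (s ''pp'' (int k)) / of_int (s ''pq'' (int k))))
         [0..<nat (s ''m'' 0)]"

definition lists_distribution :: "('b \<times> real) list \<Rightarrow> 'b pmf \<Rightarrow> bool" where
  "lists_distribution xs D \<longleftrightarrow> distinct xs \<and> set xs = (\<lambda>d. (d, pmf D d)) ` set_pmf D"

definition computes_distribution ::
  "com \<Rightarrow> nat \<Rightarrow> 'a set \<Rightarrow> (('a \<Rightarrow> real) \<Rightarrow> 'a set) \<Rightarrow> (nat \<Rightarrow> 'a) \<Rightarrow> 'a set \<Rightarrow>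
   nat \<Rightarrow> int \<Rightarrow> int \<Rightarrow> ('a \<Rightarrow> real) pmf \<Rightarrow> bool" where
  "computes_distribution prog tmax U dem u S L Bp Bq D \<longleftrightarrow>
     (\<exists>t s. exec (card U) (index_oracle U u dem) prog (input_state U u S L Bp Bq) t s \<and>
            t \<le> tmax \<and> output_ok (card U) s \<and> lists_distribution (output_list U u s) D)"

end

theory Submission
  imports Defs
begin

text \<open>
  For \<open>q \<in> [0, 1]\<close> let \<open>f(q)\<close> be the largest expected value of a random subset of \<open>S\<close> that contains
  each element with probability at most \<open>q\<close>.  Then \<open>f(1/2) \<ge> v(S)/2\<close>, while \<open>f(q) \<le> n q v(S)\<close> is
  small for \<open>q \<le> 1/(4n)\<close>, so along the about \<open>log log n\<close> levels \<open>q = 1/2, 1/4, 1/16, \<dots>\<close>, each the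
  square of the previous one, the differences \<open>f(q) - f(q\<^sup>2)\<close> add up to a constant fraction of
  \<open>v(S)\<close>.  Let \<open>T\<close> be an optimal random set of level \<open>q\<close>, and let \<open>(\<theta>, p)\<close> be an optimal dual
  solution of level \<open>q\<^sup>2\<close>, that is \<open>v(A) \<le> \<theta> + p(A)\<close> for all \<open>A\<close> and \<open>\<theta> + q\<^sup>2 p(S) = f(q\<^sup>2)\<close>.
  Split \<open>T\<close> into blocks of price \<open>O(q p(S))\<close>, of which there are \<open>O(1)\<close> on average, and offer to
  the elements of a block the budget in proportion to \<open>p\<close>.  The elements \<open>A\<close> whose cost exceeds
  this offer have price at most \<open>q p(S)\<close>, hence \<open>v(T \<inter> A)\<close> is on average at most
  \<open>\<theta> + q\<^sup>2 p(S) = f(q\<^sup>2)\<close>, and the level contributes \<open>f(q) - f(q\<^sup>2)\<close>.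

  Both sides of the linear program are obtained, up to a small error, from projected gradient
  descent on the prices against demand sets, which never needs a value of \<open>v\<close>; only the scale of
  \<open>v(S)\<close> has to be known up to a factor \<open>2 n\<close>, and it is found by doubling a uniform price until
  the demand set is empty.  The output is uniform over all blocks of all rounds and levels; one
  coordinate is overwritten to make the vectors distinct.
\<close>

section \<open>Price dynamics at a fixed level\<close>

text \<open>The constants fit together as follows. The gains telescope to
  \<open>1/2 - 9/32 - 1/32 = 3/16\<close> of \<open>rounds * w S\<close>: \<open>9/32\<close> is
  what the last level may still hold, \<open>1/32\<close> covers all regret. A round yields on
  average at most \<open>41/32\<close> blocks, and there are at most \<open>2 + y\<close> levels,
  where \<open>y = log log n\<close>. Since \<open>41/32 * (2 + y) \<le> 3 * y\<close> for
  \<open>y \<ge> 3/2\<close>, the average over all blocks is at least \<open>w S / (16 * y)\<close>.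
  The same bound on \<open>y\<close>, valid from \<open>n = 8\<close> on, limits the total cost to
  \<open>B / 24\<close>, small against the largest offer \<open>B / 4\<close>. Half of
  \<open>B\<close> pays for a block, the other half is kept for the overwritten coordinate. The
  obstacle on the computational side is that program and analysis must speak of the same demand sets
  although ties are broken arbitrarily. Prices are therefore integers times a fixed rational and are
  computed without rounding; a level that is run once for its prices and again for its plays asks
  the same questions and gets the same answers.\<close>

locale price_dynamics =
  fixes n :: nat and S :: "nat set" and w :: "nat set \<Rightarrow> real"
    and dm :: "(nat \<Rightarrow> real) \<Rightarrow> nat set" and s :: real
  assumes n_ge: "8 \<le> n"
    and S_sub: "S \<subseteq> {..<n}"
    and w_nonneg: "\<And>A. A \<subseteq> S \<Longrightarrow> 0 \<le> w A"
    and w_mono: "\<And>A B. A \<subseteq> B \<Longrightarrow> B \<subseteq> S \<Longrightarrow> w A \<le> w B"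
    and w_subadd: "\<And>A B. A \<subseteq> S \<Longrightarrow> B \<subseteq> S \<Longrightarrow> w (A \<union> B) \<le> w A + w B"
    and w_empty: "w {} = 0"
    and dm_sub: "\<And>p. (\<And>e. 0 \<le> p e) \<Longrightarrow> dm p \<subseteq> S"
    and dm_opt: "\<And>p A. (\<And>e. 0 \<le> p e) \<Longrightarrow> A \<subseteq> S \<Longrightarrow> w A - sum p A \<le> w (dm p) - sum p (dm p)"
    and s_pos: "0 < s"
    and s_le: "s \<le> w S"
    and s_ge: "w S \<le> 2 * n * s"
begin

text \<open>The regret per round is \<open>eta * n / 2\<close>, at most
  \<open>w S / (2 * n ^ 3)\<close>. With the exponent 4, the at most \<open>3 * n\<close> such terms
  of all levels together stay below \<open>w S / 32\<close>.\<close>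

definition eta :: real where "eta = s / n ^ 4"

text \<open>A dual coordinate never exceeds \<open>Q * (2 * n ^ 5 + 1)\<close>. For
  \<open>Q \<le> 16 * n ^ 2\<close> this is at most an eighth of \<open>n ^ 11\<close>, so
  frequencies overshoot \<open>1 / Q\<close> only by the factor \<open>9/8\<close>.\<close>

definition rounds :: nat where "rounds = n ^ 11"

text \<open>In the unit \<open>eta / Q\<close>, the gradient step
  \<open>eta * (of_bool (e \<in> T) - 1 / Q)\<close> for a demand set \<open>T\<close> becomes the
  integer \<open>Q * of_bool (e \<in> T) - 1\<close>, so the iterates are exact integers.\<close>

definition price :: "nat \<Rightarrow> (nat \<Rightarrow> int) \<Rightarrow> nat \<Rightarrow> real" where
  "price Q k = (\<lambda>e. eta / Q * of_int (k e))"

text \<open>\<open>Q\<close> is the reciprocal of the bound on the frequency of an element.\<close>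

primrec dual :: "nat \<Rightarrow> nat \<Rightarrow> nat \<Rightarrow> int" where
  "dual Q 0 = (\<lambda>e. 0)"
| "dual Q (Suc t) =
     (\<lambda>e. max 0 (dual Q t e + int Q * of_bool (e \<in> dm (price Q (dual Q t))) - 1))"

definition play :: "nat \<Rightarrow> nat \<Rightarrow> nat set" where
  "play Q t = dm (price Q (dual Q t))"

definition dual_sum :: "nat \<Rightarrow> nat \<Rightarrow> int" where
  "dual_sum Q e = (\<Sum>t<rounds. dual Q t e)"

definition value_sum :: "nat \<Rightarrow> real" where
  "value_sum Q = (\<Sum>t<rounds. w (play Q t))"

definition regret :: real where "regret = eta * n * rounds / 2"

lemma dual_Suc: "dual Q (Suc t) e = max 0 (dual Q t e + int Q * of_bool (e \<in> play Q t) - 1)"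
  by (simp add: play_def)

declare dual.simps(2) [simp del]

lemma finite_S: "finite S"
  using S_sub finite_subset by blast

lemma card_S: "card S \<le> n"
  using card_mono[OF _ S_sub] by simp

lemma eta_pos: "0 < eta"
  using s_pos n_ge by (simp add: eta_def)

lemma rounds_pos: "0 < rounds"
  using n_ge by (simp add: rounds_def)

lemma dual_nonneg: "0 \<le> dual Q t e"
  by (induction t) (auto simp: dual_Suc)

lemma dual_sum_nonneg: "0 \<le> dual_sum Q e"
  by (simp add: dual_sum_def dual_nonneg sum_nonneg)

lemma price_nonneg: "0 \<le> price Q (dual Q t) e"
  using eta_pos dual_nonneg by (simp add: price_def)

lemma play_sub: "play Q t \<subseteq> S"
  unfolding play_def by (rule dm_sub) (rule price_nonneg)

lemma play_opt:
  "A \<subseteq> S \<Longrightarrow> w A - sum (price Q (dual Q t)) A \<le> w (play Q t) - sum (price Q (dual Q t)) (play Q t)"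
  unfolding play_def by (rule dm_opt) (auto intro: price_nonneg)

lemma dual_bound: "dual Q t e \<le> int (t * Q)"
proof (induction t)
  case (Suc t)
  then show ?case by (auto simp: dual_Suc algebra_simps split: if_splits)
qed simp

lemma w_sum: "A \<subseteq> S \<Longrightarrow> w A \<le> (\<Sum>e\<in>A. w {e})"
proof -
  assume A: "A \<subseteq> S"
  then have "finite A" using finite_S finite_subset by blast
  then show ?thesis using A
  proof (induction A rule: finite_induct)
    case empty
    then show ?case by (simp add: w_empty)
  next
    case (insert x F)
    then have "w ({x} \<union> F) \<le> w {x} + w F" by (intro w_subadd) auto
    with insert show ?case by simp
  qed
qed

text \<open>Projected gradient descent: the squared norm of the dual iterate is the potential.\<close>

lemma potential:
  "(\<Sum>e\<in>S. of_int (dual Q t e) ^ 2) \<le>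
     (\<Sum>r<t. 2 * (Q * (\<Sum>e\<in>play Q r. of_int (dual Q r e)) - (\<Sum>e\<in>S. of_int (dual Q r e)))
        + n * real Q ^ 2)"
  if "1 \<le> Q"
proof (induction t)
  case (Suc t)
  let ?k = "\<lambda>e. of_int (dual Q t e) :: real"
  let ?g = "\<lambda>e. real Q * of_bool (e \<in> play Q t) - 1"
  have "of_int (dual Q (Suc t) e) ^ 2 \<le> ?k e ^ 2 + 2 * ?k e * ?g e + real Q ^ 2" for e
  proof -
    have "(of_int (dual Q (Suc t) e) :: real) = max 0 (?k e + ?g e)"
      by (simp add: dual_Suc of_int_max)
    then have "of_int (dual Q (Suc t) e) ^ 2 \<le> (?k e + ?g e) ^ 2"
      by (auto simp: max_def)
    moreover have "?g e ^ 2 \<le> real Q ^ 2"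
      by (rule power2_le_iff_abs_le[THEN iffD2]) (use that in auto)
    ultimately show ?thesis by (simp add: power2_eq_square algebra_simps)
  qed
  then have "(\<Sum>e\<in>S. of_int (dual Q (Suc t) e) ^ 2)
      \<le> (\<Sum>e\<in>S. ?k e ^ 2 + 2 * ?k e * ?g e + real Q ^ 2)"
    by (intro sum_mono)
  also have "\<dots> = (\<Sum>e\<in>S. ?k e ^ 2) + 2 * (\<Sum>e\<in>S. ?k e * ?g e) + card S * real Q ^ 2"
    by (simp add: sum.distrib sum_distrib_left mult.assoc)
  also have "(\<Sum>e\<in>S. ?k e * ?g e) = Q * (\<Sum>e\<in>S. ?k e * of_bool (e \<in> play Q t)) - (\<Sum>e\<in>S. ?k e)"
    by (simp add: sum_subtractf sum_distrib_left algebra_simps)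
  also have "(\<Sum>e\<in>S. ?k e * of_bool (e \<in> play Q t)) = (\<Sum>e\<in>play Q t. ?k e)"
    using play_sub[of Q t] finite_S
    by (intro sum.mono_neutral_cong_right) auto
  also have "card S * real Q ^ 2 \<le> n * real Q ^ 2"
    using card_S by (simp add: mult_right_mono)
  finally show ?case using Suc by (simp add: algebra_simps)
qed simp

text \<open>Approximate dual feasibility: divided by \<open>rounds\<close>, and with the average
  price vector \<open>p = eta / (Q * rounds) * dual_sum Q\<close>, it reads
  \<open>w A \<le> \<theta> + p(A)\<close>, where \<open>\<theta> + p(S) / Q\<close> is the average
  value of the plays up to regret.\<close>

lemma supporting_prices:
  assumes "1 \<le> Q" and A: "A \<subseteq> S"
  shows "rounds * w A - eta / Q * (\<Sum>e\<in>A. dual_sum Q e) + eta / Q ^ 2 * (\<Sum>e\<in>S. dual_sum Q e)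
           \<le> value_sum Q + regret"
proof -
  let ?k = "\<lambda>X t. (\<Sum>e\<in>X. of_int (dual Q t e)) :: real"
  have Q: "0 < real Q" using assms by simp
  have sw: "of_int (\<Sum>e\<in>X. dual_sum Q e) = (\<Sum>t<rounds. ?k X t)" for X
    by (simp add: dual_sum_def sum.swap[of _ "{..<rounds}"])
  have pr: "sum (price Q (dual Q t)) X = eta / Q * ?k X t" for X t
    by (simp add: price_def sum_distrib_left)
  \<comment> \<open>The final potential is nonnegative. Read through \<open>potential\<close>, this
    says that the plays pay, up to regret, at least the fraction \<open>1 / Q\<close> of all
    prices.\<close>
  have "0 \<le> (\<Sum>e\<in>S. (of_int (dual Q rounds e) :: real) ^ 2)" by (simp add: sum_nonneg)
  also note potential[OF assms(1)]
  finally have "0 \<le> (\<Sum>t<rounds. 2 * (Q * ?k (play Q t) t - ?k S t) + n * real Q ^ 2)" .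
  then have "0 \<le> (2 * Q * (\<Sum>t<rounds. ?k (play Q t) t) - 2 * (\<Sum>t<rounds. ?k S t)) + rounds * n * real Q ^ 2"
    by (simp add: sum.distrib sum_subtractf sum_distrib_left algebra_simps)
  then have "0 \<le> eta / (2 * Q ^ 2) *
     ((2 * Q * (\<Sum>t<rounds. ?k (play Q t) t) - 2 * (\<Sum>t<rounds. ?k S t)) + rounds * n * real Q ^ 2)"
    using eta_pos by (intro mult_nonneg_nonneg) auto
  also have "\<dots> = eta / Q * (\<Sum>t<rounds. ?k (play Q t) t) - eta / Q ^ 2 * (\<Sum>t<rounds. ?k S t) + regret"
    using Q by (simp add: regret_def field_simps power2_eq_square)
  finally have 1: "eta / Q ^ 2 * (\<Sum>t<rounds. ?k S t) \<le> eta / Q * (\<Sum>t<rounds. ?k (play Q t) t) + regret"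
    by simp
  have "(\<Sum>t<rounds. w A - eta / Q * ?k A t) \<le> (\<Sum>t<rounds. w (play Q t) - eta / Q * ?k (play Q t) t)"
    using play_opt[OF A, of Q] by (intro sum_mono) (simp add: pr)
  then have "rounds * w A - eta / Q * (\<Sum>t<rounds. ?k A t)
      \<le> value_sum Q - eta / Q * (\<Sum>t<rounds. ?k (play Q t) t)"
    by (simp add: value_sum_def sum_subtractf sum_distrib_left)
  with 1 show ?thesis unfolding sw by simp
qed

definition hits :: "nat \<Rightarrow> nat \<Rightarrow> nat" where
  "hits Q e = card {t. t < rounds \<and> e \<in> play Q t}"

text \<open>Dropping \<open>e\<close> from a demand set cannot help, so its price is at most its
  marginal value, which subadditivity bounds by \<open>w {e}\<close>.\<close>

lemma price_le_value:
  assumes "e \<in> play Q t"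
  shows "price Q (dual Q t) e \<le> w S"
proof -
  let ?p = "price Q (dual Q t)" and ?T = "play Q t"
  have T: "?T \<subseteq> S" by (rule play_sub)
  then have fin: "finite ?T" using finite_S finite_subset by blast
  have "w (?T - {e}) - sum ?p (?T - {e}) \<le> w ?T - sum ?p ?T"
    using T by (intro play_opt) auto
  moreover have "sum ?p ?T = ?p e + sum ?p (?T - {e})"
    using assms fin by (simp add: sum.remove)
  moreover have "w ({e} \<union> (?T - {e})) \<le> w {e} + w (?T - {e})"
    using T assms by (intro w_subadd) auto
  moreover have "{e} \<union> (?T - {e}) = ?T" using assms by auto
  moreover have "w {e} \<le> w S" using T assms by (intro w_mono) auto
  ultimately show ?thesis by simp
qed

text \<open>A coordinate grows only in rounds that demand its element. Before such a round
  \<open>price_le_value\<close> bounds it by \<open>Q * w S / eta\<close>, and it then grows by less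
  than \<open>Q\<close>.\<close>

lemma dual_le: "real_of_int (dual Q t e) \<le> Q * w S / eta + Q" if "1 \<le> Q"
proof (induction t)
  case 0
  then show ?case using eta_pos w_nonneg[of S] by simp
next
  case (Suc t)
  show ?case
  proof (cases "e \<in> play Q t")
    case True
    from price_le_value[OF True] have "real_of_int (dual Q t e) \<le> Q * w S / eta"
      using eta_pos that by (simp add: price_def field_simps)
    then show ?thesis using True eta_pos w_nonneg[of S] that
      by (auto simp: dual_Suc max_def)
  next
    case False
    then have "dual Q (Suc t) e \<le> dual Q t e"
      using dual_nonneg[of Q t e] by (auto simp: dual_Suc)
    then show ?thesis using Suc by linarith
  qed
qed

text \<open>The projection to nonnegative numbers only raises a coordinate, so after
  \<open>t\<close> rounds it is at least \<open>Q\<close> times the number of hits minus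
  \<open>t\<close>.\<close>

lemma hits_dual:
  "int Q * int (card {r. r < t \<and> e \<in> play Q r}) \<le> int t + dual Q t e"
proof (induction t)
  case (Suc t)
  have "{r. r < Suc t \<and> e \<in> play Q r} =
      (if e \<in> play Q t then insert t {r. r < t \<and> e \<in> play Q r} else {r. r < t \<and> e \<in> play Q r})"
    by (auto simp: less_Suc_eq)
  then have "card {r. r < Suc t \<and> e \<in> play Q r} = card {r. r < t \<and> e \<in> play Q r} + of_bool (e \<in> play Q t)"
    by simp
  then show ?case using Suc by (auto simp: dual_Suc algebra_simps)
qed simp

text \<open>\<open>hits_dual\<close> bounds \<open>Q * hits\<close> by \<open>rounds\<close> plus
  the final dual coordinate, and by \<open>dual_le\<close> that coordinate is at most an eighth of
  \<open>rounds\<close>.\<close>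

lemma hits_le:
  assumes "1 \<le> Q" "Q \<le> 16 * n ^ 2"
  shows "hits Q e \<le> 9/8 * (rounds / Q)"
proof -
  have n: "8 \<le> real n" using n_ge by simp
  have Q: "0 < real Q" using assms by simp
  have "real Q * hits Q e \<le> rounds + (Q * w S / eta + Q)"
  proof -
    have "real_of_int (int Q * int (hits Q e)) \<le> real_of_int (int rounds + dual Q rounds e)"
      unfolding of_int_le_iff hits_def by (rule hits_dual)
    then show ?thesis using dual_le[OF assms(1), of rounds e] by simp
  qed
  also have "w S / eta \<le> 2 * real n ^ 5"
  proof -
    have "w S / eta \<le> 2 * n * s / eta"
      by (rule divide_right_mono) (use s_ge eta_pos in auto)
    also have "\<dots> = 2 * real n ^ 5"
      using s_pos n by (simp add: eta_def power_numeral_reduce)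
    finally show ?thesis .
  qed
  then have "Q * w S / eta \<le> Q * (2 * real n ^ 5)"
    using mult_left_mono[of "w S / eta" _ "real Q"] Q by simp
  finally have "real Q * hits Q e \<le> rounds + Q * (2 * real n ^ 5 + 1)"
    by (simp add: algebra_simps)
  also have "Q * (2 * real n ^ 5 + 1) \<le> (16 * real n ^ 2) * (2 * real n ^ 5 + 1)"
    proof (rule mult_right_mono)
      show "real Q \<le> 16 * real n ^ 2"
        using of_nat_mono[OF assms(2), where ?'a = real] by simp
    qed simp
  also have "\<dots> \<le> rounds / 8"
  proof -
    have "1 \<le> real n ^ 5" using n by (simp add: one_le_power)
    then have "128 * (2 * real n ^ 5 + 1) \<le> 512 * real n ^ 5" by simp
    also have "\<dots> \<le> real n ^ 4 * real n ^ 5"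
      by (rule mult_right_mono) (use power_mono[OF n, of 4] in simp_all)
    finally have "real n ^ 2 * (128 * (2 * real n ^ 5 + 1)) \<le> real n ^ 2 * (real n ^ 4 * real n ^ 5)"
      by (rule mult_left_mono) simp
    also have "\<dots> = rounds" by (simp add: rounds_def flip: power_add)
    finally show ?thesis by (simp add: algebra_simps)
  qed
  finally show ?thesis using Q by (simp add: field_simps)
qed

lemma sum_play_swap:
  fixes f :: "nat \<Rightarrow> real"
  shows "(\<Sum>t<rounds. \<Sum>e\<in>play Q t \<inter> A. f e) = (\<Sum>e\<in>S \<inter> A. hits Q e * f e)"
proof -
  have "(\<Sum>e\<in>play Q t \<inter> A. f e) = (\<Sum>e\<in>S \<inter> A. of_bool (e \<in> play Q t) * f e)" for t
    using play_sub[of Q t] finite_S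
    by (intro sum.mono_neutral_cong_left) auto
  then have "(\<Sum>t<rounds. \<Sum>e\<in>play Q t \<inter> A. f e) = (\<Sum>e\<in>S \<inter> A. (\<Sum>t<rounds. of_bool (e \<in> play Q t)) * f e)"
    unfolding sum_distrib_right by (simp only: sum.swap[of _ "{..<rounds}"])
  moreover have "(\<Sum>t<rounds. of_bool (e \<in> play Q t)) = real (hits Q e)" for e
    by (simp add: hits_def of_bool_def sum.If_cases Collect_conj_eq lessThan_def)
  ultimately show ?thesis by simp
qed

lemma regret_le: "regret \<le> rounds * w S / (2 * n ^ 3)"
proof -
  have "regret = rounds * s / (2 * n ^ 3)"
    using n_ge by (simp add: regret_def eta_def field_simps power_numeral_reduce)
  also have "\<dots> \<le> rounds * w S / (2 * n ^ 3)"
    using s_le by (intro divide_right_mono mult_left_mono) auto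
  finally show ?thesis .
qed

lemma eta_le_regret: "eta \<le> regret"
proof -
  have "2 * 1 \<le> real n * real rounds"
    by (rule mult_mono) (use n_ge rounds_pos in auto)
  then have "eta * 2 \<le> eta * (real n * rounds)" using eta_pos by (intro mult_left_mono) auto
  then show ?thesis by (simp add: regret_def)
qed

text \<open>Adding the supporting inequalities for \<open>{}\<close> and \<open>S\<close> cancels
  the prices, because \<open>eta / Q\<close> is twice \<open>eta / Q ^ 2\<close> at
  \<open>Q = 2\<close>. This replaces the explicit random set that shows
  \<open>f(1/2) \<ge> v(S)/2\<close>.\<close>

lemma value_sum_first: "rounds * w S / 2 - regret \<le> value_sum 2"
  using supporting_prices[of 2 "{}"] supporting_prices[of 2 S] eta_pos
  by (simp add: w_empty)

text \<open>Each element is worth at most \<open>w S\<close> and is hit with frequency at most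
  \<open>9/8 / Q\<close>; summing over at most \<open>n \<le> Q / 4\<close> elements gives
  \<open>9/8 * 1/4 = 9/32\<close>.\<close>

lemma value_sum_last:
  assumes "4 * n \<le> Q" "Q \<le> 16 * n ^ 2"
  shows "value_sum Q \<le> 9/32 * (rounds * w S)"
proof -
  have Q: "1 \<le> Q" using assms n_ge by linarith
  have "value_sum Q \<le> (\<Sum>t<rounds. \<Sum>e\<in>play Q t \<inter> S. w S)"
    unfolding value_sum_def
  proof (rule sum_mono)
    fix t
    have "w (play Q t) \<le> (\<Sum>e\<in>play Q t. w {e})" by (rule w_sum[OF play_sub])
    also have "\<dots> \<le> (\<Sum>e\<in>play Q t. w S)"
      using play_sub[of Q t] by (intro sum_mono w_mono) auto
    finally show "w (play Q t) \<le> (\<Sum>e\<in>play Q t \<inter> S. w S)"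
      using play_sub[of Q t] by (simp add: Int_absorb2)
  qed
  also have "\<dots> = (\<Sum>e\<in>S. hits Q e * w S)"
    unfolding sum_play_swap by simp
  also have "\<dots> \<le> (\<Sum>e\<in>S. 9/8 * (rounds / Q) * w S)"
    using w_nonneg[of S] hits_le[OF Q assms(2)] by (intro sum_mono mult_right_mono) auto
  also have "\<dots> = card S * (9/8 * (rounds / Q) * w S)" by simp
  also have "\<dots> \<le> (Q / 4) * (9/8 * (rounds / Q) * w S)"
    using card_S assms(1) w_nonneg[of S] by (intro mult_right_mono) auto
  also have "\<dots> = 9/32 * (rounds * w S)" using Q by simp
  finally show ?thesis .
qed

text \<open>The plays of level \<open>Q\<close> contain each element with frequency about \<open>1 / Q\<close>.  The supporting prices
  of level \<open>Q\<^sup>2\<close> therefore bound the average value of their traces on \<open>A\<close>.\<close>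

lemma level_gain:
  assumes Q: "1 \<le> Q" "Q \<le> 16 * n ^ 2" and A: "A \<subseteq> S"
    and charge: "(\<Sum>e\<in>A. Q * dual_sum (Q ^ 2) e) \<le> 1/6 * (4 * (\<Sum>e\<in>S. dual_sum (Q ^ 2) e) + 1)"
  shows "value_sum Q - value_sum (Q ^ 2) - 2 * regret \<le> (\<Sum>t<rounds. w (play Q t - A))"
proof -
  let ?g = "dual_sum (Q ^ 2)"
  let ?G = "\<lambda>X. real_of_int (\<Sum>e\<in>X. ?g e)"
  have Q0: "0 < real Q" using Q by simp
  have Q2: "1 \<le> Q ^ 2" using Q by (simp add: one_le_power)
  have R: "0 < real rounds" using rounds_pos by simp
  have sp: "rounds * w (play Q t \<inter> A) \<le> eta / Q ^ 2 * ?G (play Q t \<inter> A)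
       + (value_sum (Q ^ 2) + regret - eta / Q ^ 4 * ?G S)" for t
  proof -
    have "play Q t \<inter> A \<subseteq> S" using A by auto
    from supporting_prices[OF Q2 this] show ?thesis by (simp flip: power_mult)
  qed
  have "rounds * (\<Sum>t<rounds. w (play Q t \<inter> A)) \<le> eta / Q ^ 2 * (\<Sum>t<rounds. ?G (play Q t \<inter> A))
       + rounds * (value_sum (Q ^ 2) + regret - eta / Q ^ 4 * ?G S)"
    using sum_mono[of "{..<rounds}", OF sp] by (simp add: sum.distrib sum_distrib_left)
  also have "(\<Sum>t<rounds. ?G (play Q t \<inter> A)) = (\<Sum>e\<in>A. hits Q e * real_of_int (?g e))"
    using sum_play_swap[where Q = Q and A = A and f = "\<lambda>e. real_of_int (?g e)"] A by (simp add: Int_absorb1)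
  also have "\<dots> \<le> (\<Sum>e\<in>A. 9/8 * (rounds / Q) * real_of_int (?g e))"
    using hits_le[OF Q] dual_sum_nonneg by (intro sum_mono mult_right_mono) auto
  also have "\<dots> = 9/8 * (rounds / Q ^ 2) * (\<Sum>e\<in>A. Q * real_of_int (?g e))"
    using Q0 by (simp add: sum_distrib_left power2_eq_square mult.assoc)
  \<comment> \<open>Here \<open>9/8 * 4/6 = 3/4\<close> is below 1, so the price of the traces is
    covered by the term \<open>eta / Q ^ 4 * ?G S\<close> that the supporting inequality subtracts.
    The summand 1 leaves \<open>3/16 * eta / Q ^ 4\<close>, which fits into a second
    \<open>regret\<close>.\<close>
  also have "\<dots> \<le> 9/8 * (rounds / Q ^ 2) * (1/6 * (4 * ?G S + 1))"
  proof (rule mult_left_mono)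
    have "(\<Sum>e\<in>A. Q * real_of_int (?g e)) = real_of_int (\<Sum>e\<in>A. Q * ?g e)" by simp
    then show "(\<Sum>e\<in>A. Q * real_of_int (?g e)) \<le> 1/6 * (4 * ?G S + 1)"
      using charge by simp
  qed simp
  also have "\<dots> = rounds / Q ^ 2 * (3/4 * ?G S + 3/16)" using Q0 by (simp add: field_simps)
  finally have "rounds * (\<Sum>t<rounds. w (play Q t \<inter> A)) \<le>
     eta / Q ^ 2 * (rounds / Q ^ 2 * (3/4 * ?G S + 3/16))
       + rounds * (value_sum (Q ^ 2) + regret - eta / Q ^ 4 * ?G S)"
    using eta_pos Q0 by (simp add: divide_right_mono mult_left_mono)
  also have "\<dots> = rounds * (value_sum (Q ^ 2) + regret + (3/16 * (eta / Q ^ 4) - 1/4 * (eta / Q ^ 4) * ?G S))"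
    using Q0 by (simp add: field_simps flip: power_add)
  finally have "(\<Sum>t<rounds. w (play Q t \<inter> A))
      \<le> value_sum (Q ^ 2) + regret + (3/16 * (eta / Q ^ 4) - 1/4 * (eta / Q ^ 4) * ?G S)"
    using R by simp
  moreover have "0 \<le> 1/4 * (eta / Q ^ 4) * ?G S"
    using eta_pos dual_sum_nonneg by (intro mult_nonneg_nonneg) (auto intro!: sum_nonneg)
  moreover have "eta / Q ^ 4 \<le> eta / 1"
    using eta_pos Q0 Q by (intro divide_left_mono) (auto intro: one_le_power)
  ultimately have 1: "(\<Sum>t<rounds. w (play Q t \<inter> A)) \<le> value_sum (Q ^ 2) + 2 * regret"
    using eta_le_regret eta_pos by linarith
  have "value_sum Q \<le> (\<Sum>t<rounds. w (play Q t - A) + w (play Q t \<inter> A))"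
    unfolding value_sum_def
  proof (rule sum_mono)
    fix t
    have "play Q t = (play Q t - A) \<union> (play Q t \<inter> A)" by auto
    then show "w (play Q t) \<le> w (play Q t - A) + w (play Q t \<inter> A)"
      using play_sub[of Q t] w_subadd[of "play Q t - A" "play Q t \<inter> A"] by auto
  qed
  with 1 show ?thesis by (simp add: sum.distrib)
qed

end

section \<open>Splitting plays into blocks\<close>

text \<open>Lay the elements of \<open>T\<close> end to end in increasing order as intervals of
  length \<open>g i * Q\<close>, and cut the line into cells of length \<open>H\<close>. The block
  of \<open>e\<close> is the cell of its left end, so only the last interval of a block may
  overhang.\<close>

definition block_of :: "(nat \<Rightarrow> int) \<Rightarrow> nat set \<Rightarrow> nat \<Rightarrow> int \<Rightarrow> nat \<Rightarrow> int" where
  "block_of g T Q H e = (\<Sum>i\<in>{i \<in> T. i < e}. g i) * int Q div H"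

text \<open>The cap \<open>H\<close> bounds the contribution of the overhanging last element. A
  block has capped weight at most \<open>2 * H\<close>, so the divisor \<open>4 * H\<close> makes it
  cost at most \<open>B / 2\<close>. A capped offer equals \<open>B / 4\<close>, above every
  admissible cost, so only uncapped elements can reject.\<close>

definition share :: "real \<Rightarrow> (nat \<Rightarrow> int) \<Rightarrow> nat \<Rightarrow> int \<Rightarrow> nat \<Rightarrow> real" where
  "share B g Q H e = B * of_int (min (g e * int Q) H) / of_int (4 * H)"

definition block_vec ::
  "real \<Rightarrow> (nat \<Rightarrow> int) \<Rightarrow> nat set \<Rightarrow> nat \<Rightarrow> int \<Rightarrow> nat \<Rightarrow> nat \<Rightarrow> real" where
  "block_vec B g T Q H j =
     (\<lambda>e. if e \<in> T \<and> block_of g T Q H e = int j then share B g Q H e else 0)"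

definition block_count :: "(nat \<Rightarrow> int) \<Rightarrow> nat set \<Rightarrow> nat \<Rightarrow> int \<Rightarrow> nat" where
  "block_count g T Q H = nat ((\<Sum>i\<in>T. g i) * int Q div H) + 1"

definition block_vecs ::
  "real \<Rightarrow> (nat \<Rightarrow> int) \<Rightarrow> nat set \<Rightarrow> nat \<Rightarrow> int \<Rightarrow> (nat \<Rightarrow> real) list" where
  "block_vecs B g T Q H = map (block_vec B g T Q H) [0..<block_count g T Q H]"

text \<open>The overwritten coordinate stays above \<open>B / 4\<close>, so that \<open>f\<close> is always accepted, and it determines
  the position \<open>k\<close> in the output list.\<close>

definition marked :: "real \<Rightarrow> nat \<Rightarrow> nat \<Rightarrow> (nat \<Rightarrow> real) \<Rightarrow> nat \<Rightarrow> real" where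
  "marked B f k y = y(f := B * (k + 2) / (4 * (k + 1)))"

definition level :: "nat \<Rightarrow> nat" where "level i = 2 ^ (2 ^ i)"

lemma share_nonneg: "0 \<le> B \<Longrightarrow> 0 < H \<Longrightarrow> 0 \<le> g e \<Longrightarrow> 0 \<le> share B g Q H e"
  by (simp add: share_def)

lemma block_vec_nonneg: "0 \<le> B \<Longrightarrow> 0 < H \<Longrightarrow> (\<And>e. 0 \<le> g e) \<Longrightarrow> 0 \<le> block_vec B g T Q H j e"
  by (simp add: block_vec_def share_nonneg)

text \<open>The prefix sums of a block lie in an interval of length \<open>H\<close>, which bounds the total weight
  of all its elements but the last.\<close>

lemma block_weight:
  fixes g :: "nat \<Rightarrow> int"
  assumes T: "finite T" and H: "0 < H" and g: "\<And>e. 0 \<le> g e"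
  shows "(\<Sum>e\<in>{e \<in> T. block_of g T Q H e = j}. min (g e * int Q) H) \<le> 2 * H"
proof (cases "{e \<in> T. block_of g T Q H e = j} = {}")
  case True
  show ?thesis unfolding True using H by simp
next
  case False
  let ?P = "{e \<in> T. block_of g T Q H e = j}"
  let ?pre = "\<lambda>e. (\<Sum>i\<in>{i \<in> T. i < e}. g i)"
  have fin: "finite ?P" using T by simp
  define a b where "a = Min ?P" and "b = Max ?P"
  have a: "a \<in> ?P" unfolding a_def by (rule Min_in[OF fin False])
  have b: "b \<in> ?P" unfolding b_def by (rule Max_in[OF fin False])
  have ab: "a \<le> e" "e \<le> b" if "e \<in> ?P" for e
    unfolding a_def b_def by (rule Min_le[OF fin that], rule Max_ge[OF fin that])
  have "(\<Sum>e\<in>?P - {b}. g e) \<le> ?pre b - ?pre a"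
  proof -
    have "?pre b = ?pre a + (\<Sum>i\<in>{i \<in> T. a \<le> i \<and> i < b}. g i)"
    proof -
      have "{i \<in> T. i < b} = {i \<in> T. i < a} \<union> {i \<in> T. a \<le> i \<and> i < b}"
        using ab(2)[OF a] by auto
      then have "?pre b = sum g ({i \<in> T. i < a} \<union> {i \<in> T. a \<le> i \<and> i < b})"
        by (rule arg_cong)
      also have "\<dots> = ?pre a + (\<Sum>i\<in>{i \<in> T. a \<le> i \<and> i < b}. g i)"
        by (rule sum.union_disjoint) (use T in auto)
      finally show ?thesis .
    qed
    moreover have "(\<Sum>e\<in>?P - {b}. g e) \<le> (\<Sum>i\<in>{i \<in> T. a \<le> i \<and> i < b}. g i)"
    proof (rule sum_mono2)
      show "?P - {b} \<subseteq> {i \<in> T. a \<le> i \<and> i < b}"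
      proof
        fix e assume e: "e \<in> ?P - {b}"
        then have "a \<le> e" "e \<le> b" by (auto intro!: ab)
        with e show "e \<in> {i \<in> T. a \<le> i \<and> i < b}" by auto
      qed
    qed (use T g in auto)
    ultimately show ?thesis by simp
  qed
  from mult_right_mono[OF this, of "int Q"]
  have "(\<Sum>e\<in>?P - {b}. g e) * int Q \<le> ?pre b * int Q - ?pre a * int Q"
    unfolding left_diff_distrib by (simp only: of_nat_0_le_iff)
  also have "\<dots> \<le> H"
  proof -
    have j: "?pre b * int Q div H = j" "?pre a * int Q div H = j"
      using a b by (auto simp: block_of_def)
    define x y where "x = ?pre b * int Q" and "y = ?pre a * int Q"
    have "x div H = y div H" using j by (simp add: x_def y_def)
    then have "x = H * (y div H) + x mod H" using mult_div_mod_eq[of H x] by simp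
    then have "x - y = x mod H - y mod H" using mult_div_mod_eq[of H y] by linarith
    also have "\<dots> \<le> H" using H pos_mod_bound[of H x] pos_mod_sign[of H y] by linarith
    finally show ?thesis unfolding x_def y_def .
  qed
  finally have "(\<Sum>e\<in>?P - {b}. g e * int Q) \<le> H" by (simp add: sum_distrib_right)
  moreover have "(\<Sum>e\<in>?P - {b}. min (g e * int Q) H) \<le> (\<Sum>e\<in>?P - {b}. g e * int Q)"
    by (intro sum_mono) simp
  moreover have "(\<Sum>e\<in>?P. min (g e * int Q) H) = min (g b * int Q) H + (\<Sum>e\<in>?P - {b}. min (g e * int Q) H)"
    by (rule sum.remove[OF fin b])
  moreover have "min (g b * int Q) H \<le> H" by simp
  ultimately show ?thesis by linarith
qed

lemma block_vec_budget:
  assumes "finite T" "T \<subseteq> S" "finite S" "0 < H" "\<And>e. 0 \<le> g e" "0 \<le> B"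
  shows "sum (block_vec B g T Q H j) S \<le> B / 2"
proof -
  let ?P = "{e \<in> T. block_of g T Q H e = int j}"
  have "sum (block_vec B g T Q H j) S = sum (share B g Q H) ?P"
    unfolding block_vec_def using assms by (intro sum.mono_neutral_cong_right) auto
  also have "\<dots> = B * of_int (\<Sum>e\<in>?P. min (g e * int Q) H) / (4 * H)"
    by (simp add: share_def sum_distrib_left sum_divide_distrib)
  also have "\<dots> \<le> B * of_int (2 * H) / (4 * H)"
  proof (intro divide_right_mono mult_left_mono)
    show "real_of_int (\<Sum>e\<in>?P. min (g e * int Q) H) \<le> real_of_int (2 * H)"
      unfolding of_int_le_iff by (rule block_weight) (use assms in auto)
  qed (use assms in auto)
  also have "\<dots> = B / 2" using assms by simp
  finally show ?thesis .
qed

lemma block_of_less: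
  assumes "finite T" "e \<in> T" "0 < H" "\<And>e. 0 \<le> g e"
  shows "0 \<le> block_of g T Q H e" "block_of g T Q H e < int (block_count g T Q H)"
proof -
  have "(\<Sum>i\<in>{i \<in> T. i < e}. g i) \<le> (\<Sum>i\<in>T. g i)"
    using assms by (intro sum_mono2) auto
  then have "block_of g T Q H e \<le> (\<Sum>i\<in>T. g i) * int Q div H"
    unfolding block_of_def using assms by (intro zdiv_mono1 mult_right_mono) auto
  moreover show "0 \<le> block_of g T Q H e"
    unfolding block_of_def using assms by (simp add: pos_imp_zdiv_nonneg_iff sum_nonneg)
  ultimately show "block_of g T Q H e < int (block_count g T Q H)"
    by (simp add: block_count_def)
qed

section \<open>Iterated logarithms and the number of levels\<close>

lemma log2_ge_3: "8 \<le> n \<Longrightarrow> 3 \<le> log 2 (real n)"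
  by (subst le_log_iff) auto

text \<open>\<open>2 powr (3/2) = sqrt 8\<close> is below \<open>3 = log 2 8\<close>. The value
  \<open>3/2\<close> is used twice: \<open>16 * 3/2 = 24\<close> for the budget of the costs, and in
  the final count of vectors.\<close>

lemma log2_log2_ge:
  assumes "8 \<le> n"
  shows "3/2 \<le> log 2 (log 2 (real n))"
proof -
  have "2 powr (3/2) = (2 powr 3) powr (1/2 :: real)" by (simp only: powr_powr) simp
  also have "\<dots> = sqrt 8" by (simp add: powr_half_sqrt)
  also have "\<dots> \<le> 3" by (rule real_le_lsqrt) simp_all
  also have "3 \<le> log 2 (real n)" by (rule log2_ge_3[OF assms])
  finally have "log 2 (2 powr (3/2)) \<le> log 2 (log 2 (real n))"
    by (subst log_le_cancel_iff) (simp_all, smt (verit) powr_gt_zero)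
  then show ?thesis by simp
qed

text \<open>The last level below \<open>4 * n\<close> has
  \<open>2 ^ (N - 1) < 2 + log 2 n < 2 * log 2 n\<close>. Another logarithm gives
  \<open>N - 1 < 1 + log 2 (log 2 n)\<close>.\<close>

lemma level_count_le:
  fixes N n :: nat
  assumes "8 \<le> n" and "\<And>i. i < N \<Longrightarrow> level i < 4 * n"
  shows "N \<le> 2 + log 2 (log 2 (real n))"
proof (cases N)
  case 0
  then show ?thesis using log2_log2_ge[OF assms(1)] by simp
next
  case (Suc M)
  have n: "3 \<le> log 2 (real n)" by (rule log2_ge_3[OF assms(1)])
  have "real (level M) < real (4 * n)"
    using assms(2)[of M] Suc by linarith
  then have "log 2 (real (level M)) < log 2 (real (4 * n))"
    using assms(1) by (subst log_less_cancel_iff) (simp_all add: level_def)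
  also have "\<dots> = 2 + log 2 (real n)"
    using assms(1) log_pow_cancel[of 2 2] by (simp add: log_mult)
  also have "log 2 (real (level M)) = 2 ^ M" by (simp add: level_def log_nat_power)
  finally have "2 ^ M < 2 * log 2 (real n)" using n by simp
  then have "log 2 (2 ^ M) < log 2 (2 * log 2 (real n))"
    using n by (subst log_less_cancel_iff) auto
  also have "\<dots> = 1 + log 2 (log 2 (real n))" using n by (subst log_mult) auto
  finally show ?thesis using Suc by (simp add: log_nat_power)
qed

lemma level_Suc: "level (Suc i) = level i ^ 2"
  by (simp add: level_def power_mult mult.commute flip: power_mult)

lemma level_ge: "2 \<le> level i"
  using power_increasing[of 1 "2 ^ i" "2::nat"] by (simp add: level_def)

text \<open>A crude linear bound, enough wherever only polynomial size matters: total regret, list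
  lengths and running time.\<close>

lemma level_count_small:
  fixes N n :: nat
  assumes "8 \<le> n" and "\<And>i. i < N \<Longrightarrow> level i < 4 * n"
  shows "N \<le> n"
proof (rule ccontr)
  assume "\<not> N \<le> n"
  then have "level n < 4 * n" using assms by simp
  moreover have "4 * n < level n"
  proof -
    have "2 + n \<le> 2 ^ n" using assms(1)
    proof (induction n rule: dec_induct)
      case (step m)
      then show ?case by simp
    qed simp
    then have "2 ^ (2 + n) \<le> level n" unfolding level_def by (intro power_increasing) auto
    moreover have "4 * n < 2 ^ (2 + n)" by (simp add: power_add)
    ultimately show ?thesis by linarith
  qed
  ultimately show False by simp
qed

section \<open>Collecting the blocks of all rounds and levels\<close>

context price_dynamics
begin

text \<open>In the lengths \<open>g e * Q\<close> a play measures on average at most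
  \<open>9/8\<close> of the total dual sum, hence at most \<open>9/32\<close> of the width. A larger
  factor than 4 would save blocks but shrink every offer. The summand 1 avoids division by zero when
  all duals vanish.\<close>

definition width :: "nat \<Rightarrow> int" where
  "width Q = 4 * (\<Sum>e\<in>S. dual_sum (Q ^ 2) e) + 1"

definition play_vecs :: "real \<Rightarrow> nat \<Rightarrow> nat \<Rightarrow> (nat \<Rightarrow> real) list" where
  "play_vecs B Q t = block_vecs B (dual_sum (Q ^ 2)) (play Q t) Q (width Q)"

definition level_vecs :: "real \<Rightarrow> nat \<Rightarrow> nat \<Rightarrow> (nat \<Rightarrow> real) list" where
  "level_vecs B Q t = concat (map (play_vecs B Q) [0..<t])"

definition all_vecs :: "real \<Rightarrow> nat \<Rightarrow> (nat \<Rightarrow> real) list" where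
  "all_vecs B N = concat (map (\<lambda>i. level_vecs B (level i) rounds) [0..<N])"

lemma width_pos: "0 < width Q"
  using sum_nonneg[of S "dual_sum (Q ^ 2)"] dual_sum_nonneg by (simp add: width_def)

lemma finite_play: "finite (play Q t)"
  using play_sub finite_S finite_subset by blast

lemma w_UN:
  fixes m :: nat
  shows "(\<And>j. j < m \<Longrightarrow> X j \<subseteq> S) \<Longrightarrow> w (\<Union>j<m. X j) \<le> (\<Sum>j<m. w (X j))"
proof (induction m)
  case 0
  then show ?case by (simp add: w_empty)
next
  case (Suc m)
  have "w (X m \<union> (\<Union>j<m. X j)) \<le> w (X m) + w (\<Union>j<m. X j)"
    using Suc.prems by (intro w_subadd UN_least) auto
  moreover have "w (\<Union>j<m. X j) \<le> (\<Sum>j<m. w (X j))" using Suc by simp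
  ultimately show ?case by (simp add: lessThan_Suc)
qed

text \<open>An element of the play outside \<open>A\<close> is accepted by the vector of its own
  block, and subadditivity adds up the blocks. The disjunct \<open>e = f\<close> anticipates the
  overwritten coordinate; it only enlarges the sets.\<close>

lemma play_vecs_value:
  fixes B :: real and Q :: nat
  assumes c: "\<And>e. e \<in> S \<Longrightarrow> 0 \<le> c e"
  defines "A \<equiv> {e \<in> S. share B (dual_sum (Q ^ 2)) Q (width Q) e < c e}"
  shows "w (play Q t - A) \<le> (\<Sum>y\<leftarrow>play_vecs B Q t. w {e \<in> S. e = f \<or> c e \<le> y e})"
proof -
  let ?g = "dual_sum (Q ^ 2)" and ?H = "width Q" and ?T = "play Q t"
  let ?m = "block_count ?g ?T Q ?H"
  let ?X = "\<lambda>j. {e \<in> S. e = f \<or> c e \<le> block_vec B ?g ?T Q ?H j e}"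
  have "?T - A \<subseteq> (\<Union>j<?m. ?X j)"
  proof
    fix e assume e: "e \<in> ?T - A"
    then have "0 \<le> block_of ?g ?T Q ?H e" "block_of ?g ?T Q ?H e < int ?m"
      using finite_play width_pos dual_sum_nonneg by (auto intro!: block_of_less)
    then obtain j where j: "block_of ?g ?T Q ?H e = int j" "j < ?m"
      by (metis nat_int nonneg_int_cases of_nat_less_iff)
    then have "e \<in> ?X j" using e play_sub[of Q t] by (auto simp: block_vec_def A_def)
    with j show "e \<in> (\<Union>j<?m. ?X j)" by auto
  qed
  then have "w (?T - A) \<le> w (\<Union>j<?m. ?X j)" by (rule w_mono) auto
  also have "\<dots> \<le> (\<Sum>j<?m. w (?X j))" by (rule w_UN) auto
  also have "\<dots> = (\<Sum>y\<leftarrow>play_vecs B Q t. w {e \<in> S. e = f \<or> c e \<le> y e})"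
    by (simp add: play_vecs_def block_vecs_def interv_sum_list_conv_sum_set_nat comp_def atLeast0LessThan)
  finally show ?thesis .
qed

text \<open>This turns the budget of \<open>c\<close> into the charge required by
  \<open>level_gain\<close>: a rejected element satisfies
  \<open>g e * Q \<le> 4 * H / B * c e\<close>, and the costs sum to at most \<open>B / 24\<close>,
  which leaves \<open>H / 6\<close>.\<close>

lemma level_vecs_value:
  assumes Q: "1 \<le> Q" "Q \<le> 16 * n ^ 2" and B: "0 < B"
    and c: "\<And>e. e \<in> S \<Longrightarrow> 0 \<le> c e" "sum c S \<le> B / 24"
  shows "value_sum Q - value_sum (Q ^ 2) - 2 * regret
    \<le> (\<Sum>y\<leftarrow>level_vecs B Q rounds. w {e \<in> S. e = f \<or> c e \<le> y e})"
proof -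
  let ?g = "dual_sum (Q ^ 2)" and ?H = "width Q"
  define A where "A = {e \<in> S. share B ?g Q ?H e < c e}"
  have H: "0 < real_of_int ?H" using width_pos by simp
  have g: "real_of_int (?g e * int Q) \<le> 4 * ?H / B * c e" if "e \<in> A" for e
  proof -
    have "e \<in> S" using that by (simp add: A_def)
    then have "c e \<le> B / 24" using c finite_S member_le_sum[of e S c] by fastforce
    moreover have sh: "share B ?g Q ?H e < c e" using that by (simp add: A_def)
    ultimately have "share B ?g Q ?H e < B / 4" using B by simp
    \<comment> \<open>A capped offer would be \<open>B / 4\<close>, more than the cost of any single
      element, so \<open>e\<close> could not have been rejected.\<close>
    have "min (?g e * int Q) ?H < ?H"
    proof (rule ccontr)
      assume "\<not> min (?g e * int Q) ?H < ?H"
      then have "min (?g e * int Q) ?H = ?H" by simp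
      then have "share B ?g Q ?H e = B / 4" using H by (simp add: share_def)
      with \<open>share B ?g Q ?H e < B / 4\<close> show False by simp
    qed
    then have "min (?g e * int Q) ?H = ?g e * int Q" by simp
    with sh show ?thesis using B H by (simp add: share_def field_simps)
  qed
  have A: "A \<subseteq> S" by (auto simp: A_def)
  have "real_of_int (\<Sum>e\<in>A. int Q * ?g e) = (\<Sum>e\<in>A. real_of_int (?g e * int Q))"
    by (simp add: mult.commute)
  also have "\<dots> \<le> (\<Sum>e\<in>A. 4 * ?H / B * c e)" by (intro sum_mono g)
  also have "\<dots> = 4 * ?H / B * (\<Sum>e\<in>A. c e)" by (simp add: sum_distrib_left)
  also have "\<dots> \<le> 4 * ?H / B * (B / 24)"
  proof (intro mult_left_mono)
    have "sum c A \<le> sum c S" using A c finite_S by (intro sum_mono2) auto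
    then show "sum c A \<le> B / 24" using c by simp
  qed (use H B in auto)
  also have "\<dots> = 1/6 * (4 * (\<Sum>e\<in>S. ?g e) + 1)" using B by (simp add: width_def)
  finally have "value_sum Q - value_sum (Q ^ 2) - 2 * regret \<le> (\<Sum>t<rounds. w (play Q t - A))"
    by (intro level_gain Q A)
  also have "\<dots> \<le> (\<Sum>t<rounds. \<Sum>y\<leftarrow>play_vecs B Q t. w {e \<in> S. e = f \<or> c e \<le> y e})"
    unfolding A_def by (intro sum_mono play_vecs_value c)
  also have "\<dots> = (\<Sum>y\<leftarrow>level_vecs B Q rounds. w {e \<in> S. e = f \<or> c e \<le> y e})"
  proof -
    have "sum_list (map h (level_vecs B Q t)) = (\<Sum>r<t. sum_list (map h (play_vecs B Q r)))"
      for h :: "_ \<Rightarrow> real" and t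
      by (induction t) (simp_all add: level_vecs_def)
    then show ?thesis by simp
  qed
  finally show ?thesis .
qed

text \<open>A play yields at most one block more than its length measured in widths. By
  \<open>hits_le\<close> that length is on average at most \<open>9/8 * 1/4\<close>, whence
  \<open>41/32 = 1 + 9/32\<close>.\<close>

lemma level_vecs_length:
  assumes Q: "1 \<le> Q" "Q \<le> 16 * n ^ 2"
  shows "length (level_vecs B Q rounds) \<le> 41/32 * rounds"
proof -
  let ?g = "dual_sum (Q ^ 2)" and ?H = "real_of_int (width Q)"
  let ?G = "\<lambda>X. real_of_int (\<Sum>e\<in>X. ?g e)"
  have H: "0 < ?H" using width_pos by simp
  have one: "length (play_vecs B Q t) \<le> 1 + Q / ?H * ?G (play Q t)" for t
  proof -
    have "0 \<le> (\<Sum>i\<in>play Q t. ?g i) * int Q div width Q"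
      using width_pos[of Q] dual_sum_nonneg by (simp add: pos_imp_zdiv_nonneg_iff sum_nonneg)
    then have "length (play_vecs B Q t) = 1 + real_of_int ((\<Sum>i\<in>play Q t. ?g i) * int Q div width Q)"
      by (simp add: play_vecs_def block_vecs_def block_count_def)
    also have "\<dots> \<le> 1 + real_of_int ((\<Sum>i\<in>play Q t. ?g i) * int Q) / ?H"
      by (intro add_left_mono real_of_int_div4)
    finally show ?thesis by (simp add: mult.commute)
  qed
  have "length (level_vecs B Q t) = (\<Sum>r<t. length (play_vecs B Q r))" for t
    by (induction t) (simp_all add: level_vecs_def)
  then have "real (length (level_vecs B Q rounds)) = (\<Sum>t<rounds. real (length (play_vecs B Q t)))"
    by simp
  also have "\<dots> \<le> (\<Sum>t<rounds. 1 + Q / ?H * ?G (play Q t))" by (intro sum_mono one)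
  also have "\<dots> = rounds + Q / ?H * (\<Sum>t<rounds. ?G (play Q t))"
    by (simp add: sum.distrib sum_distrib_left)
  also have "(\<Sum>t<rounds. ?G (play Q t)) = (\<Sum>e\<in>S. hits Q e * real_of_int (?g e))"
  proof -
    have "play Q t \<inter> S = play Q t" for t using play_sub[of Q t] by auto
    then show ?thesis
      using sum_play_swap[where Q = Q and A = S and f = "\<lambda>e. real_of_int (?g e)"] by simp
  qed
  also have "\<dots> \<le> (\<Sum>e\<in>S. 9/8 * (rounds / Q) * real_of_int (?g e))"
    using hits_le[OF Q] dual_sum_nonneg by (intro sum_mono mult_right_mono) auto
  also have "\<dots> = 9/8 * (rounds / Q) * ?G S" by (simp add: sum_distrib_left)
  also have "Q / ?H * \<dots> = 9/8 * rounds * (?G S / ?H)" using Q by simp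
  also have "\<dots> \<le> 9/8 * rounds * (1/4)"
    using H by (intro mult_left_mono) (auto simp: field_simps width_def)
  finally show ?thesis using H Q by (simp add: mult_left_mono divide_right_mono)
qed

text \<open>The gains of consecutive levels telescope, because the square of a level is the next
  one. What remains is \<open>1/2 - 9/32 - 1/32 = 3/16\<close>.\<close>

lemma all_vecs_value:
  assumes N: "\<And>i. i < N \<Longrightarrow> level i < 4 * n" "4 * n \<le> level N" and B: "0 < B"
    and c: "\<And>e. e \<in> S \<Longrightarrow> 0 \<le> c e" "sum c S \<le> B / 24"
  shows "3/16 * (rounds * w S) \<le> (\<Sum>y\<leftarrow>all_vecs B N. w {e \<in> S. e = f \<or> c e \<le> y e})"
proof -
  let ?h = "\<lambda>y. w {e \<in> S. e = f \<or> c e \<le> y e}"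
  have n: "8 \<le> real n" using n_ge by simp
  \<comment> \<open>Also the level that first reaches \<open>4 * n\<close> is the square of one
    below \<open>4 * n\<close>; this is the origin of the cap \<open>16 * n ^ 2\<close>.\<close>
  have small: "level i \<le> 16 * n ^ 2" if "i \<le> N" for i
  proof (cases i)
    case 0
    then show ?thesis using n_ge by (simp add: level_def power2_eq_square)
  next
    case (Suc j)
    then have "level j \<le> 4 * n" using N(1)[of j] that by simp
    then have "level j ^ 2 \<le> (4 * n) ^ 2" by (rule power_mono) simp
    then show ?thesis using Suc by (simp add: level_Suc power_mult_distrib)
  qed
  have ge1: "1 \<le> level i" for i using level_ge[of i] by simp
  have "M \<le> N \<Longrightarrow> value_sum (level 0) - value_sum (level M) - 2 * M * regret \<le> sum_list (map ?h (all_vecs B M))"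
    for M
  proof (induction M)
    case 0
    then show ?case by (simp add: all_vecs_def)
  next
    case (Suc M)
    have "value_sum (level M) - value_sum (level (Suc M)) - 2 * regret
        \<le> sum_list (map ?h (level_vecs B (level M) rounds))"
      unfolding level_Suc using small[of M] Suc.prems by (intro level_vecs_value ge1 B c) auto
    moreover have "sum_list (map ?h (all_vecs B (Suc M))) =
        sum_list (map ?h (all_vecs B M)) + sum_list (map ?h (level_vecs B (level M) rounds))"
      by (simp add: all_vecs_def)
    ultimately show ?case using Suc by (simp add: algebra_simps)
  qed
  from this[of N] have "value_sum 2 - value_sum (level N) - 2 * N * regret \<le> sum_list (map ?h (all_vecs B N))"
    by (simp add: level_def)
  moreover note value_sum_first value_sum_last[OF N(2) small[OF order_refl]]
  \<comment> \<open>Two regrets per level and one from \<open>value_sum_first\<close>. With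
    \<open>2 * N + 1 \<le> 3 * n\<close> the relative error is
    \<open>3 / (2 * n ^ 2)\<close>.\<close>
  moreover have "(2 * N + 1) * regret \<le> rounds * w S / 32"
  proof -
    have "real (2 * N + 1) \<le> 3 * n" using level_count_small[OF n_ge, of N] N n_ge by simp
    then have "(2 * N + 1) * regret \<le> (3 * n) * (rounds * w S / (2 * n ^ 3))"
      using regret_le w_nonneg[of S] eta_pos eta_le_regret by (intro mult_mono) auto
    also have "\<dots> = rounds * w S * (3 / (2 * n ^ 2))"
      using n by (simp add: power_numeral_reduce)
    also have "\<dots> \<le> rounds * w S * (1 / 32)"
    proof (rule mult_left_mono)
      have "8 ^ 2 \<le> real n ^ 2" using n by (intro power_mono) auto
      then show "3 / (2 * n ^ 2) \<le> 1 / (32::real)" using n by (simp add: field_simps)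
    qed (use w_nonneg[of S] in auto)
    finally show ?thesis by simp
  qed
  ultimately show ?thesis by (simp add: algebra_simps)
qed

lemma all_vecs_length:
  assumes N: "\<And>i. i < N \<Longrightarrow> level i < 4 * n"
  shows "length (all_vecs B N) \<le> 41/32 * (N * rounds)"
  using N
proof (induction N)
  case 0
  then show ?case by (simp add: all_vecs_def)
next
  case (Suc M)
  have "level M \<le> 4 * n" using Suc.prems[of M] by simp
  also have "\<dots> \<le> 16 * n ^ 2" using n_ge by (simp add: power2_eq_square)
  finally have "length (level_vecs B (level M) rounds) \<le> 41/32 * rounds"
    using level_ge[of M] by (intro level_vecs_length) auto
  moreover have "length (all_vecs B M) \<le> 41/32 * (M * rounds)" using Suc by simp
  moreover have "length (all_vecs B (Suc M)) = length (all_vecs B M) + length (level_vecs B (level M) rounds)"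
    by (simp add: all_vecs_def)
  ultimately show ?case by (simp add: algebra_simps)
qed

lemma all_vecs_nth:
  assumes B: "0 \<le> B" and k: "k < length (all_vecs B N)"
  shows "0 \<le> (all_vecs B N ! k) e" "e \<notin> S \<Longrightarrow> (all_vecs B N ! k) e = 0" "sum (all_vecs B N ! k) S \<le> B / 2"
proof -
  have "all_vecs B N ! k \<in> set (all_vecs B N)" using k by simp
  then obtain Q t j where y: "all_vecs B N ! k = block_vec B (dual_sum (Q ^ 2)) (play Q t) Q (width Q) j"
    by (auto simp: all_vecs_def level_vecs_def play_vecs_def block_vecs_def)
  show "0 \<le> (all_vecs B N ! k) e"
    unfolding y using B width_pos dual_sum_nonneg by (intro block_vec_nonneg)
  show "e \<notin> S \<Longrightarrow> (all_vecs B N ! k) e = 0"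
    unfolding y using play_sub[of Q t] by (auto simp: block_vec_def)
  show "sum (all_vecs B N ! k) S \<le> B / 2"
    unfolding y using B width_pos dual_sum_nonneg finite_play play_sub finite_S
    by (intro block_vec_budget)
qed

text \<open>The overwritten coordinate is largest at \<open>k = 0\<close>, where it equals
  \<open>B / 2\<close>; the block itself uses at most the other half.\<close>

lemma marked_budget:
  assumes B: "0 \<le> B" and k: "k < length (all_vecs B N)" and f: "f \<in> S"
  shows "0 \<le> marked B f k (all_vecs B N ! k) e"
    "e \<notin> S \<Longrightarrow> marked B f k (all_vecs B N ! k) e = 0"
    "sum (marked B f k (all_vecs B N ! k)) S \<le> B"
proof -
  let ?y = "all_vecs B N ! k"
  show "0 \<le> marked B f k ?y e" "e \<notin> S \<Longrightarrow> marked B f k ?y e = 0"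
    using all_vecs_nth[OF B k] B f by (auto simp: marked_def)
  have "sum (marked B f k ?y) S = B * (k + 2) / (4 * (k + 1)) + sum (marked B f k ?y) (S - {f})"
    using f finite_S by (simp add: sum.remove marked_def)
  also have "sum (marked B f k ?y) (S - {f}) = sum ?y (S - {f})"
    by (intro sum.cong) (auto simp: marked_def)
  also have "\<dots> \<le> sum ?y S"
    using finite_S all_vecs_nth[OF B k] by (intro sum_mono2) auto
  also have "\<dots> \<le> B / 2" using all_vecs_nth[OF B k] by simp
  also have "B * (k + 2) / (4 * (k + 1)) \<le> B / 2"
    using B by (simp add: field_simps)
  finally show "sum (marked B f k ?y) S \<le> B" by simp
qed

lemma expected_value:
  fixes B :: real and N :: nat
  assumes N: "\<And>i. i < N \<Longrightarrow> level i < 4 * n" "4 * n \<le> level N" and B: "0 < B" and f: "f \<in> S"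
    and c: "\<And>e. e \<in> S \<Longrightarrow> 0 \<le> c e" "sum c S \<le> B / (16 * log 2 (log 2 n))"
  defines "m \<equiv> length (all_vecs B N)"
  shows "0 < m"
    "w S / (16 * log 2 (log 2 n)) \<le> (\<Sum>k<m. w {e \<in> S. c e \<le> marked B f k (all_vecs B N ! k) e}) / m"
proof -
  define y where "y = log 2 (log 2 (real n))"
  have y: "3/2 \<le> y" unfolding y_def by (rule log2_log2_ge[OF n_ge])
  have V: "0 < w S" using s_pos s_le by simp
  have "sum c S \<le> B / 24"
  proof -
    have "B / (16 * y) \<le> B / 24" using y B by (intro divide_left_mono) auto
    then show ?thesis using c(2) by (simp add: y_def)
  qed
  note val = all_vecs_value[OF N B c(1) this, of f]
  have cf: "c f \<le> B / 4"
    using \<open>sum c S \<le> B / 24\<close> member_le_sum[OF f, of c] c(1) finite_S B by fastforce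
  have eq: "{e \<in> S. e = f \<or> c e \<le> (all_vecs B N ! k) e} = {e \<in> S. c e \<le> marked B f k (all_vecs B N ! k) e}"
    for k
  proof -
    have "B / 4 \<le> B * (k + 2) / (4 * (k + 1))" using B by (simp add: field_simps)
    with cf have "c f \<le> marked B f k (all_vecs B N ! k) f"
      unfolding marked_def fun_upd_same by (rule order_trans)
    then show ?thesis by (auto simp: marked_def)
  qed
  define E where "E = (\<Sum>k<m. w {e \<in> S. c e \<le> marked B f k (all_vecs B N ! k) e})"
  have E: "3/16 * (rounds * w S) \<le> E"
    using val by (simp add: E_def m_def sum_list_sum_nth atLeast0LessThan eq)
  moreover have "0 < rounds * w S" using V rounds_pos by simp
  ultimately have "0 < E" by linarith
  then show m: "0 < m" by (cases m) (auto simp: E_def)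
  have "m \<le> 41/32 * (N * rounds)" unfolding m_def by (rule all_vecs_length[OF N(1)])
  also have "\<dots> \<le> 41/32 * ((2 + y) * rounds)"
    using mult_right_mono[OF level_count_le[OF n_ge N(1)], of N "real rounds"] by (simp add: y_def)
  also have "\<dots> \<le> 3/16 * rounds * (16 * y)"
  proof -
    have "41/32 * (2 + y) \<le> 3 * y" using y by simp
    then have "rounds * (41/32 * (2 + y)) \<le> rounds * (3 * y)" by (intro mult_left_mono) auto
    then show ?thesis by (simp add: distrib_left distrib_right mult_ac)
  qed
  finally have "w S * m \<le> w S * (3/16 * rounds * (16 * y))" using V by (intro mult_left_mono) auto
  also have "\<dots> = 3/16 * (rounds * w S) * (16 * y)" by simp
  also have "\<dots> \<le> E * (16 * y)" using E y by (intro mult_right_mono) auto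
  finally show "w S / (16 * log 2 (log 2 n)) \<le> (\<Sum>k<m. w {e \<in> S. c e \<le> marked B f k (all_vecs B N ! k) e}) / m"
    using m y unfolding E_def[symmetric] y_def[symmetric] by (simp add: pos_le_divide_eq pos_divide_le_eq)
qed

text \<open>\<open>(k + 2) / (k + 1) = 1 + 1 / (k + 1)\<close> is strictly decreasing in
  \<open>k\<close>.\<close>

lemma marked_inj:
  assumes "0 < B" "marked B f k y f = marked B f k' y' f"
  shows "k = k'"
proof -
  have "(real k + 2) * (real k' + 1) = (real k' + 2) * (real k + 1)"
    using assms by (simp add: marked_def frac_eq_eq distrib_left distrib_right)
  then show "k = k'" by (simp add: distrib_left distrib_right)
qed

end

section \<open>Cost logic for programs\<close>

abbreviation var :: "string \<Rightarrow> aexp" where "var x \<equiv> Cell x (Cst 0)"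

abbreviation set_var :: "string \<Rightarrow> aexp \<Rightarrow> com" where "set_var x a \<equiv> Assign x (Cst 0) a"

definition For :: "string \<Rightarrow> aexp \<Rightarrow> com \<Rightarrow> com" where
  "For i b c = Seq (set_var i (Cst 0))
     (While (Sub b (var i)) (Seq c (set_var i (Add (var i) (Cst 1)))))"

definition upd :: "state \<Rightarrow> string \<Rightarrow> int \<Rightarrow> int \<Rightarrow> state" where
  "upd s x i v = s(x := (s x)(i := v))"

lemma upd_apply: "upd s x i v y j = (if y = x \<and> j = i then v else s y j)"
  by (simp add: upd_def)

definition frame :: "string set \<Rightarrow> state \<Rightarrow> state \<Rightarrow> bool" where
  "frame X s s' \<longleftrightarrow> (\<forall>x. x \<notin> X \<longrightarrow> s' x = s x)"

lemma frame_refl [simp]: "frame X s s"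
  by (simp add: frame_def)

lemma frameD: "frame X s s' \<Longrightarrow> x \<notin> X \<Longrightarrow> s' x = s x"
  by (simp add: frame_def)

lemma frame_upd: "frame X s s' \<Longrightarrow> x \<in> X \<Longrightarrow> frame X s (upd s' x i v)"
  by (auto simp: frame_def upd_def)

lemma frame_trans: "frame X s s' \<Longrightarrow> frame Y s' s'' \<Longrightarrow> X \<subseteq> Z \<Longrightarrow> Y \<subseteq> Z \<Longrightarrow> frame Z s s''"
  by (auto simp: frame_def) (metis subsetD)

text \<open>Once all cells are bounded, evaluating a fixed expression costs linearly many bits in
  \<open>W\<close>, address computations included. Running times can then be counted in
  operations.\<close>

definition bounded_state :: "nat \<Rightarrow> state \<Rightarrow> bool" where
  "bounded_state W s \<longleftrightarrow> (\<forall>x i. \<bar>s x i\<bar> \<le> 2 ^ W)"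

lemma bounded_stateD: "bounded_state W s \<Longrightarrow> \<bar>s x i\<bar> \<le> 2 ^ W"
  by (simp add: bounded_state_def)

lemma bounded_upd: "bounded_state W s \<Longrightarrow> \<bar>v\<bar> \<le> 2 ^ W \<Longrightarrow> bounded_state W (upd s x i v)"
  by (simp add: bounded_state_def upd_apply)

text \<open>One rule serves all binary operations: every subterm is given at least one bit, so
  \<open>2 ^ i + 2 ^ j \<le> 2 ^ (i + j)\<close> and sums obey the bound for products.\<close>

fun value_bits :: "nat \<Rightarrow> aexp \<Rightarrow> nat" where
  "value_bits W (Cst k) = nat \<bar>k\<bar> + 1"
| "value_bits W (Cell x a) = W + 1"
| "value_bits W (Add a b) = value_bits W a + value_bits W b"
| "value_bits W (Sub a b) = value_bits W a + value_bits W b"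
| "value_bits W (Mul a b) = value_bits W a + value_bits W b"
| "value_bits W (Quo a b) = value_bits W a + value_bits W b"

fun cost_bound :: "nat \<Rightarrow> aexp \<Rightarrow> nat" where
  "cost_bound W (Cst k) = nat \<bar>k\<bar> + 3"
| "cost_bound W (Cell x a) = cost_bound W a + W + 3"
| "cost_bound W (Add a b) = cost_bound W a + cost_bound W b + (value_bits W a + value_bits W b + 2)"
| "cost_bound W (Sub a b) = cost_bound W a + cost_bound W b + (value_bits W a + value_bits W b + 2)"
| "cost_bound W (Mul a b) = cost_bound W a + cost_bound W b + (value_bits W a + value_bits W b + 2)"
| "cost_bound W (Quo a b) = cost_bound W a + cost_bound W b + (value_bits W a + value_bits W b + 2)"

lemma bits_le: "\<bar>k\<bar> \<le> 2 ^ v \<Longrightarrow> bits k \<le> v + 2"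
proof -
  assume "\<bar>k\<bar> \<le> 2 ^ v"
  then have "nat \<bar>k\<bar> \<le> 2 ^ v" by (simp add: nat_le_iff)
  also have "\<dots> < 2 ^ (v + 1)" by simp
  finally have "floorlog 2 (nat \<bar>k\<bar>) \<le> v + 1"
    by (intro floorlog_leI) (auto simp flip: of_nat_power)
  then show ?thesis by (simp add: bits_def)
qed

lemma value_bits_pos: "1 \<le> value_bits W a"
  by (induction a) auto

text \<open>Rounding down moves negative quotients away from zero, yet for
  \<open>\<bar>b\<bar> \<ge> 1\<close> never past \<open>\<bar>a\<bar>\<close>; division by zero
  gives zero.\<close>

lemma abs_div_le: "\<bar>a div b\<bar> \<le> \<bar>a\<bar>" for a b :: int
proof (cases "b = 0")
  case False
  have "\<bar>a div b\<bar> * 1 \<le> \<bar>a\<bar>"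
  proof (cases "0 < b")
    case True
    then show ?thesis
      by (smt (verit) div_by_1 int_div_less_self nonneg1_imp_zdiv_pos_iff pos_imp_zdiv_neg_iff zdiv_mono2_neg zdiv_mono2)
  next
    case b: False
    then have "a div b = (- a) div (- b)" by simp
    then show ?thesis using b False
      by (smt (verit) div_by_1 int_div_less_self nonneg1_imp_zdiv_pos_iff pos_imp_zdiv_neg_iff zdiv_mono2_neg zdiv_mono2)
  qed
  then show ?thesis by simp
qed simp

lemma two_pow_add_le: "1 \<le> i \<Longrightarrow> 1 \<le> j \<Longrightarrow> (2::int) ^ i + 2 ^ j \<le> 2 ^ (i + j)"
proof -
  assume "1 \<le> i" "1 \<le> j"
  then have "(2::int) ^ 1 \<le> 2 ^ i" "(2::int) ^ 1 \<le> 2 ^ j" by (intro power_increasing; simp)+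
  then have "0 \<le> ((2::int) ^ i - 1) * (2 ^ j - 1) - 1"
    using mult_mono[of 1 "(2::int) ^ i - 1" 1 "2 ^ j - 1"] by simp
  then show ?thesis by (simp add: power_add algebra_simps)
qed

lemma aval_bound:
  assumes "bounded_state W s"
  shows "\<bar>aval s a\<bar> \<le> 2 ^ value_bits W a"
proof (induction a)
  case (Cst k)
  have "nat \<bar>k\<bar> < 2 ^ (nat \<bar>k\<bar> + 1)" using less_exp[of "nat \<bar>k\<bar> + 1"] by linarith
  then have "int (nat \<bar>k\<bar>) < int (2 ^ (nat \<bar>k\<bar> + 1))" by (simp only: of_nat_less_iff)
  then show ?case by simp
next
  case (Cell x a)
  have "\<bar>s x (aval s a)\<bar> \<le> 2 ^ W" by (rule bounded_stateD[OF assms])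
  also have "(2::int) ^ W \<le> 2 ^ (W + 1)" by simp
  finally show ?case by simp
next
  case (Add a b)
  then have "\<bar>aval s a + aval s b\<bar> \<le> 2 ^ value_bits W a + 2 ^ value_bits W b" by linarith
  also have "\<dots> \<le> 2 ^ (value_bits W a + value_bits W b)" by (intro two_pow_add_le value_bits_pos)
  finally show ?case by simp
next
  case (Sub a b)
  then have "\<bar>aval s a - aval s b\<bar> \<le> 2 ^ value_bits W a + 2 ^ value_bits W b" by linarith
  also have "\<dots> \<le> 2 ^ (value_bits W a + value_bits W b)" by (intro two_pow_add_le value_bits_pos)
  finally show ?case by simp
next
  case (Mul a b)
  then have "\<bar>aval s a\<bar> * \<bar>aval s b\<bar> \<le> 2 ^ value_bits W a * 2 ^ value_bits W b" by (intro mult_mono) auto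
  then show ?case by (simp add: abs_mult power_add)
next
  case (Quo a b)
  have "\<bar>aval s a div aval s b\<bar> \<le> \<bar>aval s a\<bar>" by (rule abs_div_le)
  also have "\<dots> \<le> 2 ^ value_bits W a" by (rule Quo)
  also have "\<dots> \<le> (2::int) ^ (value_bits W a + value_bits W b)" by (intro power_increasing) auto
  finally show ?case by simp
qed

lemma acost_bound:
  assumes "bounded_state W s"
  shows "acost s a \<le> cost_bound W a"
proof -
  note b = bits_le[OF aval_bound[OF assms]]
  have c: "bits (s x i) \<le> W + 2" for x i by (rule bits_le[OF bounded_stateD[OF assms]])
  show ?thesis
  proof (induction a)
    case (Cst k)
    then show ?case using b[of "Cst k"] by simp
  next
    case (Cell x a)
    then show ?case using c[of x "aval s a"] by simp
  next
    case (Add a1 a2)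
    then show ?case using b[of "Add a1 a2"] by simp
  next
    case (Sub a1 a2)
    then show ?case using b[of "Sub a1 a2"] by simp
  next
    case (Mul a1 a2)
    then show ?case using b[of "Mul a1 a2"] by simp
  next
    case (Quo a1 a2)
    then show ?case using b[of "Quo a1 a2"] by simp
  qed
qed

text \<open>The lower bound on \<open>K\<close> pays for one oracle query, which is charged for
  \<open>n\<close> numerators and \<open>n\<close> denominators of at most \<open>W + 2\<close> bits
  each.\<close>

locale cost_logic =
  fixes n :: nat and orc :: "(nat \<Rightarrow> real) \<Rightarrow> nat set" and W :: nat and K :: nat
  assumes K_ge: "2 * n * (W + 3) + 1 \<le> K"
begin

text \<open>Costs are counted in units of \<open>K\<close>, an upper bound for the cost of a single operation.\<close>

definition wp :: "com \<Rightarrow> nat \<Rightarrow> (state \<Rightarrow> bool) \<Rightarrow> state \<Rightarrow> bool" where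
  "wp c \<tau> P s \<longleftrightarrow> (\<exists>t s'. exec n orc c s t s' \<and> t \<le> K * \<tau> \<and> P s')"

abbreviation bounded :: "state \<Rightarrow> bool" where "bounded \<equiv> bounded_state W"

lemma K_pos: "1 \<le> K"
  using K_ge by linarith

lemma wp_mono: "wp c \<tau> P s \<Longrightarrow> \<tau> \<le> \<tau>' \<Longrightarrow> (\<And>s'. P s' \<Longrightarrow> P' s') \<Longrightarrow> wp c \<tau>' P' s"
  unfolding wp_def by (meson le_trans mult_le_mono2)

lemma wp_Skip: "P s \<Longrightarrow> wp Skip 1 P s"
  unfolding wp_def using K_pos exec.Skip[of n orc s] by auto

lemma wp_Assign:
  assumes "bounded s" "cost_bound W a + cost_bound W b + 1 \<le> K"
    and "P (upd s x (aval s a) (aval s b))"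
  shows "wp (Assign x a b) 1 P s"
proof -
  have "1 + acost s a + acost s b \<le> K * 1"
    using acost_bound[OF assms(1), of a] acost_bound[OF assms(1), of b] assms(2) by linarith
  then show ?thesis unfolding wp_def using assms(3) exec.Assign unfolding upd_def by blast
qed

lemma wp_AssignI:
  assumes "bounded s" "cost_bound W a + cost_bound W b + 1 \<le> K"
    and "aval s a = i" "aval s b = v" "\<bar>v\<bar> \<le> 2 ^ W"
    and "bounded (upd s x i v) \<Longrightarrow> P (upd s x i v)"
  shows "wp (Assign x a b) 1 P s"
  using assms bounded_upd[OF assms(1,5)] by (intro wp_Assign) auto

lemma wp_Seq: "wp c1 t1 (wp c2 t2 P) s \<Longrightarrow> wp (Seq c1 c2) (t1 + t2 + 1) P s"
proof -
  assume "wp c1 t1 (wp c2 t2 P) s"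
  then obtain u1 s1 u2 s2 where
    "exec n orc c1 s u1 s1" "u1 \<le> K * t1" "exec n orc c2 s1 u2 s2" "u2 \<le> K * t2" "P s2"
    unfolding wp_def by blast
  moreover from this have "1 + u1 + u2 \<le> K * (t1 + t2 + 1)"
    using K_pos by (simp add: distrib_left)
  ultimately show ?thesis unfolding wp_def using exec.Seq by blast
qed

lemma wp_Cond:
  assumes "bounded s" "cost_bound W a + 1 \<le> K"
    and "0 < aval s a \<Longrightarrow> wp c1 \<tau> P s" "\<not> 0 < aval s a \<Longrightarrow> wp c2 \<tau> P s"
  shows "wp (Cond a c1 c2) (\<tau> + 1) P s"
proof -
  have c: "1 + acost s a + u \<le> K * (\<tau> + 1)" if "u \<le> K * \<tau>" for u
    using acost_bound[OF assms(1), of a] assms(2) that by simp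
  show ?thesis
  proof (cases "0 < aval s a")
    case True
    from assms(3)[OF this] obtain u s' where "exec n orc c1 s u s'" "u \<le> K * \<tau>" "P s'"
      unfolding wp_def by blast
    then show ?thesis unfolding wp_def using exec.CondTrue[OF True] c by blast
  next
    case False
    from assms(4)[OF this] obtain u s' where "exec n orc c2 s u s'" "u \<le> K * \<tau>" "P s'"
      unfolding wp_def by blast
    then show ?thesis unfolding wp_def using exec.CondFalse[OF False] c by blast
  qed
qed

lemma wp_While:
  assumes "cost_bound W a + 1 \<le> K"
    and inv: "\<And>i s. i < N \<Longrightarrow> I i s \<Longrightarrow> bounded s \<and> 0 < aval s a \<and> wp c \<tau> (I (Suc i)) s"
    and fin: "\<And>s. I N s \<Longrightarrow> bounded s \<and> \<not> 0 < aval s a \<and> P s"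
    and init: "I 0 s"
  shows "wp (While a c) (N * (\<tau> + 1) + 1) P s"
proof -
  have "j \<le> N \<Longrightarrow> I (N - j) s \<Longrightarrow> wp (While a c) (j * (\<tau> + 1) + 1) P s" for j s
  proof (induction j arbitrary: s)
    case 0
    then have "bounded s" "\<not> 0 < aval s a" "P s" using fin by auto
    moreover from acost_bound[OF this(1), of a] assms(1) have "1 + acost s a \<le> K * (0 * (\<tau> + 1) + 1)" by simp
    ultimately show ?case unfolding wp_def using exec.WhileFalse by blast
  next
    case (Suc j)
    then have b: "bounded s" and a: "0 < aval s a" and w: "wp c \<tau> (I (Suc (N - Suc j))) s"
      using inv[of "N - Suc j" s] by auto
    have "Suc (N - Suc j) = N - j" using Suc.prems by simp
    with w obtain u s1 where u: "exec n orc c s u s1" "u \<le> K * \<tau>" "I (N - j) s1"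
      unfolding wp_def by auto
    with Suc obtain u' s2 where u': "exec n orc (While a c) s1 u' s2" "u' \<le> K * (j * (\<tau> + 1) + 1)" "P s2"
      unfolding wp_def by (meson Suc_leD)
    have "1 + acost s a + u + u' \<le> K * (Suc j * (\<tau> + 1) + 1)"
      using acost_bound[OF b, of a] assms(1) u u' by (simp add: algebra_simps)
    then show ?case unfolding wp_def using exec.WhileTrue[OF a u(1) u'(1)] u'(3) by blast
  qed
  from this[of N s] init show ?thesis by simp
qed

text \<open>The invariant must be insensitive to the counter, which is reset before the loop and
  increased after each body. The bound must be known for \<open>j = N\<close> as well, since the
  test that ends the loop evaluates it too.\<close>

lemma wp_For:
  assumes "cost_bound W b + value_bits W b + 4 * W + 40 \<le> K" and N: "int N \<le> 2 ^ W" and s: "bounded s"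
    and init: "I 0 s"
    and stable: "\<And>j s' v. I j s' \<Longrightarrow> I j (upd s' i 0 v)"
    and bound: "\<And>j s'. j \<le> N \<Longrightarrow> I j s' \<Longrightarrow> aval s' b = int N"
    and body: "\<And>j s'. j < N \<Longrightarrow> bounded s' \<Longrightarrow> I j s' \<Longrightarrow> s' i 0 = int j \<Longrightarrow>
        wp c \<tau> (\<lambda>s''. bounded s'' \<and> s'' i 0 = int j \<and> I (Suc j) s'') s'"
    and fin: "\<And>s'. I N s' \<Longrightarrow> bounded s' \<Longrightarrow> P s'"
  shows "wp (For i b c) (N * (\<tau> + 3) + 3) P s"
proof -
  have K: "W + 16 \<le> K" "cost_bound W (Sub b (var i)) + 1 \<le> K" "2 * W + 30 \<le> K"
    using assms(1) by auto
  have "wp (While (Sub b (var i)) (Seq c (set_var i (Add (var i) (Cst 1))))) (N * ((\<tau> + 1 + 1) + 1) + 1) P (upd s i 0 0)"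
  proof (rule wp_While[where I = "\<lambda>j s'. j \<le> N \<and> bounded s' \<and> I j s' \<and> s' i 0 = int j"])
    show "cost_bound W (Sub b (var i)) + 1 \<le> K" by (rule K)
    show "0 \<le> N \<and> bounded (upd s i 0 0) \<and> I 0 (upd s i 0 0) \<and> upd s i 0 0 i 0 = int 0"
      using stable[OF init] bounded_upd[OF s] by (simp add: upd_apply)
  next
    fix s' assume I: "N \<le> N \<and> bounded s' \<and> I N s' \<and> s' i 0 = int N"
    then show "bounded s' \<and> \<not> 0 < aval s' (Sub b (var i)) \<and> P s'"
      using bound[of N s'] fin[of s'] by simp
  next
    fix j s' assume j: "j < N" and I: "j \<le> N \<and> bounded s' \<and> I j s' \<and> s' i 0 = int j"
    have "wp (Seq c (set_var i (Add (var i) (Cst 1)))) (\<tau> + 1 + 1)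
         (\<lambda>s'. Suc j \<le> N \<and> bounded s' \<and> I (Suc j) s' \<and> s' i 0 = int (Suc j)) s'"
    proof (rule wp_Seq)
      show "wp c \<tau> (wp (set_var i (Add (var i) (Cst 1))) 1
          (\<lambda>s'. Suc j \<le> N \<and> bounded s' \<and> I (Suc j) s' \<and> s' i 0 = int (Suc j))) s'"
      proof (rule wp_mono[OF body[of j s']])
        fix s'' assume s'': "bounded s'' \<and> s'' i 0 = int j \<and> I (Suc j) s''"
        moreover have "\<bar>int (Suc j)\<bar> \<le> 2 ^ W" using j N by linarith
        ultimately have "bounded (upd s'' i 0 (int (Suc j)))" by (intro bounded_upd) auto
        with s'' show "wp (set_var i (Add (var i) (Cst 1))) 1
          (\<lambda>s'. Suc j \<le> N \<and> bounded s' \<and> I (Suc j) s' \<and> s' i 0 = int (Suc j)) s''"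
          using j K stable[of "Suc j" s'' "int (Suc j)"] by (intro wp_Assign) (auto simp: upd_apply add.commute)
      qed (use j I in auto)
    qed
    then show "bounded s' \<and> 0 < aval s' (Sub b (var i)) \<and>
        wp (Seq c (set_var i (Add (var i) (Cst 1)))) (\<tau> + 1 + 1)
         (\<lambda>s'. Suc j \<le> N \<and> bounded s' \<and> I (Suc j) s' \<and> s' i 0 = int (Suc j)) s'"
      using I j bound[of j s'] by simp
  qed
  then have "wp (For i b c) (1 + (N * ((\<tau> + 1 + 1) + 1) + 1) + 1) P s"
    unfolding For_def using s K by (intro wp_Seq wp_Assign) auto
  then show ?thesis by (rule wp_mono) (simp_all add: algebra_simps)
qed

lemma wp_Query:
  assumes s: "bounded s"
    and "\<And>i. i < n \<Longrightarrow> 0 \<le> s p (int i) \<and> 0 < s q (int i)"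
    and "P (s(r := (\<lambda>k. if 0 \<le> k \<and> k < int n
                  then of_bool (nat k \<in> orc (\<lambda>i. of_int (s p (int i)) / of_int (s q (int i))))
                  else s r k)))"
  shows "wp (Query p q r) 1 P s"
proof -
  have "bits (s x i) \<le> W + 2" for x i by (rule bits_le[OF bounded_stateD[OF s]])
  then have "(\<Sum>i<n. bits (s p (int i)) + bits (s q (int i))) \<le> (\<Sum>i<n. (W + 2) + (W + 2))"
    by (intro sum_mono add_mono)
  also have "\<dots> = 2 * n * (W + 2)" by simp
  also have "\<dots> \<le> 2 * n * (W + 3)" by (intro mult_left_mono) auto
  finally have "1 + (\<Sum>i<n. bits (s p (int i)) + bits (s q (int i))) \<le> K * 1"
    using K_ge by linarith
  with exec.Query[of n s p q orc r, OF assms(2)] assms(3) show ?thesis unfolding wp_def by blast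
qed

end

text \<open>Elements outside \<open>S\<close> get the price \<open>Z = 2\<^sup>L\<close>, which exceeds every value, so that the demand set
  lies in \<open>S\<close>.\<close>

abbreviation price_exp :: "aexp \<Rightarrow> aexp" where
  "price_exp a \<equiv> Add (Mul (Cell ''S'' (var ''e'')) a)
     (Mul (Sub (Cst 1) (Cell ''S'' (var ''e''))) (Mul (var ''Z'') (var ''den'')))"

definition ask :: "aexp \<Rightarrow> com" where
  "ask a = Seq
     (For ''e'' (var ''n'') (Seq
       (Assign ''P'' (var ''e'')
         (price_exp a))
       (Assign ''Q'' (var ''e'') (var ''den''))))
     (Query ''P'' ''Q'' ''T'')"

abbreviation mark_scale :: com where
  "mark_scale \<equiv> For ''e'' (var ''n'') (Cond (Cell ''T'' (var ''e'')) (set_var ''x'' (var ''y'')) Skip)"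

abbreviation scale_round :: com where
  "scale_round \<equiv> Seq (ask (var ''y'')) (Seq mark_scale (set_var ''y'' (Mul (Cst 2) (var ''y''))))"

definition scale_search :: com where
  "scale_search =
     Seq (set_var ''x'' (Cst 0)) (Seq (set_var ''y'' (Cst 1)) (Seq (set_var ''den'' (var ''D''))
       (For ''j'' (Add (Mul (Cst 2) (var ''L'')) (Add (var ''n'') (Cst 2)))
         scale_round)))"

section \<open>Sizes of numbers and the oracle call\<close>

locale machine =
  fixes n L :: nat and orc :: "(nat \<Rightarrow> real) \<Rightarrow> nat set" and S :: "nat set" and Bp Bq :: int
  assumes n_large: "8 \<le> n"
    and orc_cong: "\<And>p p'. (\<And>i. i < n \<Longrightarrow> p i = p' i) \<Longrightarrow> orc p = orc p'"
begin

text \<open>All size bounds derived for the program have an index well below 60 in the sense of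
  \<open>fits\<close>.\<close>

definition W :: nat where "W = 60 * (n + L)"

definition K :: nat where "K = 1000 * W + 10000 + 2 * n * (W + 3)"

sublocale cost_logic n orc W K
  by unfold_locales (simp add: K_def)

lemma K_big: "1000 * W + 10000 \<le> K"
  by (simp add: K_def)

lemma loop_cost: "cost_bound W (var y) + value_bits W (var y) + 4 * W + 40 \<le> K"
  using K_big by simp

text \<open>A degree calculus: the index counts factors \<open>2 ^ (n + L)\<close>. Products add
  indices, and a sum costs one more because \<open>2 \<le> 2 ^ (n + L)\<close>.\<close>

definition fits :: "nat \<Rightarrow> int \<Rightarrow> bool" where
  "fits i v \<longleftrightarrow> \<bar>v\<bar> \<le> 2 ^ (i * (n + L))"

lemma fits_W: "fits i v \<Longrightarrow> i \<le> 60 \<Longrightarrow> \<bar>v\<bar> \<le> 2 ^ W"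
proof -
  assume "fits i v" "i \<le> 60"
  then have "\<bar>v\<bar> \<le> 2 ^ (i * (n + L))" by (simp add: fits_def)
  also have "\<dots> \<le> (2::int) ^ W" unfolding W_def using \<open>i \<le> 60\<close> by (intro power_increasing mult_right_mono) auto
  finally show ?thesis .
qed

lemma fits_mono: "fits i v \<Longrightarrow> i \<le> j \<Longrightarrow> fits j v"
proof -
  assume "fits i v" "i \<le> j"
  then have "\<bar>v\<bar> \<le> 2 ^ (i * (n + L))" by (simp add: fits_def)
  also have "\<dots> \<le> (2::int) ^ (j * (n + L))" using \<open>i \<le> j\<close> by (intro power_increasing mult_right_mono) auto
  finally show ?thesis by (simp add: fits_def)
qed

lemma fits_mult: "fits i a \<Longrightarrow> fits j b \<Longrightarrow> fits (i + j) (a * b)"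
  unfolding fits_def abs_mult add_mult_distrib power_add by (intro mult_mono) auto

lemma fits_add: "fits i a \<Longrightarrow> fits j b \<Longrightarrow> fits (max i j + 1) (a + b)"
proof -
  assume "fits i a" "fits j b"
  then have "fits (max i j) a" "fits (max i j) b" by (auto intro: fits_mono)
  then have "\<bar>a + b\<bar> \<le> 2 * 2 ^ (max i j * (n + L))" unfolding fits_def by linarith
  also have "(2::int) * 2 ^ (max i j * (n + L)) = 2 ^ 1 * 2 ^ (max i j * (n + L))" by simp
  also have "\<dots> \<le> 2 ^ (n + L) * 2 ^ (max i j * (n + L))"
    using n_large by (intro mult_right_mono power_increasing) auto
  finally show ?thesis by (simp add: fits_def power_add)
qed

lemma fits_le: "fits i b \<Longrightarrow> 0 \<le> a \<Longrightarrow> a \<le> b \<Longrightarrow> fits i a"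
  by (simp add: fits_def)

lemma fits_const: "\<bar>k\<bar> \<le> 256 \<Longrightarrow> fits 1 k"
proof -
  assume "\<bar>k\<bar> \<le> 256"
  also have "(256::int) = 2 ^ 8" by simp
  also have "\<dots> \<le> 2 ^ (1 * (n + L))" using n_large by (intro power_increasing) auto
  finally show ?thesis by (simp add: fits_def)
qed

lemma fits_n: "fits 1 (int n)" and fits_L: "fits 1 (int L)" and fits_2L: "fits 1 (2 ^ L)"
proof -
  have le: "int a \<le> 2 ^ (n + L)" if "a \<le> n + L" for a
  proof -
    have "a < 2 ^ (n + L)" using that less_exp[of "n + L"] by linarith
    then have "int a < int (2 ^ (n + L))" by (simp only: of_nat_less_iff)
    then show ?thesis by simp
  qed
  show "fits 1 (int n)" "fits 1 (int L)" using le[of n] le[of L] by (simp_all add: fits_def)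
  show "fits 1 (2 ^ L)" by (simp add: fits_def)
qed

lemma n_W: "int n \<le> 2 ^ W"
  using fits_W[OF fits_n] by simp

lemma fits_pow: "fits 1 v \<Longrightarrow> fits k (v ^ k)"
proof (induction k)
  case 0
  then show ?case by (simp add: fits_def)
next
  case (Suc k)
  then show ?case using fits_mult[of 1 v k "v ^ k"] by simp
qed

definition inp :: "state \<Rightarrow> bool" where
  "inp s \<longleftrightarrow> s ''n'' 0 = int n \<and> s ''L'' 0 = int L \<and> s ''Bp'' 0 = Bp \<and> s ''Bq'' 0 = Bq
     \<and> (\<forall>i<n. s ''S'' (int i) = of_bool (i \<in> S))"

lemma inp_frame:
  assumes "frame X s s'" "inp s" "X \<inter> {''n'', ''L'', ''Bp'', ''Bq'', ''S''} = {}"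
  shows "inp s'"
proof -
  have "s' x = s x" if "x \<in> {''n'', ''L'', ''Bp'', ''Bq'', ''S''}" for x
    using frameD[OF assms(1)] assms(3) that by blast
  then show ?thesis using assms(2) by (simp add: inp_def)
qed

lemma wp_ask:
  assumes s: "bounded s" "inp s" and Z: "s ''Z'' 0 = Z" "0 \<le> Z"
    and d: "s ''den'' 0 = d" "0 < d" and big: "\<bar>Z * d\<bar> \<le> 2 ^ W"
    and a: "\<And>s' i. frame {''e'', ''P'', ''Q''} s s' \<Longrightarrow> s' ''e'' 0 = int i \<Longrightarrow> i < n \<Longrightarrow> aval s' a = k i"
    and k: "\<And>i. i < n \<Longrightarrow> 0 \<le> k i \<and> \<bar>k i\<bar> \<le> 2 ^ W"
    and cost: "cost_bound W a + value_bits W a \<le> 50 * W + 100"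
  shows "wp (ask a) (n * 6 + 5)
     (\<lambda>s'. bounded s' \<and> frame {''e'', ''P'', ''Q'', ''T''} s s' \<and>
        (\<forall>i<n. s' ''T'' (int i) = of_bool (i \<in> orc (\<lambda>i. if i \<in> S then of_int (k i) / of_int d else of_int Z)))) s"
    (is "wp _ _ ?post s")
proof -
  let ?I = "\<lambda>j s'. frame {''e'', ''P'', ''Q''} s s' \<and>
     (\<forall>i<j. s' ''P'' (int i) = (if i \<in> S then k i else Z * d) \<and> s' ''Q'' (int i) = d)"
  have dW: "\<bar>d\<bar> \<le> 2 ^ W" using bounded_stateD[OF s(1), of "''den''" 0] d by simp
  have "wp (ask a) ((n * ((1 + 1 + 1) + 3) + 3) + 1 + 1) ?post s"
    unfolding ask_def
  proof (rule wp_Seq, rule wp_For[where I = ?I])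
    fix j s' v assume "?I j s'"
    then show "?I j (upd s' ''e'' 0 v)" by (auto intro: frame_upd simp: upd_apply)
  next
    fix j s' assume "?I j s'"
    then show "aval s' (var ''n'') = int n"
      using s(2) by (auto simp: frame_def inp_def)
  next
    fix j s' assume j: "j < n" and b: "bounded s'" and I: "?I j s'" and e: "s' ''e'' 0 = int j"
    have st: "s' ''S'' (int j) = of_bool (j \<in> S)" "s' ''Z'' 0 = Z" "s' ''den'' 0 = d"
      using I s(2) j Z d by (auto simp: frame_def inp_def)
    have av: "aval s' a = k j" using a I e j by blast
    let ?v = "if j \<in> S then k j else Z * d"
    show "wp (Seq (Assign ''P'' (var ''e'')
         (price_exp a))
       (Assign ''Q'' (var ''e'') (var ''den''))) (1 + 1 + 1)
       (\<lambda>s''. bounded s'' \<and> s'' ''e'' 0 = int j \<and> ?I (Suc j) s'') s'"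
    proof (rule wp_Seq, rule wp_AssignI[where i = "int j" and v = ?v])
      assume b1: "bounded (upd s' ''P'' (int j) ?v)"
      show "wp (Assign ''Q'' (var ''e'') (var ''den'')) 1
         (\<lambda>s''. bounded s'' \<and> s'' ''e'' 0 = int j \<and> ?I (Suc j) s'') (upd s' ''P'' (int j) ?v)"
      proof (rule wp_AssignI[where i = "int j" and v = d])
        show "bounded (upd (upd s' ''P'' (int j) ?v) ''Q'' (int j) d) \<Longrightarrow>
          bounded (upd (upd s' ''P'' (int j) ?v) ''Q'' (int j) d) \<and>
          upd (upd s' ''P'' (int j) ?v) ''Q'' (int j) d ''e'' 0 = int j \<and>
          ?I (Suc j) (upd (upd s' ''P'' (int j) ?v) ''Q'' (int j) d)"
          using I e by (auto intro!: frame_upd simp: upd_apply less_Suc_eq)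
        show "aval (upd s' ''P'' (int j) ?v) (var ''e'') = int j" using e by (simp add: upd_apply)
        show "aval (upd s' ''P'' (int j) ?v) (var ''den'') = d" using st(3) by (simp add: upd_apply)
        show "cost_bound W (var ''e'') + cost_bound W (var ''den'') + 1 \<le> K" using K_big by simp
      qed (rule b1 dW)+
    next
      show "\<bar>?v\<bar> \<le> 2 ^ W" using k[OF j] big by auto
      show "cost_bound W (var ''e'') + cost_bound W (price_exp a) + 1 \<le> K"
        using cost K_big by simp
    qed (use b e st av in simp_all)
  next
    fix s' assume I: "?I n s'" and b: "bounded s'"
    let ?s2 = "s'(''T'' := (\<lambda>k. if 0 \<le> k \<and> k < int n
       then of_bool (nat k \<in> orc (\<lambda>i. of_int (s' ''P'' (int i)) / of_int (s' ''Q'' (int i)))) else s' ''T'' k))"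
    \<comment> \<open>The oracle depends only on the prices of indices below \<open>n\<close>, and
      outside \<open>S\<close> the fraction \<open>Z * d / d\<close> is \<open>Z\<close>.\<close>
    have eq: "orc (\<lambda>i. of_int (s' ''P'' (int i)) / of_int (s' ''Q'' (int i))) =
         orc (\<lambda>i. if i \<in> S then of_int (k i) / of_int d else of_int Z)"
      using I d(2) by (intro orc_cong) auto
    show "wp (Query ''P'' ''Q'' ''T'') 1 ?post s'"
    proof (rule wp_Query[OF b])
      show "0 \<le> s' ''P'' (int i) \<and> 0 < s' ''Q'' (int i)" if "i < n" for i
        using I that k d Z by auto
      have "bounded ?s2"
        using b by (simp add: bounded_state_def)
      moreover have "frame {''e'', ''P'', ''Q'', ''T''} s ?s2"
        using I by (auto simp: frame_def)
      ultimately show "?post ?s2" by (simp add: eq)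
    qed
  qed (rule loop_cost, use s n_W in simp_all)
  then show ?thesis by (rule wp_mono) (simp, assumption)
qed

end

section \<open>Finding the scale\<close>

locale oracle_game =
  fixes n :: nat and w :: "nat set \<Rightarrow> real" and orc :: "(nat \<Rightarrow> real) \<Rightarrow> nat set"
    and S :: "nat set" and Z :: real
  assumes U_nonneg: "\<And>A. A \<subseteq> {..<n} \<Longrightarrow> 0 \<le> w A"
    and U_mono: "\<And>A B. A \<subseteq> B \<Longrightarrow> B \<subseteq> {..<n} \<Longrightarrow> w A \<le> w B"
    and U_subadd: "\<And>A B. A \<subseteq> {..<n} \<Longrightarrow> B \<subseteq> {..<n} \<Longrightarrow> w (A \<union> B) \<le> w A + w B"
    and U_empty: "w {} = 0"
    and orc_sub: "\<And>p. (\<And>i. 0 \<le> p i) \<Longrightarrow> orc p \<subseteq> {..<n}"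
    and orc_opt: "\<And>p A. (\<And>i. 0 \<le> p i) \<Longrightarrow> A \<subseteq> {..<n} \<Longrightarrow> w A - sum p A \<le> w (orc p) - sum p (orc p)"
    and S_within: "S \<subseteq> {..<n}"
    and Z_large: "w {..<n} < Z"
begin

definition demand :: "(nat \<Rightarrow> real) \<Rightarrow> nat set" where
  "demand p = orc (\<lambda>i. if i \<in> S then p i else Z)"

lemma Z_pos: "0 < Z"
  using U_nonneg[of "{..<n}"] Z_large by simp

text \<open>Dropping the demanded elements outside \<open>S\<close> loses at most
  \<open>w {..<n} < Z\<close> in value but saves \<open>Z\<close> for each of them.\<close>

lemma demand_sub:
  assumes p: "\<And>i. 0 \<le> p i"
  shows "demand p \<subseteq> S"
proof (rule ccontr)
  assume "\<not> demand p \<subseteq> S"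
  let ?q = "\<lambda>i. if i \<in> S then p i else Z" and ?T = "demand p"
  have q: "\<And>i. 0 \<le> ?q i" using p Z_pos by simp
  have T: "?T \<subseteq> {..<n}" unfolding demand_def using q by (rule orc_sub)
  then have fin: "finite ?T" using finite_subset by blast
  have "?T - S \<noteq> {}" using \<open>\<not> demand p \<subseteq> S\<close> by auto
  then have "1 \<le> card (?T - S)" using fin by (simp add: Suc_leI card_gt_0_iff)
  then have "Z * 1 \<le> Z * card (?T - S)" using Z_pos by (intro mult_left_mono) auto
  moreover have "sum ?q ?T = sum ?q (?T \<inter> S) + sum ?q (?T - S)"
    by (rule sum.Int_Diff[OF fin])
  moreover have "sum ?q (?T - S) = Z * card (?T - S)" by simp
  moreover have "w (?T \<inter> S) - sum ?q (?T \<inter> S) \<le> w ?T - sum ?q ?T"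
    unfolding demand_def using q by (rule orc_opt) (use T demand_def in auto)
  moreover have "w ?T \<le> w (?T \<inter> S) + w (?T - S)"
    using U_subadd[of "?T \<inter> S" "?T - S"] T by (auto simp: Int_Diff_Un)
  moreover have "w (?T - S) \<le> w {..<n}" using T by (intro U_mono) auto
  ultimately show False using Z_large by linarith
qed

lemma demand_opt:
  assumes p: "\<And>i. 0 \<le> p i" and A: "A \<subseteq> S"
  shows "w A - sum p A \<le> w (demand p) - sum p (demand p)"
proof -
  let ?q = "\<lambda>i. if i \<in> S then p i else Z"
  have q: "\<And>i. 0 \<le> ?q i" using p Z_pos by simp
  have "w A - sum ?q A \<le> w (demand p) - sum ?q (demand p)"
    unfolding demand_def using q by (rule orc_opt) (use A S_within in auto)
  moreover have "sum ?q X = sum p X" if "X \<subseteq> S" for X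
    using that by (intro sum.cong) auto
  ultimately show ?thesis using A demand_sub[of p] p by simp
qed

text \<open>A uniform price serves as a substitute for a value query: a nonempty answer certifies
  \<open>c \<le> w S\<close>, an empty one \<open>w S \<le> n * c\<close>.\<close>

lemma demand_const_nonempty:
  fixes c :: real
  assumes "0 \<le> c" "demand (\<lambda>_. c) \<noteq> {}"
  shows "c \<le> w S"
proof -
  let ?T = "demand (\<lambda>_. c)"
  have T: "?T \<subseteq> S" using assms by (intro demand_sub)
  then have "finite ?T" by (rule finite_subset) (rule finite_subset[OF S_within finite_lessThan])
  then have "1 \<le> card ?T" using assms by (simp add: Suc_leI card_gt_0_iff)
  then have "c * 1 \<le> c * card ?T" using assms by (intro mult_left_mono) auto
  moreover have "c * card ?T \<le> w ?T"
    using demand_opt[of "\<lambda>_. c" "{}"] assms U_empty by (simp add: mult.commute)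
  moreover have "w ?T \<le> w S" using T S_within by (intro U_mono) auto
  ultimately show ?thesis by simp
qed

lemma demand_const_empty:
  fixes c :: real
  assumes "0 \<le> c" "demand (\<lambda>_. c) = {}"
  shows "w S \<le> n * c"
proof -
  have "w S \<le> card S * c"
    using demand_opt[of "\<lambda>_. c" S] assms U_empty by simp
  also have "card S \<le> n" using card_mono[OF _ S_within] by simp
  then have "card S * c \<le> n * c" using assms by (intro mult_right_mono) auto
  finally show ?thesis .
qed

lemma scaled_dynamics:
  fixes s :: real
  assumes "8 \<le> n" "0 < s" "s \<le> w S" "w S \<le> 2 * n * s"
  shows "price_dynamics n S w demand s"
  using assms S_within U_nonneg U_mono U_subadd U_empty demand_sub demand_opt
  by unfold_locales auto

end

locale machine_game = machine n L orc S Bp Bq + oracle_game n w orc S "2 ^ L"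
  for n L :: nat and orc :: "(nat \<Rightarrow> real) \<Rightarrow> nat set" and S :: "nat set" and Bp Bq :: int
    and w :: "nat set \<Rightarrow> real" +
  assumes w_gap: "w S = 0 \<or> 1 / 2 ^ L \<le> w S"
    and Bp_fits: "fits 1 Bp" "0 \<le> Bp" and Bq_fits: "fits 1 Bq" "0 < Bq"
begin

text \<open>The lowest price tried is \<open>1 / D\<close>. An empty answer there gives
  \<open>w S \<le> n / D = 1 / (2 * 2 ^ L)\<close>, below the smallest positive value, so
  \<open>w S = 0\<close>.\<close>

definition D :: int where "D = 2 * int n * 2 ^ L"

lemma D_pos: "0 < D"
  using n_large by (simp add: D_def)

lemma D_fits: "fits 3 D"
  unfolding D_def by (rule fits_mono[OF fits_mult[OF fits_mult[OF fits_const fits_n] fits_2L]]) simp_all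

text \<open>After \<open>j\<close> rounds \<open>x\<close> is the last price numerator with a
  nonempty answer. If \<open>2 * x = 2 ^ j\<close>, it was the latest one tried and no upper bound
  is known yet; otherwise the doubled price was answered by the empty set.\<close>

definition scale_inv :: "nat \<Rightarrow> int \<Rightarrow> bool" where
  "scale_inv j x \<longleftrightarrow> 0 \<le> x \<and> x \<le> 2 ^ j \<and> (x = 0 \<longrightarrow> j = 0 \<or> w S \<le> n / D) \<and>
     (0 < x \<longrightarrow> x / D \<le> w S \<and> (2 * x = 2 ^ j \<or> w S \<le> 2 * n * (x / D)))"

lemma scale_inv_Suc:
  assumes "scale_inv j x"
  shows "scale_inv (Suc j) (if demand (\<lambda>_. 2 ^ j / D) = {} then x else 2 ^ j)"
proof (cases "demand (\<lambda>_. 2 ^ j / D) = {}")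
  case True
  have "w S \<le> n * (2 ^ j / D)"
    using True D_pos by (intro demand_const_empty) auto
  moreover have "(2::int) ^ j \<le> 2 ^ Suc j" by simp
  moreover have "w S \<le> 2 * n * (x / D)" if "2 * x = 2 ^ j"
  proof -
    have "(2::real) ^ j = of_int (2 * x)" using that by simp
    then show ?thesis using calculation by (simp add: mult_ac)
  qed
  ultimately show ?thesis using assms True unfolding scale_inv_def by auto
next
  case False
  then have "2 ^ j / D \<le> w S" using D_pos by (intro demand_const_nonempty) auto
  then show ?thesis using False by (simp add: scale_inv_def)
qed

definition scale_ok :: "int \<Rightarrow> bool" where
  "scale_ok x \<longleftrightarrow>
     (if x = 0 then w S = 0 else 0 < x \<and> x / D \<le> w S \<and> w S \<le> 2 * n * (x / D))"

text \<open>The last price tried is \<open>2 ^ (2 * L + n + 1) / D = 2 ^ (L + n) / n\<close>, which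
  exceeds \<open>2 ^ L\<close> and hence every value. It cannot have had a nonempty answer, so the
  upper bound is in force.\<close>

lemma scale_inv_final:
  assumes "scale_inv (2 * L + n + 2) x"
  shows "scale_ok x"
proof (cases "x = 0")
  case True
  then have "w S \<le> n / D" using assms by (simp add: scale_inv_def)
  also have "n / D < 1 / 2 ^ L" using n_large by (simp add: D_def field_simps)
  finally show ?thesis using True w_gap by (auto simp: scale_ok_def)
next
  case False
  then have x: "0 < x" "x / D \<le> w S" "2 * x = 2 ^ (2 * L + n + 2) \<or> w S \<le> 2 * n * (x / D)"
    using assms by (auto simp: scale_inv_def)
  have "2 * x \<noteq> 2 ^ (2 * L + n + 2)"
  proof
    assume "2 * x = 2 ^ (2 * L + n + 2)"
    moreover have "(2::int) ^ (2 * L) = 2 ^ L * 2 ^ L" by (simp add: mult_2 power_add)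
    ultimately have "x = 2 ^ L * 2 ^ L * 2 * 2 ^ n" by (simp add: power_add)
    moreover have "x / D < 2 ^ L"
    proof -
      have "w S \<le> w {..<n}" using S_within by (intro U_mono) auto
      then show ?thesis using x(2) Z_large by simp
    qed
    then have "real_of_int x < 2 ^ L * real_of_int D" using D_pos by (simp add: field_simps)
    then have "real_of_int x < real_of_int (2 ^ L * D)" by simp
    then have "x < 2 ^ L * D" by linarith
    ultimately have "2 ^ L * 2 ^ L * 2 * (2::int) ^ n < 2 ^ L * 2 ^ L * 2 * int n"
      by (simp add: D_def mult_ac)
    then show False using less_exp[of n] by simp
  qed
  with x show ?thesis unfolding scale_ok_def by simp
qed

lemma wp_scale_search:
  assumes s: "bounded s" "inp s" and Z: "s ''Z'' 0 = 2 ^ L" and D: "s ''D'' 0 = D"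
  shows "wp scale_search ((2 * L + n + 2) * (n * 11 + 20) + 12)
     (\<lambda>s'. bounded s' \<and> frame {''x'', ''y'', ''den'', ''j'', ''e'', ''P'', ''Q'', ''T''} s s' \<and>
       fits 3 (s' ''x'' 0) \<and> scale_ok (s' ''x'' 0)) s"
    (is "wp _ _ ?post s")
proof -
  let ?X = "{''x'', ''y'', ''den'', ''j'', ''e'', ''P'', ''Q'', ''T''}"
  let ?J = "2 * L + n + 2"
  let ?I = "\<lambda>j s'. frame ?X s s' \<and> s' ''den'' 0 = D \<and> s' ''y'' 0 = 2 ^ j \<and> scale_inv j (s' ''x'' 0)"
  have pow: "fits 3 (2 ^ j)" if "j \<le> ?J" for j
  proof -
    have "\<bar>2 ^ j\<bar> \<le> (2::int) ^ (3 * (n + L))"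
      unfolding power_abs abs_numeral using that n_large by (intro power_increasing) auto
    then show ?thesis by (simp add: fits_def)
  qed
  have J_W: "int ?J \<le> 2 ^ W"
  proof -
    have "fits (max (1 + 1) (max 1 1 + 1) + 1) (2 * int L + (int n + 2))"
      by (intro fits_add fits_mult fits_const fits_n fits_L) auto
    from fits_W[OF this] show ?thesis by (simp add: add.assoc)
  qed
  define s3 where "s3 = upd (upd (upd s ''x'' 0 0) ''y'' 0 1) ''den'' 0 D"
  have init: "?I 0 s3"
    unfolding s3_def by (auto intro!: frame_upd simp: upd_apply scale_inv_def)
  have loop: "wp (For ''j'' (Add (Mul (Cst 2) (var ''L'')) (Add (var ''n'') (Cst 2)))
         scale_round) (?J * (((n * 6 + 5) + ((n * ((1 + 1) + 3) + 3) + 1 + 1) + 1) + 3) + 3) ?post s3"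
    if b3: "bounded s3"
  proof (rule wp_For[where I = ?I])
    fix j s' v assume "?I j s'"
    then show "?I j (upd s' ''j'' 0 v)" by (auto intro!: frame_upd simp: upd_apply)
  next
    fix j s' assume "?I j s'"
    then have "inp s'" using inp_frame[OF _ s(2), of ?X s'] by simp
    then show "aval s' (Add (Mul (Cst 2) (var ''L'')) (Add (var ''n'') (Cst 2))) = int ?J"
      by (simp add: inp_def)
  next
    fix j s' assume j: "j < ?J" and b: "bounded s'" and I: "?I j s'" and jv: "s' ''j'' 0 = int j"
    have inp: "inp s'" using I inp_frame[OF _ s(2), of ?X s'] by simp
    have Z': "s' ''Z'' 0 = 2 ^ L" using I Z frameD[of ?X s s' "''Z''"] by simp
    let ?T = "demand (\<lambda>_. 2 ^ j / D)"
    show "wp scale_round ((n * 6 + 5) + ((n * ((1 + 1) + 3) + 3) + 1 + 1) + 1)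
         (\<lambda>s''. bounded s'' \<and> s'' ''j'' 0 = int j \<and> ?I (Suc j) s'') s'"
    proof (rule wp_Seq, rule wp_mono[OF wp_ask[where Z = "2 ^ L" and d = D and k = "\<lambda>_. 2 ^ j"]])
      show "bounded s'" "inp s'" "s' ''Z'' 0 = 2 ^ L" "s' ''den'' 0 = D" "0 < D"
        using b inp Z' I D_pos by auto
      show "\<bar>2 ^ L * D\<bar> \<le> 2 ^ W" using fits_W[OF fits_mult[OF fits_2L D_fits]] by simp
      show "aval s'' (var ''y'') = 2 ^ j" if "frame {''e'', ''P'', ''Q''} s' s''" for s''
        using frameD[OF that, of "''y''"] I by simp
      show "0 \<le> (2::int) ^ j \<and> \<bar>2 ^ j\<bar> \<le> (2::int) ^ W" using fits_W[OF pow[of j]] j by simp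
    next
      fix s1 assume s1: "bounded s1 \<and> frame {''e'', ''P'', ''Q'', ''T''} s' s1 \<and>
        (\<forall>i<n. s1 ''T'' (int i) = of_bool (i \<in> orc (\<lambda>i. if i \<in> S then of_int (2 ^ j) / of_int D else of_int (2 ^ L))))"
      have fr1: "frame {''e'', ''P'', ''Q'', ''T''} s' s1" using s1 by simp
      have "(\<lambda>i. if i \<in> S then real_of_int (2 ^ j) / real_of_int D else real_of_int (2 ^ L))
          = (\<lambda>i. if i \<in> S then 2 ^ j / D else 2 ^ L)" by auto
      then have T1: "s1 ''T'' (int i) = of_bool (i \<in> ?T)" if "i < n" for i
        using s1 that unfolding demand_def by simp
      have v1: "s1 ''y'' 0 = 2 ^ j" "s1 ''den'' 0 = D" "s1 ''x'' 0 = s' ''x'' 0" "s1 ''j'' 0 = int j"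
        using frameD[OF fr1] I jv by auto
      have inp1: "inp s1" using inp_frame[OF fr1 inp] by simp
      have frs1: "frame ?X s s1" using I by (intro frame_trans[OF _ fr1, of ?X s ?X]) auto
      let ?I2 = "\<lambda>i s''. frame {''e'', ''x''} s1 s'' \<and>
         s'' ''x'' 0 = (if \<exists>k<i. k \<in> ?T then 2 ^ j else s' ''x'' 0)"
      show "wp (Seq mark_scale
           (set_var ''y'' (Mul (Cst 2) (var ''y'')))) ((n * ((1 + 1) + 3) + 3) + 1 + 1)
         (\<lambda>s''. bounded s'' \<and> s'' ''j'' 0 = int j \<and> ?I (Suc j) s'') s1"
      proof (rule wp_Seq, rule wp_For[where I = ?I2])
        show "?I2 0 s1" using v1 by simp
        fix i s2 v assume "?I2 i s2"
        then show "?I2 i (upd s2 ''e'' 0 v)" by (auto intro!: frame_upd simp: upd_apply)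
      next
        fix i s2 assume "?I2 i s2"
        then show "aval s2 (var ''n'') = int n"
          using inp1 frameD[of "{''e'', ''x''}" s1 s2 "''n''"] by (simp add: inp_def)
      next
        fix i s2 assume i: "i < n" and b2: "bounded s2" and I2: "?I2 i s2" and e: "s2 ''e'' 0 = int i"
        have fr2: "frame {''e'', ''x''} s1 s2" using I2 by simp
        have v2: "s2 ''T'' (int i) = of_bool (i \<in> ?T)" "s2 ''y'' 0 = 2 ^ j"
          using frameD[OF fr2] T1[OF i] v1 by auto
        show "wp (Cond (Cell ''T'' (var ''e'')) (set_var ''x'' (var ''y'')) Skip) (1 + 1)
          (\<lambda>s''. bounded s'' \<and> s'' ''e'' 0 = int i \<and> ?I2 (Suc i) s'') s2"
        proof (rule wp_Cond)
          assume "0 < aval s2 (Cell ''T'' (var ''e''))"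
          then have iT: "i \<in> ?T" using e v2 by simp
          show "wp (set_var ''x'' (var ''y'')) 1
              (\<lambda>s''. bounded s'' \<and> s'' ''e'' 0 = int i \<and> ?I2 (Suc i) s'') s2"
          proof (rule wp_AssignI[where i = 0 and v = "2 ^ j"])
            show "bounded (upd s2 ''x'' 0 (2 ^ j)) \<Longrightarrow> bounded (upd s2 ''x'' 0 (2 ^ j)) \<and>
              upd s2 ''x'' 0 (2 ^ j) ''e'' 0 = int i \<and> ?I2 (Suc i) (upd s2 ''x'' 0 (2 ^ j))"
              using fr2 e iT by (auto intro!: frame_upd simp: upd_apply)
            show "\<bar>2 ^ j\<bar> \<le> (2::int) ^ W" using fits_W[OF pow[of j]] j by simp
          qed (use b2 v2 K_big in simp_all)
        next
          assume "\<not> 0 < aval s2 (Cell ''T'' (var ''e''))"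
          then have "i \<notin> ?T" using e v2 by (auto split: if_splits)
          then have "(\<exists>k<Suc i. k \<in> ?T) \<longleftrightarrow> (\<exists>k<i. k \<in> ?T)" by (metis less_Suc_eq)
          then show "wp Skip 1 (\<lambda>s''. bounded s'' \<and> s'' ''e'' 0 = int i \<and> ?I2 (Suc i) s'') s2"
            using b2 e I2 by (intro wp_Skip) simp
        qed (use b2 K_big in simp_all)
      next
        fix s2 assume I2: "?I2 n s2" and b2: "bounded s2"
        have fr2: "frame {''e'', ''x''} s1 s2" using I2 by simp
        have "?T \<subseteq> {..<n}" using demand_sub[of "\<lambda>_. 2 ^ j / D"] D_pos S_within by auto
        then have "(\<exists>k<n. k \<in> ?T) \<longleftrightarrow> ?T \<noteq> {}" by auto
        then have x2: "s2 ''x'' 0 = (if ?T = {} then s' ''x'' 0 else 2 ^ j)" using I2 by simp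
        have v2: "s2 ''y'' 0 = 2 ^ j" "s2 ''den'' 0 = D" "s2 ''j'' 0 = int j"
          using frameD[OF fr2] v1 by auto
        show "wp (set_var ''y'' (Mul (Cst 2) (var ''y''))) 1
          (\<lambda>s''. bounded s'' \<and> s'' ''j'' 0 = int j \<and> ?I (Suc j) s'') s2"
        proof (rule wp_AssignI[where i = 0 and v = "2 ^ Suc j"])
          have "frame ?X s s2" using frs1 by (rule frame_trans[OF _ fr2]) auto
          then have "frame ?X s (upd s2 ''y'' 0 (2 ^ Suc j))" by (rule frame_upd) simp
          moreover have "scale_inv (Suc j) (s2 ''x'' 0)"
            unfolding x2 using I by (intro scale_inv_Suc) simp
          ultimately show "bounded (upd s2 ''y'' 0 (2 ^ Suc j)) \<Longrightarrow> bounded (upd s2 ''y'' 0 (2 ^ Suc j)) \<and>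
              upd s2 ''y'' 0 (2 ^ Suc j) ''j'' 0 = int j \<and> ?I (Suc j) (upd s2 ''y'' 0 (2 ^ Suc j))"
            using v2 by (simp add: upd_apply)
          show "\<bar>2 ^ Suc j\<bar> \<le> (2::int) ^ W" using fits_W[OF pow[of "Suc j"]] j by simp
        qed (use b2 v2 K_big in simp_all)
      qed (rule loop_cost, use s1 n_W in simp_all)
    next
      show "cost_bound W (var ''y'') + value_bits W (var ''y'') \<le> 50 * W + 100" by simp
    qed simp_all
  next
    fix s' assume I: "?I ?J s'" and b: "bounded s'"
    have "fits 3 (s' ''x'' 0)" using I pow[of ?J] by (auto simp: scale_inv_def intro: fits_le)
    then show "?post s'" using I b scale_inv_final[of "s' ''x'' 0"] by simp
  next
    show "cost_bound W (Add (Mul (Cst 2) (var ''L'')) (Add (var ''n'') (Cst 2))) +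
        value_bits W (Add (Mul (Cst 2) (var ''L'')) (Add (var ''n'') (Cst 2))) + 4 * W + 40 \<le> K"
      using K_big by simp
  qed (use b3 J_W init in simp_all)
  have "wp scale_search (1 + (1 + (1 + (?J * (((n * 6 + 5) + ((n * ((1 + 1) + 3) + 3) + 1 + 1) + 1) + 3) + 3) + 1) + 1) + 1) ?post s"
    unfolding scale_search_def
    apply (rule wp_Seq, rule wp_AssignI[where i = 0 and v = 0])
         apply (use s K_big in simp_all)[5]
    apply (rule wp_Seq, rule wp_AssignI[where i = 0 and v = 1])
         apply (use K_big in simp_all)[5]
    apply (rule wp_Seq, rule wp_AssignI[where i = 0 and v = D])
         apply (use s K_big D fits_W[OF D_fits] in \<open>simp_all add: upd_apply\<close>)[5]
    using loop unfolding s3_def by blast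
  then show ?thesis by (rule wp_mono) (simp add: algebra_simps, assumption)
qed

end

section \<open>Running the price dynamics\<close>

abbreviation n2_exp :: aexp where "n2_exp \<equiv> Mul (var ''n'') (var ''n'')"
abbreviation n4_exp :: aexp where "n4_exp \<equiv> Mul n2_exp n2_exp"
abbreviation n11_exp :: aexp where "n11_exp \<equiv> Mul (Mul n4_exp n4_exp) (Mul n2_exp (var ''n''))"

abbreviation step_dual :: com where
  "step_dual \<equiv> Seq (Assign ''k'' (var ''e'') (Sub (Add (Cell ''k'' (var ''e'')) (Mul (var ''q'') (Cell ''T'' (var ''e'')))) (Cst 1))) (Cond (Cell ''k'' (var ''e'')) Skip (Assign ''k'' (var ''e'') (Cst 0)))"

text \<open>\<open>G\<close> is increased before \<open>k\<close> moves: \<open>dual_sum\<close>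
  includes the initial iterate and excludes the one after the last round.\<close>

definition update_duals :: com where
  "update_duals =
     For ''e'' (var ''n'') (Seq
       (Assign ''G'' (var ''e'') (Add (Cell ''G'' (var ''e'')) (Cell ''k'' (var ''e'')))) step_dual)"

abbreviation play_rounds :: "com \<Rightarrow> com" where
  "play_rounds c \<equiv> For ''t'' n11_exp (Seq (ask (Mul (var ''x'') (Cell ''k'' (var ''e'')))) (Seq c update_duals))"

text \<open>The parameter \<open>c\<close> is what happens to a play between the oracle's answer and
  the dual update: nothing when only the prices are wanted, \<open>emit\<close> when the plays are
  to be split.\<close>

definition run :: "com \<Rightarrow> com" where
  "run c =
     Seq (For ''e'' (var ''n'') (Seq (Assign ''k'' (var ''e'') (Cst 0)) (Assign ''G'' (var ''e'') (Cst 0))))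
    (Seq (set_var ''den'' (Mul (var ''D'') (Mul n4_exp (var ''q''))))
    (play_rounds c))"

locale machine_run = machine_game n L orc S Bp Bq w
  for n L :: nat and orc :: "(nat \<Rightarrow> real) \<Rightarrow> nat set" and S :: "nat set" and Bp Bq :: int
    and w :: "nat set \<Rightarrow> real" +
  fixes x :: int
  assumes x_pos: "0 < x" and x_fits: "fits 3 x"
    and x_le: "x / D \<le> w S" and x_ge: "w S \<le> 2 * n * (x / D)"
begin

sublocale price_dynamics n S w demand "x / D"
proof (rule scaled_dynamics)
  show "0 < real_of_int x / real_of_int D" using x_pos D_pos by simp
qed (use n_large x_le x_ge in auto)

definition env :: "nat \<Rightarrow> state \<Rightarrow> bool" where
  "env Q s \<longleftrightarrow> inp s \<and> s ''Z'' 0 = 2 ^ L \<and> s ''D'' 0 = D \<and> s ''x'' 0 = x \<and> s ''q'' 0 = int Q"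

lemma env_frame:
  assumes "frame X s s'" "env Q s" "X \<inter> {''n'', ''L'', ''Bp'', ''Bq'', ''S'', ''Z'', ''D'', ''x'', ''q''} = {}"
  shows "env Q s'"
proof -
  have "s' y = s y" if "y \<in> {''Z'', ''D'', ''x'', ''q''}" for y
    using frameD[OF assms(1)] assms(3) that by blast
  moreover have "inp s'"
    by (rule inp_frame[OF assms(1)]) (use assms(2,3) in \<open>auto simp: env_def\<close>)
  ultimately show ?thesis using assms(2) by (simp add: env_def)
qed

lemma rounds_fits: "fits 11 (int rounds)"
  unfolding rounds_def of_nat_power by (rule fits_pow[OF fits_n])

lemma Q_fits: "Q \<le> 16 * n ^ 2 \<Longrightarrow> fits 3 (int Q)"
proof -
  assume "Q \<le> 16 * n ^ 2"
  then have "int Q \<le> int (16 * n ^ 2)" by (simp only: of_nat_le_iff)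
  then have "int Q \<le> 16 * int n ^ 2" by simp
  moreover have "fits 3 (16 * int n ^ 2)"
    by (rule fits_mono[OF fits_mult[OF fits_const fits_pow[OF fits_n]]]) simp_all
  ultimately show ?thesis using fits_le by simp
qed

lemma dual_fits:
  assumes "t \<le> rounds" "Q \<le> 16 * n ^ 2"
  shows "fits 14 (dual Q t e)"
proof (rule fits_le)
  show "fits 14 (int rounds * int Q)"
    by (rule fits_mono[OF fits_mult[OF rounds_fits Q_fits[OF assms(2)]]]) simp
  have "dual Q t e \<le> int t * int Q" using dual_bound[of Q t e] by simp
  also have "\<dots> \<le> int rounds * int Q" using assms by (intro mult_right_mono) auto
  finally show "dual Q t e \<le> int rounds * int Q" .
qed (rule dual_nonneg)

lemma partial_sum_fits:
  assumes "t \<le> rounds" "Q \<le> 16 * n ^ 2"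
  shows "fits 25 (\<Sum>r<t. dual Q r e)"
proof (rule fits_le)
  show "fits 25 (int rounds * 2 ^ (14 * (n + L)))"
    by (rule fits_mono[OF fits_mult[OF rounds_fits, of 14]]) (simp_all add: fits_def)
  have "(\<Sum>r<t. dual Q r e) \<le> (\<Sum>r<t. 2 ^ (14 * (n + L)))"
  proof (rule sum_mono)
    fix r assume "r \<in> {..<t}"
    then have "fits 14 (dual Q r e)" using assms by (intro dual_fits) auto
    then show "dual Q r e \<le> 2 ^ (14 * (n + L))" by (simp add: fits_def)
  qed
  also have "\<dots> = int t * 2 ^ (14 * (n + L))" by simp
  also have "\<dots> \<le> int rounds * 2 ^ (14 * (n + L))" using assms by (intro mult_right_mono) auto
  finally show "(\<Sum>r<t. dual Q r e) \<le> int rounds * 2 ^ (14 * (n + L))" .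
qed (simp add: sum_nonneg dual_nonneg)

definition den :: "nat \<Rightarrow> int" where "den Q = D * (int n ^ 4 * int Q)"

lemma den_pos: "1 \<le> Q \<Longrightarrow> 0 < den Q"
  using D_pos n_large by (simp add: den_def)

lemma den_fits: "Q \<le> 16 * n ^ 2 \<Longrightarrow> fits 10 (den Q)"
  unfolding den_def by (rule fits_mono[OF fits_mult[OF D_fits fits_mult[OF fits_pow[OF fits_n] Q_fits]]]) auto

text \<open>The fraction computed by the program is exactly the price of the dynamics, as
  \<open>eta / Q = x / den Q\<close>. The oracle gets the very same question, so arbitrary tie
  breaking cannot separate the run from \<open>play\<close>.\<close>

lemma asked_set:
  "orc (\<lambda>i. if i \<in> S then of_int (x * dual Q t i) / of_int (den Q) else of_int (2 ^ L)) = play Q t"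
proof -
  have "(\<lambda>i. if i \<in> S then of_int (x * dual Q t i) / of_int (den Q) else of_int (2 ^ L)) =
      (\<lambda>i. if i \<in> S then price Q (dual Q t) i else 2 ^ L)"
    by (auto simp: price_def eta_def den_def mult_ac)
  then show ?thesis by (simp add: play_def demand_def)
qed

lemma wp_update_duals:
  assumes Q: "Q \<le> 16 * n ^ 2" and t: "t < rounds"
    and s: "bounded s" "env Q s"
    and k: "\<And>i. i < n \<Longrightarrow> s ''k'' (int i) = dual Q t i"
    and G: "\<And>i. i < n \<Longrightarrow> s ''G'' (int i) = (\<Sum>r<t. dual Q r i)"
    and T: "\<And>i. i < n \<Longrightarrow> s ''T'' (int i) = of_bool (i \<in> play Q t)"
  shows "wp update_duals (n * 9 + 3)
     (\<lambda>s'. bounded s' \<and> frame {''e'', ''k'', ''G''} s s' \<and>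
       (\<forall>i<n. s' ''k'' (int i) = dual Q (Suc t) i \<and> s' ''G'' (int i) = (\<Sum>r<Suc t. dual Q r i))) s"
    (is "wp _ _ ?post s")
proof -
  let ?I = "\<lambda>j s'. frame {''e'', ''k'', ''G''} s s' \<and>
     (\<forall>i<n. s' ''k'' (int i) = dual Q (if i < j then Suc t else t) i \<and>
        s' ''G'' (int i) = (\<Sum>r<(if i < j then Suc t else t). dual Q r i))"
  have "wp update_duals (n * ((1 + (1 + (1 + 1) + 1) + 1) + 3) + 3) ?post s"
    unfolding update_duals_def
  proof (rule wp_For[where I = ?I])
    show "?I 0 s" using k G by simp
    fix j s' v assume "?I j s'"
    then show "?I j (upd s' ''e'' 0 v)" by (auto intro!: frame_upd simp: upd_apply)
  next
    fix j s' assume "?I j s'"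
    then show "aval s' (var ''n'') = int n"
      using s(2) frameD[of "{''e'', ''k'', ''G''}" s s' "''n''"] by (simp add: env_def inp_def)
  next
    fix j s' assume j: "j < n" and b: "bounded s'" and I: "?I j s'" and e: "s' ''e'' 0 = int j"
    have fr: "frame {''e'', ''k'', ''G''} s s'" using I by simp
    have st: "s' ''T'' (int j) = of_bool (j \<in> play Q t)" "s' ''q'' 0 = int Q"
      using frameD[OF fr] T[OF j] s(2) by (auto simp: env_def)
    have kG: "s' ''k'' (int j) = dual Q t j" "s' ''G'' (int j) = (\<Sum>r<t. dual Q r j)"
      using I j by auto
    define u where "u = dual Q t j + int Q * of_bool (j \<in> play Q t) - 1"
    have u: "\<bar>u\<bar> \<le> 2 ^ W"
    proof -
      have "fits (max (max 14 (3 + 1) + 1) 1 + 1) (dual Q t j + int Q * of_bool (j \<in> play Q t) + (- 1))"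
        using t by (intro fits_add fits_mult dual_fits Q Q_fits fits_const) auto
      from fits_W[OF this] show ?thesis by (simp add: u_def)
    qed
    have Gv: "\<bar>\<Sum>r<Suc t. dual Q r j\<bar> \<le> 2 ^ W"
      by (rule fits_W[OF partial_sum_fits]) (use t Q in auto)
    define s1 where "s1 = upd s' ''G'' (int j) (\<Sum>r<Suc t. dual Q r j)"
    define s2 where "s2 = upd s1 ''k'' (int j) u"
    show "wp (Seq (Assign ''G'' (var ''e'') (Add (Cell ''G'' (var ''e'')) (Cell ''k'' (var ''e'')))) step_dual) (1 + (1 + (1 + 1) + 1) + 1)
       (\<lambda>s''. bounded s'' \<and> s'' ''e'' 0 = int j \<and> ?I (Suc j) s'') s'"
    proof (rule wp_Seq, rule wp_AssignI[where i = "int j" and v = "\<Sum>r<Suc t. dual Q r j"], unfold s1_def[symmetric])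
      assume b1: "bounded s1"
      have v1: "s1 ''k'' (int j) = dual Q t j" "s1 ''T'' (int j) = of_bool (j \<in> play Q t)"
        "s1 ''q'' 0 = int Q" "s1 ''e'' 0 = int j"
        using kG st e by (simp_all add: s1_def upd_apply)
      show "wp step_dual (1 + (1 + 1) + 1)
       (\<lambda>s''. bounded s'' \<and> s'' ''e'' 0 = int j \<and> ?I (Suc j) s'') s1"
      proof (rule wp_Seq, rule wp_AssignI[where i = "int j" and v = u], unfold s2_def[symmetric])
        assume b2: "bounded s2"
        have v2: "s2 ''k'' (int j) = u" "s2 ''e'' 0 = int j"
          using v1 by (simp_all add: s2_def upd_apply)
        have fr2: "frame {''e'', ''k'', ''G''} s s2"
          unfolding s2_def s1_def using fr by (intro frame_upd) auto
        have G2: "\<forall>i<n. s2 ''G'' (int i) = (\<Sum>r<(if i < Suc j then Suc t else t). dual Q r i)"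
          using I by (auto simp: s2_def s1_def upd_apply less_Suc_eq)
        have k2: "\<forall>i<n. i \<noteq> j \<longrightarrow> s2 ''k'' (int i) = dual Q (if i < Suc j then Suc t else t) i"
          using I by (auto simp: s2_def s1_def upd_apply less_Suc_eq)
        have du: "dual Q (Suc t) j = max 0 u" by (simp add: dual_Suc u_def)
        show "wp (Cond (Cell ''k'' (var ''e'')) Skip (Assign ''k'' (var ''e'') (Cst 0))) (1 + 1)
          (\<lambda>s''. bounded s'' \<and> s'' ''e'' 0 = int j \<and> ?I (Suc j) s'') s2"
        proof (rule wp_Cond)
          assume "0 < aval s2 (Cell ''k'' (var ''e''))"
          then have "s2 ''k'' (int j) = dual Q (Suc t) j" using v2 du by simp
          then have "\<forall>i<n. s2 ''k'' (int i) = dual Q (if i < Suc j then Suc t else t) i"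
            using k2 by (metis lessI)
          then show "wp Skip 1 (\<lambda>s''. bounded s'' \<and> s'' ''e'' 0 = int j \<and> ?I (Suc j) s'') s2"
            using b2 v2 fr2 G2 by (intro wp_Skip) simp
        next
          assume "\<not> 0 < aval s2 (Cell ''k'' (var ''e''))"
          then have "dual Q (Suc t) j = 0" using v2 du by simp
          then have "\<forall>i<n. upd s2 ''k'' (int j) 0 ''k'' (int i) = dual Q (if i < Suc j then Suc t else t) i"
            using k2 by (simp add: upd_apply)
          moreover have "\<forall>i<n. upd s2 ''k'' (int j) 0 ''G'' (int i) = (\<Sum>r<(if i < Suc j then Suc t else t). dual Q r i)"
            using G2 by (simp add: upd_apply)
          moreover have "frame {''e'', ''k'', ''G''} s (upd s2 ''k'' (int j) 0)"
            using fr2 by (rule frame_upd) simp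
          moreover have "upd s2 ''k'' (int j) 0 ''e'' 0 = int j" using v2 by (simp add: upd_apply)
          ultimately show "wp (Assign ''k'' (var ''e'') (Cst 0)) 1
             (\<lambda>s''. bounded s'' \<and> s'' ''e'' 0 = int j \<and> ?I (Suc j) s'') s2"
            using b2 v2 K_big by (intro wp_AssignI[where i = "int j" and v = 0]) simp_all
        qed (use b2 K_big in simp_all)
      qed (use b1 v1 K_big u u_def in simp_all)
    qed (use b e kG K_big Gv in simp_all)
  next
    fix s' assume "?I n s'" "bounded s'"
    then show "?post s'" by simp
  qed (rule loop_cost, use s n_W in simp_all)
  then show ?thesis by (rule wp_mono) (simp, assumption)
qed

text \<open>\<open>J\<close> is the private invariant of the body \<open>c\<close>. It has to
  survive all writes of the surrounding dynamics (\<open>X\<close>), while the body may write only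
  to \<open>Y\<close>, which avoids the state of the dynamics.\<close>

lemma wp_run:
  assumes Q: "1 \<le> Q" "Q \<le> 16 * n ^ 2"
    and s: "bounded s" "env Q s"
    and X: "X = {''e'', ''P'', ''Q'', ''T'', ''k'', ''G'', ''den'', ''t''}"
    and Y: "Y \<inter> {''P'', ''Q'', ''T'', ''k'', ''G'', ''den'', ''t'',
               ''n'', ''L'', ''Bp'', ''Bq'', ''S'', ''Z'', ''D'', ''x'', ''q''} = {}"
    and stable: "\<And>t s s'. J t s \<Longrightarrow> frame X s s' \<Longrightarrow> J t s'"
    and J0: "J 0 s"
    and body: "\<And>t s. t < rounds \<Longrightarrow> bounded s \<Longrightarrow> env Q s \<Longrightarrow> J t s \<Longrightarrow>
        (\<And>i. i < n \<Longrightarrow> s ''T'' (int i) = of_bool (i \<in> play Q t)) \<Longrightarrow>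
        wp c \<tau> (\<lambda>s'. bounded s' \<and> frame Y s s' \<and> J (Suc t) s') s"
  shows "wp (run c) (rounds * (n * 15 + \<tau> + 13) + n * 6 + 9)
     (\<lambda>s'. bounded s' \<and> frame (X \<union> Y) s s' \<and> J rounds s' \<and>
        (\<forall>i<n. s' ''G'' (int i) = dual_sum Q i)) s"
    (is "wp _ _ ?post s")
proof -
  let ?r = "rounds * (((n * 6 + 5) + (\<tau> + (n * 9 + 3) + 1) + 1) + 3) + 3"
  let ?Clear = "\<lambda>j s'. frame X s s' \<and> (\<forall>i<j. s' ''k'' (int i) = 0 \<and> s' ''G'' (int i) = 0)"
  let ?I = "\<lambda>t s'. frame (X \<union> Y) s s' \<and> s' ''den'' 0 = den Q \<and> J t s' \<and>
     (\<forall>i<n. s' ''k'' (int i) = dual Q t i \<and> s' ''G'' (int i) = (\<Sum>r<t. dual Q r i))"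
  have disj: "(X \<union> Y) \<inter> {''n'', ''L'', ''Bp'', ''Bq'', ''S'', ''Z'', ''D'', ''x'', ''q''} = {}"
    using X Y by auto
  have rounds: "aval s' n11_exp = int rounds" if "env Q s'" for s'
    using that by (simp add: env_def inp_def rounds_def power_numeral_reduce mult_ac)
  have loop: "wp (play_rounds c)
        ?r ?post s1"
    if b1: "bounded s1" and I1: "?I 0 s1" for s1
  proof (rule wp_For[where I = ?I])
    fix t s' v assume "?I t s'"
    moreover from this have "J t (upd s' ''t'' 0 v)"
      using stable[of t s' "upd s' ''t'' 0 v"] X frame_upd[OF frame_refl, of "''t''" X s'] by simp
    ultimately show "?I t (upd s' ''t'' 0 v)"
      using frame_upd[of "X \<union> Y" s s' "''t''" 0 v] X by (simp add: upd_apply)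
  next
    fix t s' assume "?I t s'"
    then have "env Q s'" using env_frame[OF _ s(2) disj] by simp
    then show "aval s' n11_exp = int rounds" by (rule rounds)
  next
    fix t s' assume t: "t < rounds" and b: "bounded s'" and I: "?I t s'" and tv: "s' ''t'' 0 = int t"
    have env: "env Q s'" using I env_frame[OF _ s(2) disj] by simp
    show "wp (Seq (ask (Mul (var ''x'') (Cell ''k'' (var ''e'')))) (Seq c update_duals))
        ((n * 6 + 5) + (\<tau> + (n * 9 + 3) + 1) + 1)
        (\<lambda>s''. bounded s'' \<and> s'' ''t'' 0 = int t \<and> ?I (Suc t) s'') s'"
    proof (rule wp_Seq, rule wp_mono[OF wp_ask[where Z = "2 ^ L" and d = "den Q" and k = "\<lambda>i. x * dual Q t i"]])
      show "bounded s'" "inp s'" "s' ''Z'' 0 = 2 ^ L" "s' ''den'' 0 = den Q" "0 < den Q"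
        using b env I den_pos[OF Q(1)] by (auto simp: env_def)
      show "\<bar>2 ^ L * den Q\<bar> \<le> 2 ^ W" by (rule fits_W[OF fits_mult[OF fits_2L den_fits[OF Q(2)]]]) simp
      show "aval s'' (Mul (var ''x'') (Cell ''k'' (var ''e''))) = x * dual Q t i"
        if "frame {''e'', ''P'', ''Q''} s' s''" "s'' ''e'' 0 = int i" "i < n" for s'' i
        using frameD[OF that(1), of "''x''"] frameD[OF that(1), of "''k''"] that I env by (simp add: env_def)
      show "0 \<le> x * dual Q t i \<and> \<bar>x * dual Q t i\<bar> \<le> 2 ^ W" for i
      proof
        show "0 \<le> x * dual Q t i" using x_pos dual_nonneg by simp
        show "\<bar>x * dual Q t i\<bar> \<le> 2 ^ W"
          by (rule fits_W[OF fits_mult[OF x_fits dual_fits]]) (use t Q in auto)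
      qed
      show "cost_bound W (Mul (var ''x'') (Cell ''k'' (var ''e''))) +
          value_bits W (Mul (var ''x'') (Cell ''k'' (var ''e''))) \<le> 50 * W + 100"
        by simp
    next
      fix s2 assume s2: "bounded s2 \<and> frame {''e'', ''P'', ''Q'', ''T''} s' s2 \<and>
        (\<forall>i<n. s2 ''T'' (int i) = of_bool (i \<in> orc (\<lambda>i. if i \<in> S then of_int (x * dual Q t i) / of_int (den Q) else of_int (2 ^ L))))"
      then have b2: "bounded s2" and fr2: "frame {''e'', ''P'', ''Q'', ''T''} s' s2" by simp_all
      have T2: "s2 ''T'' (int i) = of_bool (i \<in> play Q t)" if "i < n" for i
        using s2 that unfolding asked_set by blast
      have env2: "env Q s2" by (rule env_frame[OF fr2 env]) simp
      have J2: "J t s2"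
        by (rule stable) (use I fr2 X in \<open>auto simp: frame_def\<close>)
      show "wp (Seq c update_duals) (\<tau> + (n * 9 + 3) + 1)
        (\<lambda>s''. bounded s'' \<and> s'' ''t'' 0 = int t \<and> ?I (Suc t) s'') s2"
      proof (rule wp_Seq, rule wp_mono[OF body[OF t b2 env2 J2 T2] order_refl])
        fix s3 assume s3: "bounded s3 \<and> frame Y s2 s3 \<and> J (Suc t) s3"
        then have fr3: "frame Y s2 s3" by simp
        have eq: "s3 y = s2 y" if "y \<in> {''P'', ''Q'', ''T'', ''k'', ''G'', ''den'', ''t''}" for y
          using frameD[OF fr3] Y that by blast
        have eq': "s2 y = s' y" if "y \<in> {''k'', ''G'', ''den'', ''t''}" for y
          by (rule frameD[OF fr2]) (use that in auto)
        have env3: "env Q s3" by (rule env_frame[OF fr3 env2]) (use Y in auto)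
        have v3: "s3 ''den'' 0 = den Q" "s3 ''t'' 0 = int t"
          using eq eq' I tv by simp_all
        have fr: "frame (X \<union> Y) s s3"
        proof (rule frame_trans[OF _ fr3])
          show "frame (X \<union> Y) s s2"
            by (rule frame_trans[OF _ fr2, where X = "X \<union> Y"]) (use I X in auto)
        qed auto
        show "wp update_duals (n * 9 + 3)
           (\<lambda>s''. bounded s'' \<and> s'' ''t'' 0 = int t \<and> ?I (Suc t) s'') s3"
        proof (rule wp_mono[OF wp_update_duals[OF Q(2) t _ env3]])
          show "bounded s3" using s3 by simp
        next
          fix s4 assume s4: "bounded s4 \<and> frame {''e'', ''k'', ''G''} s3 s4 \<and>
            (\<forall>i<n. s4 ''k'' (int i) = dual Q (Suc t) i \<and> s4 ''G'' (int i) = (\<Sum>r<Suc t. dual Q r i))"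
          then have fr4: "frame {''e'', ''k'', ''G''} s3 s4" by simp
          have "J (Suc t) s4"
            by (rule stable[of "Suc t" s3]) (use s3 fr4 X in \<open>auto simp: frame_def\<close>)
          moreover have "frame (X \<union> Y) s s4"
            by (rule frame_trans[OF fr fr4]) (use X in auto)
          moreover have "s4 ''den'' 0 = den Q" "s4 ''t'' 0 = int t"
            using frameD[OF fr4, of "''den''"] frameD[OF fr4, of "''t''"] v3 by simp_all
          ultimately show "bounded s4 \<and> s4 ''t'' 0 = int t \<and> ?I (Suc t) s4"
            using s4 by simp
        qed (use eq eq' I T2 in simp_all)
      qed
    qed simp_all
  next
    fix s' assume "?I rounds s'" "bounded s'"
    then show "?post s'" by (simp add: dual_sum_def)
  next
    show "cost_bound W n11_exp + value_bits W n11_exp + 4 * W + 40 \<le> K" using K_big by simp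
  next
    show "int rounds \<le> 2 ^ W" using fits_W[OF rounds_fits] by simp
  qed (use b1 I1 in simp_all)
  have "wp (run c) ((n * ((1 + 1 + 1) + 3) + 3) + (1 + ?r + 1) + 1) ?post s"
    unfolding run_def
  proof (rule wp_Seq, rule wp_For[where I = ?Clear])
    fix j s' v assume "?Clear j s'"
    then show "?Clear j (upd s' ''e'' 0 v)"
      using frame_upd[of X s s' "''e''" 0 v] X by (simp add: upd_apply)
  next
    fix j s' assume "?Clear j s'"
    then show "aval s' (var ''n'') = int n"
      using s(2) frameD[of X s s' "''n''"] X by (simp add: env_def inp_def)
  next
    fix j s' assume j: "j < n" and b: "bounded s'" and I: "?Clear j s'" and e: "s' ''e'' 0 = int j"
    show "wp (Seq (Assign ''k'' (var ''e'') (Cst 0)) (Assign ''G'' (var ''e'') (Cst 0))) (1 + 1 + 1)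
       (\<lambda>s''. bounded s'' \<and> s'' ''e'' 0 = int j \<and> ?Clear (Suc j) s'') s'"
      apply (rule wp_Seq, rule wp_AssignI[where i = "int j" and v = 0])
           apply (use b e K_big in simp_all)[5]
      apply (rule wp_AssignI[where i = "int j" and v = 0])
           apply (use e K_big in \<open>simp_all add: upd_apply\<close>)[5]
      using I e X by (auto intro!: frame_upd simp: upd_apply less_Suc_eq)
  next
    fix s' assume I: "?Clear n s'" and b: "bounded s'"
    have fr: "frame X s s'" using I by simp
    have env: "env Q s'" by (rule env_frame[OF fr s(2)]) (use X in auto)
    let ?s1 = "upd s' ''den'' 0 (den Q)"
    have fr1: "frame X s ?s1" using fr X by (intro frame_upd) auto
    have I1: "?I 0 ?s1"
    proof (intro conjI)
      show "frame (X \<union> Y) s ?s1" using fr1 by (auto simp: frame_def)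
      show "J 0 ?s1" using J0 fr1 by (rule stable)
    qed (use I in \<open>simp_all add: upd_apply\<close>)
    show "wp (Seq (set_var ''den'' (Mul (var ''D'') (Mul n4_exp (var ''q'')))) (play_rounds c))
        (1 + ?r + 1) ?post s'"
    proof (rule wp_Seq, rule wp_AssignI[where i = 0 and v = "den Q"])
      show "bounded s'" by (rule b)
      show "aval s' (Mul (var ''D'') (Mul n4_exp (var ''q''))) = den Q"
        using env by (simp add: env_def inp_def den_def power_numeral_reduce)
      show "cost_bound W (Cst 0) + cost_bound W (Mul (var ''D'') (Mul n4_exp (var ''q''))) + 1 \<le> K"
        using K_big by simp
      show "\<bar>den Q\<bar> \<le> 2 ^ W" by (rule fits_W[OF den_fits[OF Q(2)]]) simp
    qed (simp, rule loop, simp, rule I1)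
  qed (rule loop_cost, use s n_W in simp_all)
  then show ?thesis by (rule wp_mono) (simp add: algebra_simps, assumption)
qed

end

section \<open>Writing the vectors\<close>

abbreviation slot :: "string \<Rightarrow> aexp" where
  "slot i \<equiv> Add (Mul (var ''m'') (var ''n'')) (var i)"

text \<open>The test \<open>0 < 1 - (b - j)\<^sup>2\<close> expresses \<open>b = j\<close>.\<close>

abbreviation in_block :: aexp where
  "in_block \<equiv> Mul (Cell ''T'' (var ''e'')) (Sub (Cst 1) (Mul (Sub (Cell ''bl'' (var ''e'')) (var ''j'')) (Sub (Cell ''bl'' (var ''e'')) (var ''j''))))"

abbreviation entry_value :: com where
  "entry_value \<equiv> Cond (Sub (var ''H'') (Mul (Cell ''g'' (var ''e'')) (var ''lv''))) (Assign ''dp'' (slot ''e'') (Mul (var ''Bp'') (Mul (Cell ''g'' (var ''e'')) (var ''lv'')))) (Assign ''dp'' (slot ''e'') (Mul (var ''Bp'') (var ''H'')))"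

text \<open>The denominator goes into every slot, also where the coordinate is 0, because a valid
  output has positive denominators throughout.\<close>

definition emit_entry :: com where
  "emit_entry =
     Seq (Assign ''dq'' (slot ''e'') (Mul (Mul (Cst 4) (var ''H'')) (var ''Bq'')))
     (Cond in_block
       entry_value
       (Assign ''dp'' (slot ''e'') (Cst 0)))"

text \<open>The slot of \<open>f\<close> is overwritten after the loop has filled it, and
  \<open>m\<close> grows only afterwards, since the mark depends on the position of the current
  vector.\<close>

definition emit_block :: com where
  "emit_block =
     Seq (For ''e'' (var ''n'') emit_entry)
    (Seq (Assign ''dp'' (slot ''f'') (Mul (var ''Bp'') (Add (var ''m'') (Cst 2))))
    (Seq (Assign ''dq'' (slot ''f'') (Mul (var ''Bq'') (Mul (Cst 4) (Add (var ''m'') (Cst 1)))))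
    (set_var ''m'' (Add (var ''m'') (Cst 1)))))"

text \<open>The block number is taken before \<open>acc\<close> grows by the element itself:
  \<open>block_of\<close> sums over strictly smaller indices.\<close>

abbreviation number_entry :: com where
  "number_entry \<equiv> Seq (Assign ''bl'' (var ''e'') (Quo (Mul (var ''acc'') (var ''lv'')) (var ''H''))) (set_var ''acc'' (Add (var ''acc'') (Mul (Cell ''T'' (var ''e'')) (Cell ''g'' (var ''e'')))))"

abbreviation count_blocks :: com where
  "count_blocks \<equiv> set_var ''c'' (Add (Quo (Mul (var ''acc'') (var ''lv'')) (var ''H'')) (Cst 1))"

definition block_numbers :: com where
  "block_numbers =
     Seq (set_var ''acc'' (Cst 0))
    (Seq (For ''e'' (var ''n'') number_entry)
    count_blocks)"

definition emit :: com where
  "emit = Seq block_numbers (For ''j'' (var ''c'') emit_block)"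

context machine_game
begin

definition B :: real where "B = Bp / Bq"

definition emitted :: "nat \<Rightarrow> (nat \<Rightarrow> real) list \<Rightarrow> state \<Rightarrow> bool" where
  "emitted f ys s \<longleftrightarrow> s ''m'' 0 = int (length ys) \<and>
     (\<forall>k<length ys. \<forall>e<n. 0 < s ''dq'' (int (k * n + e)) \<and>
        s ''dp'' (int (k * n + e)) / s ''dq'' (int (k * n + e)) = marked B f k (ys ! k) e)"

lemma emitted_cong:
  assumes "emitted f ys s" "s' ''m'' = s ''m''" "s' ''dp'' = s ''dp''" "s' ''dq'' = s ''dq''"
  shows "emitted f ys s'"
  using assms by (simp add: emitted_def)

lemma emitted_snoc:
  assumes ys: "emitted f ys s" and m: "s' ''m'' 0 = int (length ys) + 1"
    and old: "\<And>i. i < length ys * n \<Longrightarrow> s' ''dp'' (int i) = s ''dp'' (int i) \<and> s' ''dq'' (int i) = s ''dq'' (int i)"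
    and new: "\<And>e. e < n \<Longrightarrow> 0 < s' ''dq'' (int (length ys * n + e)) \<and>
        s' ''dp'' (int (length ys * n + e)) / s' ''dq'' (int (length ys * n + e)) = marked B f (length ys) y e"
  shows "emitted f (ys @ [y]) s'"
  unfolding emitted_def
proof (intro conjI allI impI)
  show "s' ''m'' 0 = int (length (ys @ [y]))" using m by simp
  fix k e assume k: "k < length (ys @ [y])" and e: "e < n"
  consider "k < length ys" | "k = length ys" using k by fastforce
  then have "0 < s' ''dq'' (int (k * n + e)) \<and>
      s' ''dp'' (int (k * n + e)) / s' ''dq'' (int (k * n + e)) = marked B f k ((ys @ [y]) ! k) e"
  proof cases
    case 1
    then have "Suc k * n \<le> length ys * n" by (intro mult_right_mono) auto
    then have "k * n + e < length ys * n" using e by simp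
    then show ?thesis using old[of "k * n + e"] ys 1 e by (simp add: emitted_def nth_append)
  next
    case 2
    then show ?thesis using new[OF e] by simp
  qed
  then show "0 < s' ''dq'' (int (k * n + e))"
    "s' ''dp'' (int (k * n + e)) / s' ''dq'' (int (k * n + e)) = marked B f k ((ys @ [y]) ! k) e"
    by simp_all
qed

end

locale emission = machine_game n L orc S Bp Bq w
  for n L :: nat and orc :: "(nat \<Rightarrow> real) \<Rightarrow> nat set" and S :: "nat set" and Bp Bq :: int
    and w :: "nat set \<Rightarrow> real" +
  fixes f Q :: nat and T :: "nat set" and g :: "nat \<Rightarrow> int" and H :: int
  assumes f: "f < n" and T: "T \<subseteq> {..<n}" and Q_fits: "fits 3 (int Q)"
    and g: "\<And>e. 0 \<le> g e" "\<And>e. fits 25 (g e)" and H: "0 < H" "fits 30 H"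
begin

definition ready :: "state \<Rightarrow> bool" where
  "ready s \<longleftrightarrow> inp s \<and> (\<forall>i<n. s ''T'' (int i) = of_bool (i \<in> T) \<and> s ''g'' (int i) = g i)
     \<and> s ''H'' 0 = H \<and> s ''lv'' 0 = int Q \<and> s ''f'' 0 = int f"

lemma ready_frame:
  assumes "frame X s s'" "ready s"
    "X \<inter> {''n'', ''L'', ''Bp'', ''Bq'', ''S'', ''T'', ''g'', ''H'', ''lv'', ''f''} = {}"
  shows "ready s'"
proof -
  have "s' y = s y" if "y \<in> {''T'', ''g'', ''H'', ''lv'', ''f''}" for y
  proof (rule frameD[OF assms(1)])
    have "y \<in> {''n'', ''L'', ''Bp'', ''Bq'', ''S'', ''T'', ''g'', ''H'', ''lv'', ''f''}"
      using that by (elim insertE emptyE) simp_all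
    then show "y \<notin> X" using assms(3) by (meson disjoint_iff)
  qed
  moreover have "inp s'"
    by (rule inp_frame[OF assms(1)]) (use assms(2,3) in \<open>auto simp: ready_def\<close>)
  ultimately show ?thesis using assms(2) by (simp add: ready_def)
qed

lemma fin_T: "finite T"
  using T finite_subset by blast

definition pre :: "nat \<Rightarrow> int" where "pre e = (\<Sum>i\<in>{i \<in> T. i < e}. g i)"

lemma pre_Suc: "pre (Suc e) = pre e + of_bool (e \<in> T) * g e"
proof -
  have "{i \<in> T. i < Suc e} = (if e \<in> T then insert e {i \<in> T. i < e} else {i \<in> T. i < e})"
    by (auto simp: less_Suc_eq)
  then show ?thesis using fin_T by (simp add: pre_def)
qed

lemma pre_n: "pre n = (\<Sum>i\<in>T. g i)"
  unfolding pre_def by (rule sum.cong) (use T in auto)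

lemma pre_nonneg: "0 \<le> pre e"
  unfolding pre_def by (intro sum_nonneg g)

lemma pre_fits: "fits 26 (pre e)"
proof (rule fits_le)
  have "pre e \<le> (\<Sum>i\<in>T. g i)"
    unfolding pre_def using fin_T g by (intro sum_mono2) auto
  also have "\<dots> \<le> (\<Sum>i<n. g i)" using T g by (intro sum_mono2) auto
  also have "\<dots> \<le> (\<Sum>i<n. 2 ^ (25 * (n + L)))"
    using g by (intro sum_mono) (simp add: fits_def)
  also have "\<dots> = int n * 2 ^ (25 * (n + L))" by simp
  finally show "pre e \<le> int n * 2 ^ (25 * (n + L))" .
  show "fits 26 (int n * 2 ^ (25 * (n + L)))"
    by (rule fits_mono[OF fits_mult[OF fits_n, of 25]]) (simp_all add: fits_def)
qed (rule pre_nonneg)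

lemma block_fits: "fits 29 (pre e * int Q div H)"
proof -
  have "\<bar>pre e * int Q div H\<bar> \<le> \<bar>pre e * int Q\<bar>" by (rule abs_div_le)
  moreover have "fits 29 (pre e * int Q)"
    by (rule fits_mono[OF fits_mult[OF pre_fits Q_fits]]) simp
  ultimately show ?thesis unfolding fits_def by linarith
qed

lemma block_of_pre: "block_of g T Q H e = pre e * int Q div H"
  by (simp add: block_of_def pre_def)

lemma block_count_pre: "int (block_count g T Q H) = pre n * int Q div H + 1"
  using pre_nonneg[of n] H by (simp add: block_count_def pos_imp_zdiv_nonneg_iff flip: pre_n)

lemma wp_block_numbers:
  assumes s: "bounded s" "ready s"
  shows "wp block_numbers (n * 6 + 7)
     (\<lambda>s'. bounded s' \<and> frame {''e'', ''acc'', ''bl'', ''c''} s s' \<and>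
       (\<forall>i<n. s' ''bl'' (int i) = block_of g T Q H i) \<and> s' ''c'' 0 = int (block_count g T Q H)) s"
    (is "wp _ _ ?post s")
proof -
  let ?X = "{''e'', ''acc'', ''bl'', ''c''}"
  let ?I = "\<lambda>j s'. frame ?X s s' \<and> s' ''acc'' 0 = pre j \<and>
     (\<forall>i<j. s' ''bl'' (int i) = block_of g T Q H i)"
  have preW: "\<bar>pre e\<bar> \<le> 2 ^ W" for e by (rule fits_W[OF pre_fits]) simp
  have blW: "\<bar>pre e * int Q div H\<bar> \<le> 2 ^ W" for e by (rule fits_W[OF block_fits]) simp
  have rdy: "ready s'" if "frame ?X s s'" for s'
    by (rule ready_frame[OF that s(2)]) simp
  have "wp block_numbers (1 + ((n * ((1 + 1 + 1) + 3) + 3) + 1 + 1) + 1) ?post s"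
    unfolding block_numbers_def
  proof (rule wp_Seq, rule wp_AssignI[where i = 0 and v = 0])
    assume b1: "bounded (upd s ''acc'' 0 0)"
    show "wp (Seq (For ''e'' (var ''n'') number_entry)
      count_blocks)
      ((n * ((1 + 1 + 1) + 3) + 3) + 1 + 1) ?post (upd s ''acc'' 0 0)"
    proof (rule wp_Seq, rule wp_For[where I = ?I])
      show "?I 0 (upd s ''acc'' 0 0)" by (auto intro!: frame_upd simp: upd_apply pre_def)
    next
      fix j s' v assume "?I j s'"
      then show "?I j (upd s' ''e'' 0 v)" using frame_upd[of ?X s s' "''e''" 0 v] by (simp add: upd_apply)
    next
      fix j s' assume "?I j s'"
      then show "aval s' (var ''n'') = int n" using rdy[of s'] by (simp add: ready_def inp_def)
    next
      fix j s' assume j: "j < n" and b: "bounded s'" and I: "?I j s'" and e: "s' ''e'' 0 = int j"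
      have rd: "ready s'" using rdy I by simp
      define s1 where "s1 = upd s' ''bl'' (int j) (pre j * int Q div H)"
      show "wp number_entry (1 + 1 + 1)
        (\<lambda>s''. bounded s'' \<and> s'' ''e'' 0 = int j \<and> ?I (Suc j) s'') s'"
      proof (rule wp_Seq, rule wp_AssignI[where i = "int j" and v = "pre j * int Q div H"], unfold s1_def[symmetric])
        assume b1: "bounded s1"
        have fr1: "frame ?X s s1" unfolding s1_def using I by (intro frame_upd) auto
        have v1: "s1 ''e'' 0 = int j" "s1 ''acc'' 0 = pre j" using e I by (simp_all add: s1_def upd_apply)
        show "wp (set_var ''acc'' (Add (var ''acc'') (Mul (Cell ''T'' (var ''e'')) (Cell ''g'' (var ''e''))))) 1
          (\<lambda>s''. bounded s'' \<and> s'' ''e'' 0 = int j \<and> ?I (Suc j) s'') s1"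
        proof (rule wp_AssignI[where i = 0 and v = "pre (Suc j)"])
          show "aval s1 (Add (var ''acc'') (Mul (Cell ''T'' (var ''e'')) (Cell ''g'' (var ''e'')))) = pre (Suc j)"
            using v1 rdy[OF fr1] j by (simp add: ready_def pre_Suc)
          have "frame ?X s (upd s1 ''acc'' 0 (pre (Suc j)))" using fr1 by (rule frame_upd) simp
          moreover have "\<forall>i<Suc j. s1 ''bl'' (int i) = block_of g T Q H i"
            using I by (simp add: s1_def upd_apply less_Suc_eq block_of_pre)
          ultimately show "bounded (upd s1 ''acc'' 0 (pre (Suc j))) \<Longrightarrow>
             bounded (upd s1 ''acc'' 0 (pre (Suc j))) \<and> upd s1 ''acc'' 0 (pre (Suc j)) ''e'' 0 = int j \<and>
             ?I (Suc j) (upd s1 ''acc'' 0 (pre (Suc j)))"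
            using v1 by (simp add: upd_apply)
        qed (use b1 preW K_big in simp_all)
      next
        show "aval s' (Quo (Mul (var ''acc'') (var ''lv'')) (var ''H'')) = pre j * int Q div H"
          using I rd by (simp add: ready_def)
      qed (use b e blW K_big in simp_all)
    next
      fix s' assume I: "?I n s'" and b: "bounded s'"
      have rd: "ready s'" using rdy I by simp
      show "wp count_blocks 1 ?post s'"
      proof (rule wp_AssignI[where i = 0 and v = "int (block_count g T Q H)"])
        show "aval s' (Add (Quo (Mul (var ''acc'') (var ''lv'')) (var ''H'')) (Cst 1)) = int (block_count g T Q H)"
          using I rd by (simp add: ready_def block_count_pre)
        have "fits (max 29 1 + 1) (pre n * int Q div H + 1)"
          by (intro fits_add block_fits fits_const) simp
        then show "\<bar>int (block_count g T Q H)\<bar> \<le> 2 ^ W"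
          unfolding block_count_pre by (rule fits_W) simp
        have "frame ?X s (upd s' ''c'' 0 (int (block_count g T Q H)))" using I by (intro frame_upd) auto
        then show "bounded (upd s' ''c'' 0 (int (block_count g T Q H))) \<Longrightarrow>
            ?post (upd s' ''c'' 0 (int (block_count g T Q H)))"
          using I by (simp add: upd_apply)
      qed (use b K_big in simp_all)
    qed (rule loop_cost, use b1 n_W in simp_all)
  qed (use s K_big in simp_all)
  then show ?thesis by (rule wp_mono) (simp add: algebra_simps, assumption)
qed

definition entry :: "nat \<Rightarrow> nat \<Rightarrow> int" where
  "entry j e = (if e \<in> T \<and> block_of g T Q H e = int j then Bp * min (g e * int Q) H else 0)"

lemma entry_share: "entry j e / (4 * H * Bq) = block_vec B g T Q H j e"
  using H Bq_fits by (simp add: entry_def block_vec_def share_def B_def)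

lemma entry_bounded: "\<bar>entry j e\<bar> \<le> 2 ^ W"
proof (cases "e \<in> T \<and> block_of g T Q H e = int j")
  case True
  have "fits 30 (min (g e * int Q) H)"
    by (rule fits_le[OF H(2)]) (use g H in auto)
  from fits_W[OF fits_mult[OF Bp_fits(1) this]] show ?thesis using True by (simp add: entry_def)
next
  case False
  then have "entry j e = 0" unfolding entry_def by (rule if_not_P)
  then show ?thesis by simp
qed

lemma wp_emit_entry:
  assumes b: "bounded s" and rd: "ready s" and i: "i < n"
    and v: "s ''e'' 0 = int i" "s ''m'' 0 = int m" "s ''j'' 0 = int j" "s ''bl'' (int i) = block_of g T Q H i"
    and P: "\<And>s'. bounded s' \<Longrightarrow>
       s' = upd (upd s ''dq'' (int (m * n + i)) (4 * H * Bq)) ''dp'' (int (m * n + i)) (entry j i) \<Longrightarrow> P s'"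
  shows "wp emit_entry 5 P s"
proof -
  define s1 where "s1 = upd s ''dq'' (int (m * n + i)) (4 * H * Bq)"
  have dqW: "\<bar>4 * H * Bq\<bar> \<le> 2 ^ W"
    by (rule fits_W[OF fits_mult[OF fits_mult[OF fits_const H(2)] Bq_fits(1)]]) simp_all
  have "wp emit_entry (1 + ((1 + 1) + 1) + 1) P s"
    unfolding emit_entry_def
  proof (rule wp_Seq, rule wp_AssignI[where i = "int (m * n + i)" and v = "4 * H * Bq"], unfold s1_def[symmetric])
    assume b1: "bounded s1"
    have st: "s1 ''T'' (int i) = of_bool (i \<in> T)" "s1 ''bl'' (int i) = block_of g T Q H i" "s1 ''j'' 0 = int j"
      "s1 ''e'' 0 = int i" "s1 ''g'' (int i) = g i" "s1 ''lv'' 0 = int Q" "s1 ''H'' 0 = H" "s1 ''Bp'' 0 = Bp"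
      "s1 ''m'' 0 = int m" "s1 ''n'' 0 = int n"
      using rd v i by (simp_all add: s1_def upd_apply ready_def inp_def)
    have fin: "wp (Assign ''dp'' (slot ''e'') a) 1 P s1" if "aval s1 a = entry j i" "cost_bound W a \<le> 900 * W" for a
    proof (rule wp_AssignI[where i = "int (m * n + i)" and v = "entry j i"])
      show "bounded (upd s1 ''dp'' (int (m * n + i)) (entry j i)) \<Longrightarrow> P (upd s1 ''dp'' (int (m * n + i)) (entry j i))"
        using P by (simp add: s1_def)
      show "cost_bound W (slot ''e'') + cost_bound W a + 1 \<le> K" using that K_big by simp
    qed (use b1 st that entry_bounded in simp_all)
    have W: "480 \<le> W" using n_large by (simp add: W_def)
    let ?d = "block_of g T Q H i - int j"
    have test: "0 < (1 - ?d * ?d :: int) \<longleftrightarrow> ?d = 0"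
    proof
      assume "0 < 1 - ?d * ?d"
      then have "?d * ?d = 0" using zero_le_square[of ?d] by linarith
      then show "?d = 0" by simp
    qed simp
    show "wp (Cond in_block
       entry_value
       (Assign ''dp'' (slot ''e'') (Cst 0))) ((1 + 1) + 1) P s1"
    proof (rule wp_Cond)
      assume "0 < aval s1 in_block"
      then have "0 < of_bool (i \<in> T) * (1 - ?d * ?d)" using st by simp
      then have on: "i \<in> T" "?d = 0" using test by (auto split: if_splits simp: of_bool_def)
      show "wp entry_value (1 + 1) P s1"
      proof (rule wp_Cond)
        assume "0 < aval s1 (Sub (var ''H'') (Mul (Cell ''g'' (var ''e'')) (var ''lv'')))"
        then have "g i * int Q < H" using st by simp
        then show "wp (Assign ''dp'' (slot ''e'') (Mul (var ''Bp'') (Mul (Cell ''g'' (var ''e'')) (var ''lv'')))) 1 P s1"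
          using on st W by (intro fin) (simp_all add: entry_def)
      next
        assume "\<not> 0 < aval s1 (Sub (var ''H'') (Mul (Cell ''g'' (var ''e'')) (var ''lv'')))"
        then have "H \<le> g i * int Q" using st by simp
        then show "wp (Assign ''dp'' (slot ''e'') (Mul (var ''Bp'') (var ''H''))) 1 P s1"
          using on st W by (intro fin) (simp_all add: entry_def)
      qed (use b1 K_big in simp_all)
    next
      assume "\<not> 0 < aval s1 in_block"
      then have "\<not> (i \<in> T \<and> ?d = 0)" using st test by auto
      then have "entry j i = 0" by (auto simp: entry_def)
      then have "wp (Assign ''dp'' (slot ''e'') (Cst 0)) 1 P s1"
        using W by (intro fin) simp_all
      then show "wp (Assign ''dp'' (slot ''e'') (Cst 0)) (1 + 1) P s1" by (rule wp_mono) simp_all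
    qed (use b1 K_big in simp_all)
  next
    show "aval s (slot ''e'') = int (m * n + i)" "aval s (Mul (Mul (Cst 4) (var ''H'')) (var ''Bq'')) = 4 * H * Bq"
      using rd v by (simp_all add: ready_def inp_def)
  qed (use b dqW K_big in simp_all)
  then show ?thesis by (rule wp_mono) simp_all
qed

lemma wp_emit_block:
  assumes s: "bounded s" "ready s"
    and v: "s ''j'' 0 = int j" "\<And>i. i < n \<Longrightarrow> s ''bl'' (int i) = block_of g T Q H i"
    and ys: "emitted f ys s" "fits 30 (int (length ys))"
  shows "wp emit_block (n * 8 + 10)
     (\<lambda>s'. bounded s' \<and> frame {''e'', ''dp'', ''dq'', ''m''} s s' \<and>
        emitted f (ys @ [block_vec B g T Q H j]) s') s"
    (is "wp _ _ ?post s")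
proof -
  let ?m = "length ys"
  let ?I = "\<lambda>i s'. frame {''e'', ''dp'', ''dq''} s s' \<and>
     (\<forall>a < ?m * n. s' ''dp'' (int a) = s ''dp'' (int a) \<and> s' ''dq'' (int a) = s ''dq'' (int a)) \<and>
     (\<forall>e<i. s' ''dp'' (int (?m * n + e)) = entry j e \<and> s' ''dq'' (int (?m * n + e)) = 4 * H * Bq)"
  have m: "s ''m'' 0 = int ?m" using ys by (simp add: emitted_def)
  have keep: "s' y = s y" if "frame {''e'', ''dp'', ''dq''} s s'" "y \<in> {''n'', ''m'', ''j'', ''bl'', ''Bp'', ''Bq'', ''f''}" for s' y
    by (rule frameD[OF that(1)]) (use that(2) in auto)
  have rdy: "ready s'" if "frame {''e'', ''dp'', ''dq''} s s'" for s'
    by (rule ready_frame[OF that s(2)]) simp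
  have m_fits: "fits 32 (int ?m + 2)"
    by (rule fits_mono[OF fits_add[OF ys(2) fits_const[of 2]]]) simp_all
  define p1 where "p1 = Bp * (int ?m + 2)"
  define q1 where "q1 = Bq * (4 * (int ?m + 1))"
  have p1W: "\<bar>p1\<bar> \<le> 2 ^ W"
    unfolding p1_def by (rule fits_W[OF fits_mult[OF Bp_fits(1) m_fits]]) simp
  have m1_fits: "fits 32 (int ?m + 1)" by (rule fits_le[OF m_fits]) simp_all
  have q1W: "\<bar>q1\<bar> \<le> 2 ^ W"
    unfolding q1_def by (rule fits_W[OF fits_mult[OF Bq_fits(1) fits_mult[OF fits_const m1_fits]]]) simp_all
  have "wp emit_block ((n * (5 + 3) + 3) + (1 + (1 + 1 + 1) + 1) + 1) ?post s"
    unfolding emit_block_def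
  proof (rule wp_Seq, rule wp_For[where I = ?I])
    fix i s' a assume "?I i s'"
    then show "?I i (upd s' ''e'' 0 a)"
      using frame_upd[of "{''e'', ''dp'', ''dq''}" s s' "''e''" 0 a] by (simp add: upd_apply)
  next
    fix i s' assume "?I i s'"
    then show "aval s' (var ''n'') = int n" using rdy[of s'] by (simp add: ready_def inp_def)
  next
    fix i s' assume i: "i < n" and b: "bounded s'" and I: "?I i s'" and e: "s' ''e'' 0 = int i"
    have fr: "frame {''e'', ''dp'', ''dq''} s s'" using I by simp
    show "wp emit_entry 5 (\<lambda>s''. bounded s'' \<and> s'' ''e'' 0 = int i \<and> ?I (Suc i) s'') s'"
    proof (rule wp_emit_entry[where m = ?m and j = j and i = i])
      fix s2 assume b2: "bounded s2"
        and s2: "s2 = upd (upd s' ''dq'' (int (?m * n + i)) (4 * H * Bq)) ''dp'' (int (?m * n + i)) (entry j i)"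
      have "frame {''e'', ''dp'', ''dq''} s s2" unfolding s2 using fr by (intro frame_upd) auto
      moreover have "\<forall>a < ?m * n. s2 ''dp'' (int a) = s ''dp'' (int a) \<and> s2 ''dq'' (int a) = s ''dq'' (int a)"
        using I by (simp add: s2 upd_apply del: of_nat_add of_nat_mult)
      moreover have "\<forall>e<Suc i. s2 ''dp'' (int (?m * n + e)) = entry j e \<and> s2 ''dq'' (int (?m * n + e)) = 4 * H * Bq"
        using I by (simp add: s2 upd_apply less_Suc_eq del: of_nat_add of_nat_mult)
      moreover have "s2 ''e'' 0 = int i" using e by (simp add: s2 upd_apply)
      ultimately show "bounded s2 \<and> s2 ''e'' 0 = int i \<and> ?I (Suc i) s2" using b2 by simp
    qed (use b rdy[OF fr] i e keep[OF fr] v m in simp_all)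
  next
    fix s' assume I: "?I n s'" and b: "bounded s'"
    have fr: "frame {''e'', ''dp'', ''dq''} s s'" using I by simp
    note rd = rdy[OF fr]
    let ?sl = "int (?m * n + f)"
    define s1 where "s1 = upd s' ''dp'' ?sl p1"
    define s2 where "s2 = upd s1 ''dq'' ?sl q1"
    define s3 where "s3 = upd s2 ''m'' 0 (int ?m + 1)"
    have st: "s' ''m'' 0 = int ?m" "s' ''n'' 0 = int n" "s' ''f'' 0 = int f" "s' ''Bp'' 0 = Bp" "s' ''Bq'' 0 = Bq"
      using keep[OF fr] m rd by (simp_all add: ready_def inp_def)
    have post: "?post s3" if "bounded s3"
    proof (intro conjI)
      show "frame {''e'', ''dp'', ''dq'', ''m''} s s3"
        unfolding s3_def s2_def s1_def using fr by (intro frame_upd) (auto simp: frame_def)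
      show "emitted f (ys @ [block_vec B g T Q H j]) s3"
      proof (rule emitted_snoc[OF ys(1)])
        show "s3 ''m'' 0 = int ?m + 1" by (simp add: s3_def upd_apply)
        show "s3 ''dp'' (int a) = s ''dp'' (int a) \<and> s3 ''dq'' (int a) = s ''dq'' (int a)" if "a < ?m * n" for a
          using that I by (simp add: s3_def s2_def s1_def upd_apply del: of_nat_add of_nat_mult)
        fix e assume e: "e < n"
        show "0 < s3 ''dq'' (int (?m * n + e)) \<and>
          s3 ''dp'' (int (?m * n + e)) / s3 ''dq'' (int (?m * n + e)) = marked B f ?m (block_vec B g T Q H j) e"
        proof (cases "e = f")
          case True
          then have "s3 ''dp'' (int (?m * n + e)) = p1" "s3 ''dq'' (int (?m * n + e)) = q1"
            by (simp_all add: s3_def s2_def s1_def upd_apply)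
          moreover have "0 < q1" using Bq_fits by (simp add: q1_def)
          moreover have "p1 / q1 = marked B f ?m (block_vec B g T Q H j) f"
            by (simp add: p1_def q1_def marked_def B_def add.commute)
          ultimately show ?thesis using True by simp
        next
          case False
          then have "s3 ''dp'' (int (?m * n + e)) = entry j e" "s3 ''dq'' (int (?m * n + e)) = 4 * H * Bq"
            using I e by (simp_all add: s3_def s2_def s1_def upd_apply del: of_nat_add of_nat_mult)
          moreover have "0 < 4 * H * Bq" using H Bq_fits by simp
          ultimately show ?thesis using entry_share[of j e] False by (simp add: marked_def)
        qed
      qed
    qed (rule that)
    show "wp (Seq (Assign ''dp'' (slot ''f'') (Mul (var ''Bp'') (Add (var ''m'') (Cst 2))))
      (Seq (Assign ''dq'' (slot ''f'') (Mul (var ''Bq'') (Mul (Cst 4) (Add (var ''m'') (Cst 1)))))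
      (set_var ''m'' (Add (var ''m'') (Cst 1))))) (1 + (1 + 1 + 1) + 1) ?post s'"
      apply (rule wp_Seq, rule wp_AssignI[where i = "?sl" and v = p1])
           apply (use b st K_big p1W in \<open>simp_all add: p1_def\<close>)[5]
      apply (unfold s1_def[symmetric])
      apply (rule wp_Seq, rule wp_AssignI[where i = "?sl" and v = q1])
           apply assumption
          apply (use K_big in simp)
         apply (use st in \<open>simp add: s1_def upd_apply\<close>)
        apply (use st in \<open>simp add: s1_def upd_apply q1_def\<close>)
       apply (rule q1W)
      apply (unfold s2_def[symmetric])
      apply (rule wp_AssignI[where i = 0 and v = "int ?m + 1"])
           apply assumption
          apply (use K_big in simp)
         apply simp
        apply (use st in \<open>simp add: s2_def s1_def upd_apply\<close>)
       apply (use fits_W[OF m1_fits] in simp)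
      apply (unfold s3_def[symmetric])
      by (rule post)
  qed (rule loop_cost, use s n_W in simp_all)
  then show ?thesis by (rule wp_mono) (simp, assumption)
qed

text \<open>\<open>C\<close> bounds the number of blocks independently of the round, so that all
  rounds of a run share one cost. \<open>M\<close> bounds the length of the finished list and with
  it the size of counters and marks.\<close>

lemma wp_emit:
  assumes s: "bounded s" "ready s"
    and ys: "emitted f ys s" "length ys + block_count g T Q H \<le> M" "fits 30 (int M)"
    and C: "block_count g T Q H \<le> C"
  shows "wp emit (C * (n * 8 + 13) + n * 6 + 11)
     (\<lambda>s'. bounded s' \<and> frame {''e'', ''acc'', ''bl'', ''c'', ''j'', ''dp'', ''dq'', ''m''} s s' \<and>
        emitted f (ys @ block_vecs B g T Q H) s') s"
    (is "wp _ _ ?post s")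
proof -
  let ?X = "{''e'', ''acc'', ''bl'', ''c''}"
  let ?Y = "{''e'', ''j'', ''dp'', ''dq'', ''m''}"
  let ?c = "block_count g T Q H"
  have "wp emit ((n * 6 + 7) + (?c * ((n * 8 + 10) + 3) + 3) + 1) ?post s"
    unfolding emit_def
  proof (rule wp_Seq, rule wp_mono[OF wp_block_numbers[OF s] order_refl])
    fix s1 assume s1: "bounded s1 \<and> frame ?X s s1 \<and>
       (\<forall>i<n. s1 ''bl'' (int i) = block_of g T Q H i) \<and> s1 ''c'' 0 = int ?c"
    then have fr1: "frame ?X s s1" by simp
    have rd1: "ready s1" by (rule ready_frame[OF fr1 s(2)]) simp
    have e1: "emitted f ys s1"
      using frameD[OF fr1, of "''m''"] frameD[OF fr1, of "''dp''"] frameD[OF fr1, of "''dq''"]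
      by (intro emitted_cong[OF ys(1)]) simp_all
    let ?I = "\<lambda>j s'. frame ?Y s1 s' \<and> emitted f (ys @ map (block_vec B g T Q H) [0..<j]) s'"
    show "wp (For ''j'' (var ''c'') emit_block) (?c * ((n * 8 + 10) + 3) + 3) ?post s1"
    proof (rule wp_For[where I = ?I])
      show "?I 0 s1" using e1 by simp
    next
      fix j s' v assume I: "?I j s'"
      show "?I j (upd s' ''j'' 0 v)"
      proof
        show "frame ?Y s1 (upd s' ''j'' 0 v)" using I by (intro frame_upd) auto
        show "emitted f (ys @ map (block_vec B g T Q H) [0..<j]) (upd s' ''j'' 0 v)"
          by (rule emitted_cong) (use I in \<open>simp_all add: upd_def\<close>)
      qed
    next
      fix j s' assume "?I j s'"
      then show "aval s' (var ''c'') = int ?c"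
        using frameD[of ?Y s1 s' "''c''"] s1 by simp
    next
      fix j s' assume j: "j < ?c" and b: "bounded s'" and I: "?I j s'" and jv: "s' ''j'' 0 = int j"
      have fr: "frame ?Y s1 s'" using I by simp
      have len: "fits 30 (int (length (ys @ map (block_vec B g T Q H) [0..<j])))"
        by (rule fits_le[OF ys(3)]) (use ys(2) j in simp_all)
      have bl: "s' ''bl'' (int i) = block_of g T Q H i" if "i < n" for i
        using frameD[OF fr, of "''bl''"] s1 that by simp
      have rd: "ready s'" by (rule ready_frame[OF fr rd1]) simp
      show "wp emit_block (n * 8 + 10) (\<lambda>s''. bounded s'' \<and> s'' ''j'' 0 = int j \<and> ?I (Suc j) s'') s'"
      proof (rule wp_mono[OF wp_emit_block[OF b rd jv bl conjunct2[OF I] len] order_refl])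
        fix s2 assume s2: "bounded s2 \<and> frame {''e'', ''dp'', ''dq'', ''m''} s' s2 \<and>
          emitted f ((ys @ map (block_vec B g T Q H) [0..<j]) @ [block_vec B g T Q H j]) s2"
        then have fr2: "frame {''e'', ''dp'', ''dq'', ''m''} s' s2" by simp
        have "frame ?Y s1 s2" by (rule frame_trans[OF fr fr2]) auto
        moreover have "s2 ''j'' 0 = int j" using frameD[OF fr2, of "''j''"] jv by simp
        ultimately show "bounded s2 \<and> s2 ''j'' 0 = int j \<and> ?I (Suc j) s2" using s2 by simp
      qed
    next
      fix s' assume I: "?I ?c s'" and b: "bounded s'"
      have "frame {''e'', ''acc'', ''bl'', ''c'', ''j'', ''dp'', ''dq'', ''m''} s s'"
        by (rule frame_trans[OF fr1 conjunct1[OF I]]) auto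
      then show "?post s'" using I b by (simp add: block_vecs_def)
    next
      show "cost_bound W (var ''c'') + value_bits W (var ''c'') + 4 * W + 40 \<le> K" by (rule loop_cost)
    next
      have "fits 30 (int ?c)" by (rule fits_le[OF ys(3)]) (use ys(2) in simp_all)
      from fits_W[OF this] show "int ?c \<le> 2 ^ W" by simp
    qed (use s1 in simp_all)
  qed
  then show ?thesis
  proof (rule wp_mono)
    have "?c * (n * 8 + 13) \<le> C * (n * 8 + 13)" using C by (rule mult_right_mono) simp
    then show "(n * 6 + 7) + (?c * ((n * 8 + 10) + 3) + 3) + 1 \<le> C * (n * 8 + 13) + n * 6 + 11"
      by (simp add: algebra_simps)
  qed
qed

end

section \<open>The loop over the levels\<close>

definition save_prices :: com where
  "save_prices =
     Seq (set_var ''H'' (Cst 1))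
    (For ''e'' (var ''n'') (Seq
      (Assign ''g'' (var ''e'') (Cell ''G'' (var ''e'')))
      (set_var ''H'' (Add (var ''H'') (Mul (Cst 4) (Cell ''G'' (var ''e'')))))))"

abbreviation square_level :: com where
  "square_level \<equiv> set_var ''lv'' (Mul (var ''lv'') (var ''lv''))"

abbreviation emit_level :: com where
  "emit_level \<equiv> Seq (set_var ''q'' (var ''lv'')) (Seq (run emit) square_level)"

text \<open>Plays of level \<open>Q\<close> are cut by dual sums of level \<open>Q ^ 2\<close>,
  which are complete only after all rounds of the latter. So that level is run ahead with an idle
  body, its sums are saved before \<open>G\<close> is reused, and plays are recomputed rather than
  stored.\<close>

definition level_step :: com where
  "level_step =
     Seq (set_var ''q'' (Mul (var ''lv'') (var ''lv'')))
    (Seq (run Skip)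
    (Seq save_prices
    emit_level))"

abbreviation more_levels :: aexp where
  "more_levels \<equiv> Sub (Mul (Cst 4) (var ''n'')) (var ''lv'')"

definition all_levels :: com where
  "all_levels =
     Seq (set_var ''m'' (Cst 0))
    (Seq (set_var ''lv'' (Cst 2))
    (While more_levels level_step))"

definition level_cost :: "nat \<Rightarrow> nat" where
  "level_cost n = n ^ 11 * (4 * n * (n * 8 + 13) + n * 36 + 38) + n * 18 + 40"

context machine_run
begin

definition base :: "state \<Rightarrow> bool" where
  "base s \<longleftrightarrow> inp s \<and> s ''Z'' 0 = 2 ^ L \<and> s ''D'' 0 = D \<and> s ''x'' 0 = x"

lemma env_base: "env Q s \<longleftrightarrow> base s \<and> s ''q'' 0 = int Q"
  by (auto simp: env_def base_def)

lemma base_frame: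
  assumes "frame X s s'" "base s" "X \<inter> {''n'', ''L'', ''Bp'', ''Bq'', ''S'', ''Z'', ''D'', ''x''} = {}"
  shows "base s'"
proof -
  have "s' y = s y" if "y \<in> {''Z'', ''D'', ''x''}" for y
  proof (rule frameD[OF assms(1)])
    have "y \<in> {''n'', ''L'', ''Bp'', ''Bq'', ''S'', ''Z'', ''D'', ''x''}"
      using that by (elim insertE emptyE) simp_all
    then show "y \<notin> X" using assms(3) by (meson disjoint_iff)
  qed
  moreover have "inp s'"
    by (rule inp_frame[OF assms(1)]) (use assms(2,3) in \<open>auto simp: base_def\<close>)
  ultimately show ?thesis using assms(2) by (simp add: base_def)
qed

text \<open>This allows the program to form the width by summing over all \<open>n\<close>
  indices.\<close>

lemma dual_outside: "e \<notin> S \<Longrightarrow> dual Q t e = 0"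
proof (induction t)
  case (Suc t)
  then have "e \<notin> play Q t" using play_sub by blast
  then show ?case using Suc by (simp add: dual_Suc)
qed simp

lemma dual_sum_outside: "e \<notin> S \<Longrightarrow> dual_sum Q e = 0"
  by (simp add: dual_sum_def dual_outside)

lemma dual_sum_fits: "Q \<le> 16 * n ^ 2 \<Longrightarrow> fits 25 (dual_sum Q e)"
  unfolding dual_sum_def by (rule partial_sum_fits) simp_all

lemma partial_width_fits:
  assumes "Q \<le> 16 * n ^ 2" "j \<le> n"
  shows "fits 28 (1 + 4 * (\<Sum>i<j. dual_sum Q i))"
proof (rule fits_le)
  have "(\<Sum>i<j. dual_sum Q i) \<le> (\<Sum>i<j. 2 ^ (25 * (n + L)))"
  proof (rule sum_mono)
    fix i
    show "dual_sum Q i \<le> 2 ^ (25 * (n + L))" using dual_sum_fits[OF assms(1), of i] by (simp add: fits_def)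
  qed
  also have "\<dots> = int j * 2 ^ (25 * (n + L))" by simp
  also have "\<dots> \<le> int n * 2 ^ (25 * (n + L))" using assms(2) by (intro mult_right_mono) auto
  finally show "1 + 4 * (\<Sum>i<j. dual_sum Q i) \<le> 1 + 4 * (int n * 2 ^ (25 * (n + L)))" by simp
  have "fits (max 1 (1 + (1 + 25)) + 1) (1 + 4 * (int n * 2 ^ (25 * (n + L))))"
    by (intro fits_add fits_mult fits_const fits_n) (simp_all add: fits_def)
  then show "fits 28 (1 + 4 * (int n * 2 ^ (25 * (n + L))))" by (rule fits_mono) simp
  show "0 \<le> 1 + 4 * (\<Sum>i<j. dual_sum Q i)" using sum_nonneg[of "{..<j}" "dual_sum Q"] dual_sum_nonneg by simp
qed

lemma width_eq: "1 + 4 * (\<Sum>i<n. dual_sum (Q ^ 2) i) = width Q"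
proof -
  have "(\<Sum>i<n. dual_sum (Q ^ 2) i) = (\<Sum>i\<in>S. dual_sum (Q ^ 2) i)"
    using S_within dual_sum_outside by (intro sum.mono_neutral_right) auto
  then show ?thesis by (simp add: width_def)
qed

lemma wp_save_prices:
  assumes Q: "Q ^ 2 \<le> 16 * n ^ 2" and s: "bounded s" "base s"
    and G: "\<And>i. i < n \<Longrightarrow> s ''G'' (int i) = dual_sum (Q ^ 2) i"
  shows "wp save_prices (n * 6 + 5)
    (\<lambda>s'. bounded s' \<and> frame {''e'', ''g'', ''H''} s s' \<and>
      (\<forall>i<n. s' ''g'' (int i) = dual_sum (Q ^ 2) i) \<and> s' ''H'' 0 = width Q) s"
    (is "wp _ _ ?post s")
proof -
  let ?X = "{''e'', ''g'', ''H''}"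
  let ?h = "\<lambda>j. 1 + 4 * (\<Sum>i<j. dual_sum (Q ^ 2) i)"
  let ?I = "\<lambda>j s'. frame ?X s s' \<and> s' ''H'' 0 = ?h j \<and> (\<forall>i<j. s' ''g'' (int i) = dual_sum (Q ^ 2) i)"
  have hW: "\<bar>?h j\<bar> \<le> 2 ^ W" if "j \<le> n" for j
    by (rule fits_W[OF partial_width_fits[OF Q that]]) simp
  have gW: "\<bar>dual_sum (Q ^ 2) i\<bar> \<le> 2 ^ W" for i by (rule fits_W[OF dual_sum_fits[OF Q]]) simp
  have "wp save_prices (1 + (n * ((1 + 1 + 1) + 3) + 3) + 1) ?post s"
    unfolding save_prices_def
  proof (rule wp_Seq, rule wp_AssignI[where i = 0 and v = 1])
    assume b1: "bounded (upd s ''H'' 0 1)"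
    show "wp (For ''e'' (var ''n'') (Seq
      (Assign ''g'' (var ''e'') (Cell ''G'' (var ''e'')))
      (set_var ''H'' (Add (var ''H'') (Mul (Cst 4) (Cell ''G'' (var ''e''))))))) (n * ((1 + 1 + 1) + 3) + 3) ?post (upd s ''H'' 0 1)"
    proof (rule wp_For[where I = ?I])
      show "?I 0 (upd s ''H'' 0 1)" using frame_upd[OF frame_refl, of "''H''" ?X s 0 1] by (simp add: upd_apply)
    next
      fix j s' v assume "?I j s'"
      then show "?I j (upd s' ''e'' 0 v)" using frame_upd[of ?X s s' "''e''" 0 v] by (simp add: upd_apply)
    next
      fix j s' assume "?I j s'"
      then show "aval s' (var ''n'') = int n" using frameD[of ?X s s' "''n''"] s(2) by (simp add: base_def inp_def)
    next
      fix j s' assume j: "j < n" and b: "bounded s'" and I: "?I j s'" and e: "s' ''e'' 0 = int j"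
      have G': "s' ''G'' (int j) = dual_sum (Q ^ 2) j" using I G[OF j] frameD[of ?X s s' "''G''"] by simp
      define s1 where "s1 = upd s' ''g'' (int j) (dual_sum (Q ^ 2) j)"
      define s2 where "s2 = upd s1 ''H'' 0 (?h (Suc j))"
      have fr2: "frame ?X s s2" unfolding s2_def s1_def using I by (intro frame_upd) auto
      have g2: "\<forall>i<Suc j. s2 ''g'' (int i) = dual_sum (Q ^ 2) i"
        using I by (simp add: s2_def s1_def upd_apply less_Suc_eq)
      show "wp (Seq (Assign ''g'' (var ''e'') (Cell ''G'' (var ''e'')))
      (set_var ''H'' (Add (var ''H'') (Mul (Cst 4) (Cell ''G'' (var ''e'')))))) (1 + 1 + 1)
        (\<lambda>s''. bounded s'' \<and> s'' ''e'' 0 = int j \<and> ?I (Suc j) s'') s'"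
        apply (rule wp_Seq, rule wp_AssignI[where i = "int j" and v = "dual_sum (Q ^ 2) j"])
             apply (use b e G' gW K_big in simp_all)[5]
        apply (unfold s1_def[symmetric])
        apply (rule wp_AssignI[where i = 0 and v = "?h (Suc j)"])
             apply assumption
            apply (use K_big in simp)
           apply simp
          apply (use I G' e in \<open>simp add: s1_def upd_apply\<close>)
         apply (rule hW, use j in simp)
        apply (unfold s2_def[symmetric])
        using fr2 g2 e by (simp add: s2_def s1_def upd_apply)
    next
      fix s' assume "?I n s'" "bounded s'"
      then show "?post s'" using width_eq[of Q] by simp
    qed (rule loop_cost, use b1 n_W in simp_all)
  qed (use s K_big in simp_all)
  then show ?thesis by (rule wp_mono) (simp, assumption)
qed

text \<open>A worst case for a single round, in contrast to the average in
  \<open>level_vecs_length\<close>; costs and list sizes need a bound that holds in every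
  round.\<close>

lemma block_count_play:
  assumes "1 \<le> Q"
  shows "block_count (dual_sum (Q ^ 2)) (play Q t) Q (width Q) \<le> Q + 1"
proof -
  have "(\<Sum>i\<in>play Q t. dual_sum (Q ^ 2) i) \<le> (\<Sum>i\<in>S. dual_sum (Q ^ 2) i)"
    using finite_S play_sub dual_sum_nonneg by (intro sum_mono2) auto
  also have "\<dots> \<le> width Q" using sum_nonneg[of S "dual_sum (Q ^ 2)"] dual_sum_nonneg by (simp add: width_def)
  finally have "(\<Sum>i\<in>play Q t. dual_sum (Q ^ 2) i) * int Q \<le> width Q * int Q"
    by (rule mult_right_mono) simp
  then have "(\<Sum>i\<in>play Q t. dual_sum (Q ^ 2) i) * int Q div width Q \<le> width Q * int Q div width Q"
    using width_pos by (rule zdiv_mono1)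
  also have "\<dots> = int Q" using width_pos[of Q] by simp
  finally show ?thesis by (simp add: block_count_def nat_le_iff)
qed

lemma level_vecs_length_le:
  assumes "1 \<le> Q"
  shows "length (level_vecs B' Q t) \<le> t * (Q + 1)"
proof (induction t)
  case (Suc t)
  have "length (play_vecs B' Q t) \<le> Q + 1"
    using block_count_play[OF assms, of t] by (simp add: play_vecs_def block_vecs_def)
  moreover have "length (level_vecs B' Q (Suc t)) = length (level_vecs B' Q t) + length (play_vecs B' Q t)"
    by (simp add: level_vecs_def)
  ultimately show ?case using Suc by simp
qed (simp add: level_vecs_def)

lemma wp_level_step:
  assumes Q: "1 \<le> Q" "Q < 4 * n" and s: "bounded s" "base s"
    and v: "s ''lv'' 0 = int Q" "s ''f'' 0 = int f" and f: "f < n"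
    and ys: "emitted f ys s" "length ys + rounds * (4 * n) \<le> M" "fits 30 (int M)"
  shows "wp level_step (level_cost n)
    (\<lambda>s'. bounded s' \<and> base s' \<and> s' ''lv'' 0 = int (Q ^ 2) \<and> s' ''f'' 0 = int f \<and>
      emitted f (ys @ level_vecs B Q rounds) s') s"
    (is "wp _ _ ?post s")
proof -
  have Q1: "Q \<le> 16 * n ^ 2"
  proof -
    have "4 * n * 1 \<le> 4 * n * (4 * n)" using n_large by (intro mult_left_mono) auto
    moreover have "16 * n ^ 2 = 4 * n * (4 * n)" by (simp add: power2_eq_square)
    ultimately show ?thesis using Q(2) by linarith
  qed
  have "Q ^ 2 \<le> (4 * n) ^ 2" using Q by (intro power_mono) auto
  then have Q2: "Q ^ 2 \<le> 16 * n ^ 2" by (simp add: power_mult_distrib)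
  have Q2': "1 \<le> Q ^ 2" using Q by (simp add: one_le_power)
  let ?e = "4 * n * (n * 8 + 13) + n * 6 + 11"
  let ?skip = "rounds * (n * 15 + 1 + 13) + n * 6 + 9"
  let ?r = "rounds * (n * 15 + ?e + 13) + n * 6 + 9"
  let ?X = "{''e'', ''P'', ''Q'', ''T'', ''k'', ''G'', ''den'', ''t''}"
  let ?Y = "{''e'', ''acc'', ''bl'', ''c'', ''j'', ''dp'', ''dq'', ''m''}"
  have QW: "\<bar>int Q\<bar> \<le> 2 ^ W" "\<bar>int Q * int Q\<bar> \<le> 2 ^ W"
    using fits_W[OF Q_fits[OF Q1]] fits_W[OF Q_fits[OF Q2]] by (simp_all add: power2_eq_square)
  define s1 where "s1 = upd s ''q'' 0 (int Q * int Q)"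
  \<comment> \<open>The frame condition inside \<open>J\<close> carries the saved cells
    \<open>lv\<close>, \<open>f\<close>, \<open>H\<close> and \<open>g\<close> from
    \<open>s4\<close> into every round, where they establish \<open>em.ready\<close>.\<close>
  have wp2: "wp (run emit) ?r
     (\<lambda>s'. bounded s' \<and> frame (?X \<union> ?Y) s4 s' \<and>
        (frame (?X \<union> ?Y) s4 s' \<and> emitted f (ys @ level_vecs B Q rounds) s') \<and>
        (\<forall>i<n. s' ''G'' (int i) = dual_sum Q i)) s4"
    if b4: "bounded s4" and env4: "env Q s4" and e4: "emitted f ys s4"
      and v4: "s4 ''lv'' 0 = int Q" "s4 ''f'' 0 = int f" "s4 ''H'' 0 = width Q"
        "\<And>i. i < n \<Longrightarrow> s4 ''g'' (int i) = dual_sum (Q ^ 2) i" for s4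
  proof (rule wp_run[OF Q(1) Q1 b4 env4 refl,
        where J = "\<lambda>t s'. frame (?X \<union> ?Y) s4 s' \<and> emitted f (ys @ level_vecs B Q t) s'"])
    show "?Y \<inter> {''P'', ''Q'', ''T'', ''k'', ''G'', ''den'', ''t'', ''n'', ''L'', ''Bp'', ''Bq'', ''S'', ''Z'', ''D'', ''x'', ''q''} = {}"
      by simp
    show "frame (?X \<union> ?Y) s4 s4 \<and> emitted f (ys @ level_vecs B Q 0) s4"
      using e4 by (simp add: level_vecs_def)
  next
    fix t s' s'' assume J: "frame (?X \<union> ?Y) s4 s' \<and> emitted f (ys @ level_vecs B Q t) s'" and fr: "frame ?X s' s''"
    show "frame (?X \<union> ?Y) s4 s'' \<and> emitted f (ys @ level_vecs B Q t) s''"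
    proof
      show "frame (?X \<union> ?Y) s4 s''" by (rule frame_trans[OF conjunct1[OF J] fr]) auto
      show "emitted f (ys @ level_vecs B Q t) s''"
        by (rule emitted_cong[OF conjunct2[OF J]])
          (use frameD[OF fr, of "''m''"] frameD[OF fr, of "''dp''"] frameD[OF fr, of "''dq''"] in simp_all)
    qed
  next
    fix t s' assume t: "t < rounds" and b: "bounded s'" and env: "env Q s'"
      and J: "frame (?X \<union> ?Y) s4 s' \<and> emitted f (ys @ level_vecs B Q t) s'"
      and T: "\<And>i. i < n \<Longrightarrow> s' ''T'' (int i) = of_bool (i \<in> play Q t)"
    have fr: "frame (?X \<union> ?Y) s4 s'" using J by simp
    interpret em: emission n L orc S Bp Bq w f Q "play Q t" "dual_sum (Q ^ 2)" "width Q"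
    proof
      show "play Q t \<subseteq> {..<n}" using play_sub[of Q t] S_within by blast
      show "fits 3 (int Q)" by (rule Q_fits[OF Q1])
      show "fits 25 (dual_sum (Q ^ 2) e)" for e by (rule dual_sum_fits[OF Q2])
      show "fits 30 (width Q)"
        using partial_width_fits[OF Q2 order_refl] unfolding width_eq by (rule fits_mono) simp
    qed (rule f dual_sum_nonneg width_pos)+
    have rd: "em.ready s'"
      using env T v4 frameD[OF fr, of "''lv''"] frameD[OF fr, of "''f''"] frameD[OF fr, of "''H''"]
        frameD[OF fr, of "''g''"]
      by (simp add: em.ready_def env_def)
    let ?bc = "block_count (dual_sum (Q ^ 2)) (play Q t) Q (width Q)"
    have bc: "?bc \<le> 4 * n" using block_count_play[OF Q(1), of t] Q(2) by linarith
    have len: "length (ys @ level_vecs B Q t) + ?bc \<le> M"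
    proof -
      have "length (level_vecs B Q t) \<le> t * (Q + 1)" by (rule level_vecs_length_le[OF Q(1)])
      also have "\<dots> \<le> t * (4 * n)" using Q(2) by (intro mult_left_mono) auto
      finally have "length (level_vecs B Q t) + ?bc \<le> Suc t * (4 * n)" using bc by simp
      also have "\<dots> \<le> rounds * (4 * n)" using t by (intro mult_right_mono) auto
      finally show ?thesis using ys(2) by simp
    qed
    show "wp emit ?e
       (\<lambda>s''. bounded s'' \<and> frame ?Y s' s'' \<and>
          (frame (?X \<union> ?Y) s4 s'' \<and> emitted f (ys @ level_vecs B Q (Suc t)) s'')) s'"
    proof (rule wp_mono[OF em.wp_emit[OF b rd conjunct2[OF J] len ys(3) bc] order_refl])
      fix s'' assume s'': "bounded s'' \<and> frame ?Y s' s'' \<and>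
        emitted f ((ys @ level_vecs B Q t) @ block_vecs B (dual_sum (Q ^ 2)) (play Q t) Q (width Q)) s''"
      then have "frame (?X \<union> ?Y) s4 s''" by (intro frame_trans[OF fr, where Y = ?Y]) auto
      moreover have "(ys @ level_vecs B Q t) @ block_vecs B (dual_sum (Q ^ 2)) (play Q t) Q (width Q)
          = ys @ level_vecs B Q (Suc t)"
        by (simp add: level_vecs_def play_vecs_def)
      ultimately show "bounded s'' \<and> frame ?Y s' s'' \<and>
          (frame (?X \<union> ?Y) s4 s'' \<and> emitted f (ys @ level_vecs B Q (Suc t)) s'')"
        using s'' by simp
    qed
  qed
  have wp3: "wp save_prices (n * 6 + 5) (wp emit_level
      (1 + (?r + 1 + 1) + 1) ?post) s2"
    if b2: "bounded s2" and base2: "base s2" and e2: "emitted f ys s2"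
      and v2: "s2 ''lv'' 0 = int Q" "s2 ''f'' 0 = int f"
        "\<And>i. i < n \<Longrightarrow> s2 ''G'' (int i) = dual_sum (Q ^ 2) i" for s2
  proof (rule wp_mono[OF wp_save_prices[OF Q2 b2 base2 v2(3)] order_refl])
    fix s3 assume s3: "bounded s3 \<and> frame {''e'', ''g'', ''H''} s2 s3 \<and>
      (\<forall>i<n. s3 ''g'' (int i) = dual_sum (Q ^ 2) i) \<and> s3 ''H'' 0 = width Q"
    then have fr3: "frame {''e'', ''g'', ''H''} s2 s3" by simp
    have base3: "base s3" by (rule base_frame[OF fr3 base2]) simp
    have e3: "emitted f ys s3"
      by (rule emitted_cong[OF e2])
        (use frameD[OF fr3, of "''m''"] frameD[OF fr3, of "''dp''"] frameD[OF fr3, of "''dq''"] in simp_all)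
    have v3: "s3 ''lv'' 0 = int Q" "s3 ''f'' 0 = int f"
      using frameD[OF fr3, of "''lv''"] frameD[OF fr3, of "''f''"] v2 by simp_all
    define s4 where "s4 = upd s3 ''q'' 0 (int Q)"
    have fr4: "frame {''q''} s3 s4" unfolding s4_def by (rule frame_upd) simp_all
    have base4: "base s4" by (rule base_frame[OF fr4 base3]) simp
    have e4: "emitted f ys s4"
      by (rule emitted_cong[OF e3])
        (use frameD[OF fr4, of "''m''"] frameD[OF fr4, of "''dp''"] frameD[OF fr4, of "''dq''"] in simp_all)
    have v4: "s4 ''lv'' 0 = int Q" "s4 ''f'' 0 = int f" "s4 ''H'' 0 = width Q"
        "\<And>i. i < n \<Longrightarrow> s4 ''g'' (int i) = dual_sum (Q ^ 2) i"
      using v3 s3 by (simp_all add: s4_def upd_apply)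
    have env4: "env Q s4" using base4 by (simp add: env_base s4_def upd_apply)
    show "wp emit_level
      (1 + (?r + 1 + 1) + 1) ?post s3"
    proof (rule wp_Seq, rule wp_AssignI[where i = 0 and v = "int Q"], unfold s4_def[symmetric])
      assume b4: "bounded s4"
      show "wp (Seq (run emit) square_level)
        (?r + 1 + 1) ?post s4"
      proof (rule wp_Seq, rule wp_mono[OF wp2[OF b4 env4 e4 v4] order_refl])
        fix s5 assume s5: "bounded s5 \<and> frame (?X \<union> ?Y) s4 s5 \<and>
          (frame (?X \<union> ?Y) s4 s5 \<and> emitted f (ys @ level_vecs B Q rounds) s5) \<and> (\<forall>i<n. s5 ''G'' (int i) = dual_sum Q i)"
        then have fr5: "frame (?X \<union> ?Y) s4 s5" by simp
        have base5: "base s5" by (rule base_frame[OF fr5 base4]) simp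
        have v5: "s5 ''lv'' 0 = int Q" "s5 ''f'' 0 = int f"
          using frameD[OF fr5, of "''lv''"] frameD[OF fr5, of "''f''"] v4 by simp_all
        show "wp square_level 1 ?post s5"
        proof (rule wp_AssignI[where i = 0 and v = "int Q * int Q"])
          assume b6: "bounded (upd s5 ''lv'' 0 (int Q * int Q))"
          have fr6: "frame {''lv''} s5 (upd s5 ''lv'' 0 (int Q * int Q))" by (rule frame_upd) simp_all
          have "base (upd s5 ''lv'' 0 (int Q * int Q))" by (rule base_frame[OF fr6 base5]) simp
          moreover have "emitted f (ys @ level_vecs B Q rounds) (upd s5 ''lv'' 0 (int Q * int Q))"
            by (rule emitted_cong[of _ _ s5]) (use s5 in \<open>simp_all add: upd_def\<close>)
          ultimately show "?post (upd s5 ''lv'' 0 (int Q * int Q))"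
            using b6 v5 by (simp add: upd_apply power2_eq_square)
        qed (use s5 v5 QW K_big in simp_all)
      qed
    qed (use s3 v3 QW K_big in simp_all)
  qed
  have wp1: "wp (run Skip) ?skip
     (\<lambda>s'. bounded s' \<and> frame (?X \<union> {}) s1 s' \<and> True \<and> (\<forall>i<n. s' ''G'' (int i) = dual_sum (Q ^ 2) i)) s1"
    if b1: "bounded s1" and env1: "env (Q ^ 2) s1"
  proof (rule wp_run[OF Q2' Q2 b1 env1 refl, where J = "\<lambda>_ _. True"])
    fix t s' assume "bounded s'"
    then show "wp Skip 1 (\<lambda>s''. bounded s'' \<and> frame {} s' s'' \<and> True) s'"
      by (intro wp_Skip) simp
  qed simp_all
  have "wp level_step (1 + (?skip + ((n * 6 + 5) +
      (1 + (?r + 1 + 1) + 1) + 1) + 1) + 1) ?post s"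
    unfolding level_step_def
  proof (rule wp_Seq, rule wp_AssignI[where i = 0 and v = "int Q * int Q"], unfold s1_def[symmetric])
    assume b1: "bounded s1"
    have fr1: "frame {''q''} s s1" unfolding s1_def by (rule frame_upd) simp_all
    have base1: "base s1" by (rule base_frame[OF fr1 s(2)]) simp
    have env1: "env (Q ^ 2) s1" using base1 by (simp add: env_base s1_def upd_apply power2_eq_square)
    show "wp (Seq (run Skip) (Seq save_prices emit_level))
      (?skip + ((n * 6 + 5) +
      (1 + (?r + 1 + 1) + 1) + 1) + 1) ?post s1"
    proof (rule wp_Seq, rule wp_mono[OF wp1[OF b1 env1] order_refl])
      fix s2 assume s2: "bounded s2 \<and> frame (?X \<union> {}) s1 s2 \<and> True \<and> (\<forall>i<n. s2 ''G'' (int i) = dual_sum (Q ^ 2) i)"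
      then have fr2: "frame ?X s1 s2" by simp
      have base2: "base s2" by (rule base_frame[OF fr2 base1]) simp
      have e2: "emitted f ys s2"
        by (rule emitted_cong[OF ys(1)])
          (use frameD[OF fr2, of "''m''"] frameD[OF fr2, of "''dp''"] frameD[OF fr2, of "''dq''"]
             frameD[OF fr1, of "''m''"] frameD[OF fr1, of "''dp''"] frameD[OF fr1, of "''dq''"] in simp_all)
      have v2: "s2 ''lv'' 0 = int Q" "s2 ''f'' 0 = int f"
        using frameD[OF fr2, of "''lv''"] frameD[OF fr2, of "''f''"]
          frameD[OF fr1, of "''lv''"] frameD[OF fr1, of "''f''"] v by simp_all
      show "wp (Seq save_prices emit_level)
        ((n * 6 + 5) +
      (1 + (?r + 1 + 1) + 1) + 1) ?post s2"
        by (rule wp_Seq, rule wp3) (use s2 base2 e2 v2 in simp_all)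
    qed
  qed (use s v QW K_big in simp_all)
  then show ?thesis
    by (rule wp_mono) (simp add: level_cost_def rounds_def algebra_simps, assumption)
qed

lemma all_vecs_length_le:
  fixes N :: nat
  assumes N: "\<And>i. i < N \<Longrightarrow> level i < 4 * n" and "i \<le> N"
  shows "length (all_vecs B' i) \<le> i * (rounds * (4 * n))"
  using assms(2)
proof (induction i)
  case (Suc i)
  have "length (level_vecs B' (level i) rounds) \<le> rounds * (level i + 1)"
    using level_ge[of i] by (intro level_vecs_length_le) simp
  also have "\<dots> \<le> rounds * (4 * n)" using N[of i] Suc.prems by (intro mult_left_mono) auto
  finally have "length (level_vecs B' (level i) rounds) \<le> rounds * (4 * n)" .
  moreover have "length (all_vecs B' (Suc i)) = length (all_vecs B' i) + length (level_vecs B' (level i) rounds)"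
    by (simp add: all_vecs_def)
  ultimately show ?case using Suc by simp
qed (simp add: all_vecs_def)

lemma wp_all_levels:
  fixes N :: nat
  assumes N: "\<And>i. i < N \<Longrightarrow> level i < 4 * n" "4 * n \<le> level N"
    and s: "bounded s" "base s" "s ''f'' 0 = int f" and f: "f < n"
  shows "wp all_levels (n * (level_cost n + 1) + 5)
    (\<lambda>s'. bounded s' \<and> base s' \<and> emitted f (all_vecs B N) s') s"
    (is "wp _ _ ?post s")
proof -
  let ?M = "n * (rounds * (4 * n))"
  have N_n: "N \<le> n" by (rule level_count_small[OF n_large N(1)])
  have M: "fits 30 (int ?M)"
    unfolding of_nat_mult
    by (rule fits_mono[OF fits_mult[OF fits_n fits_mult[OF rounds_fits fits_mult[OF fits_const fits_n]]]])
      simp_all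
  note len = all_vecs_length_le[OF N(1)]
  let ?I = "\<lambda>i s'. bounded s' \<and> base s' \<and> s' ''lv'' 0 = int (level i) \<and> s' ''f'' 0 = int f \<and>
     emitted f (all_vecs B i) s'"
  define s1 where "s1 = upd s ''m'' 0 0"
  define s2 where "s2 = upd s1 ''lv'' 0 2"
  have fr: "frame {''m'', ''lv''} s s2"
    unfolding s2_def s1_def by (intro frame_upd frame_refl) auto
  have loop: "wp (While more_levels level_step) (N * (level_cost n + 1) + 1) ?post s2"
    if b2: "bounded s2"
  proof (rule wp_While[where I = ?I])
    show "cost_bound W more_levels + 1 \<le> K" using K_big by simp
    have "emitted f (all_vecs B 0) s2" by (simp add: emitted_def all_vecs_def s2_def s1_def upd_apply)
    moreover have "base s2" by (rule base_frame[OF fr s(2)]) simp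
    moreover have "s2 ''lv'' 0 = int (level 0)" "s2 ''f'' 0 = int f"
      using s(3) by (simp_all add: s2_def s1_def upd_apply level_def)
    ultimately show "?I 0 s2" using b2 by simp
  next
    fix i s' assume i: "i < N" and I: "?I i s'"
    have "wp level_step (level_cost n) (?I (Suc i)) s'"
    proof (rule wp_mono[OF wp_level_step[where Q = "level i" and f = f and ys = "all_vecs B i" and M = ?M] order_refl])
      show "1 \<le> level i" using level_ge[of i] by simp
      show "level i < 4 * n" by (rule N(1)[OF i])
      have "length (all_vecs B i) + rounds * (4 * n) \<le> Suc i * (rounds * (4 * n))" using len[of i] i by simp
      also have "\<dots> \<le> ?M" using i N_n by (intro mult_right_mono) auto
      finally show "length (all_vecs B i) + rounds * (4 * n) \<le> ?M" .
      show "fits 30 (int ?M)" by (rule M)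
      fix s'' assume "bounded s'' \<and> base s'' \<and> s'' ''lv'' 0 = int (level i ^ 2) \<and> s'' ''f'' 0 = int f \<and>
        emitted f (all_vecs B i @ level_vecs B (level i) rounds) s''"
      moreover have "all_vecs B (Suc i) = all_vecs B i @ level_vecs B (level i) rounds" by (simp add: all_vecs_def)
      ultimately show "?I (Suc i) s''" by (simp only: level_Suc simp_thms)
    qed (use I f in simp_all)
    moreover have "0 < aval s' more_levels"
      using I N(1)[OF i] by (simp add: base_def inp_def)
    ultimately show "bounded s' \<and> 0 < aval s' more_levels \<and>
       wp level_step (level_cost n) (?I (Suc i)) s'" using I by simp
  next
    fix s' assume I: "?I N s'"
    then have "\<not> 0 < aval s' more_levels"
      using N(2) by (simp add: base_def inp_def)
    then show "bounded s' \<and> \<not> 0 < aval s' more_levels \<and> ?post s'"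
      using I by simp
  qed
  have "wp all_levels (1 + (1 + (N * (level_cost n + 1) + 1) + 1) + 1) ?post s"
    unfolding all_levels_def
    apply (rule wp_Seq, rule wp_AssignI[where i = 0 and v = 0])
         apply (use s K_big in simp_all)[5]
    apply (unfold s1_def[symmetric])
    apply (rule wp_Seq, rule wp_AssignI[where i = 0 and v = 2])
         apply (use K_big in simp_all)[4]
     apply (use fits_W[OF fits_const[of 2]] in simp)
    apply (unfold s2_def[symmetric])
    by (rule loop)
  then show ?thesis
  proof (rule wp_mono)
    have "N * (level_cost n + 1) \<le> n * (level_cost n + 1)" using N_n by (rule mult_right_mono) simp
    then show "1 + (1 + (N * (level_cost n + 1) + 1) + 1) + 1 \<le> n * (level_cost n + 1) + 5" by linarith
  qed
qed

end

section \<open>The algorithm\<close>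

text \<open>The interface between arrays and mathematical vectors: everything depends only on
  coordinates below \<open>n\<close>. Distinctness is included so that each listed vector has
  probability exactly \<open>1 / m\<close>.\<close>

definition good_output ::
  "nat \<Rightarrow> nat set \<Rightarrow> (nat set \<Rightarrow> real) \<Rightarrow> real \<Rightarrow> nat \<Rightarrow> (nat \<Rightarrow> nat \<Rightarrow> real) \<Rightarrow> bool" where
  "good_output n S w B m d \<longleftrightarrow> 0 < m \<and>
     (\<forall>k<m. (\<forall>e<n. 0 \<le> d k e \<and> (e \<notin> S \<longrightarrow> d k e = 0)) \<and> sum (d k) S \<le> B) \<and>
     (\<forall>k<m. \<forall>k'<m. (\<forall>e<n. d k e = d k' e) \<longrightarrow> k = k') \<and>
     (\<forall>c. (\<forall>e\<in>S. 0 \<le> c e) \<and> sum c S \<le> B / (16 * log 2 (log 2 n)) \<longrightarrow>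
        w S / (16 * log 2 (log 2 n)) \<le> (\<Sum>k<m. w {e \<in> S. c e \<le> d k e}) / m)"

lemma good_output_cong:
  assumes "good_output n S w B m d" "S \<subseteq> {..<n}"
    and eq: "\<And>k e. k < m \<Longrightarrow> e < n \<Longrightarrow> d' k e = d k e"
  shows "good_output n S w B m d'"
proof -
  have S: "e < n" if "e \<in> S" for e using assms(2) that by auto
  have "sum (d' k) S = sum (d k) S" if "k < m" for k
    using eq[OF that S] by (intro sum.cong) auto
  moreover have "{e \<in> S. c e \<le> d' k e} = {e \<in> S. c e \<le> d k e}" if "k < m" for k and c :: "nat \<Rightarrow> real"
    using eq[OF that S] by auto
  then have "(\<Sum>k<m. w {e \<in> S. c e \<le> d' k e}) = (\<Sum>k<m. w {e \<in> S. c e \<le> d k e})" for c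
    by (intro sum.cong) auto
  ultimately show ?thesis using assms(1) eq by (simp add: good_output_def)
qed

text \<open>If \<open>w S = 0\<close> there is nothing to gain; if \<open>B = 0\<close> then
  \<open>c\<close> vanishes on \<open>S\<close> and the zero vector buys all of
  \<open>S\<close>.\<close>

lemma good_output_zero:
  assumes n: "8 \<le> n" and S: "S \<subseteq> {..<n}" and w: "\<And>A. A \<subseteq> S \<Longrightarrow> 0 \<le> w A"
    and "0 \<le> B" and triv: "w S = 0 \<or> B = 0"
  shows "good_output n S w B 1 (\<lambda>_ _. 0)"
proof -
  have y: "1 \<le> 16 * log 2 (log 2 (real n))" using log2_log2_ge[OF n] by simp
  have fin: "finite S" using S finite_subset by blast
  have "w S / (16 * log 2 (log 2 n)) \<le> w {e \<in> S. c e \<le> 0}"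
    if c: "\<forall>e\<in>S. 0 \<le> c e" "sum c S \<le> B / (16 * log 2 (log 2 n))" for c
  proof (cases "B = 0")
    case True
    then have "sum c S = 0" using c sum_nonneg[of S c] by auto
    then have "\<forall>e\<in>S. c e = 0" using c fin sum_nonneg_eq_0_iff[of S c] by simp
    then have "{e \<in> S. c e \<le> 0} = S" by auto
    moreover have "w S * 1 \<le> w S * (16 * log 2 (log 2 n))" using w[of S] y by (intro mult_left_mono) auto
    then have "w S / (16 * log 2 (log 2 n)) \<le> w S" using y by (subst pos_divide_le_eq) auto
    ultimately show ?thesis by simp
  next
    case False
    then show ?thesis using triv w[of "{e \<in> S. c e \<le> 0}"] by auto
  qed
  then show ?thesis using assms by (simp add: good_output_def)
qed

text \<open>If all levels were below \<open>4 * n\<close>, \<open>level_count_small\<close> would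
  bound every number of levels by \<open>n\<close>.\<close>

lemma level_count_exists:
  assumes "8 \<le> n"
  obtains N where "\<And>i. i < N \<Longrightarrow> level i < 4 * n" "4 * n \<le> level N"
proof -
  have ex: "\<exists>N. 4 * n \<le> level N"
  proof (rule ccontr)
    assume "\<nexists>N. 4 * n \<le> level N"
    then have "level i < 4 * n" for i by (simp add: not_le)
    then have "Suc n \<le> n" by (rule level_count_small[OF assms])
    then show False by simp
  qed
  show thesis
  proof (rule that)
    show "4 * n \<le> level (LEAST N. 4 * n \<le> level N)" by (rule LeastI_ex[OF ex])
    show "level i < 4 * n" if "i < (LEAST N. 4 * n \<le> level N)" for i
      using not_less_Least[OF that] by simp
  qed
qed

context price_dynamics
begin

lemma good_output_marked:
  assumes N: "\<And>i. i < N \<Longrightarrow> level i < 4 * n" "4 * n \<le> level N" and B: "0 < B" and f: "f \<in> S"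
  shows "good_output n S w B (length (all_vecs B N)) (\<lambda>k. marked B f k (all_vecs B N ! k))"
  unfolding good_output_def
proof (intro conjI allI impI)
  let ?m = "length (all_vecs B N)" and ?d = "\<lambda>k. marked B f k (all_vecs B N ! k)"
  have B0: "0 \<le> B" using B by simp
  have n0: "0 \<le> log 2 (log 2 (real n))" using log2_log2_ge[OF n_ge] by simp
  show "0 < ?m"
    by (rule expected_value(1)[OF N B f, where c = "\<lambda>_. 0"]) (use B0 n0 in auto)
  show "0 \<le> ?d k e" if "k < ?m" for k e by (rule marked_budget(1)[OF B0 that f])
  show "?d k e = 0" if "k < ?m" "e \<notin> S" for k e by (rule marked_budget(2)[OF B0 that(1) f that(2)])
  show "sum (?d k) S \<le> B" if "k < ?m" for k by (rule marked_budget(3)[OF B0 that f])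
  show "k = k'" if "\<forall>e<n. ?d k e = ?d k' e" for k k'
  proof -
    have "f < n" using f S_sub by auto
    then show ?thesis using that marked_inj[OF B] by blast
  qed
  show "w S / (16 * log 2 (log 2 n)) \<le> (\<Sum>k<?m. w {e \<in> S. c e \<le> ?d k e}) / ?m"
    if "(\<forall>e\<in>S. 0 \<le> c e) \<and> sum c S \<le> B / (16 * log 2 (log 2 n))" for c
    by (rule expected_value(2)[OF N B f]) (use that in auto)
qed

end

section \<open>The complete program and its cost\<close>

definition find_element :: com where
  "find_element = For ''e'' (var ''n'') (Cond (Cell ''S'' (var ''e'')) (set_var ''f'' (var ''e'')) Skip)"

definition prepare :: com where
  "prepare =
     Seq (set_var ''Z'' (Cst 1))
    (Seq (For ''j'' (var ''L'') (set_var ''Z'' (Mul (Cst 2) (var ''Z''))))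
    (Seq (set_var ''D'' (Mul (Mul (Cst 2) (var ''n'')) (var ''Z'')))
    (Seq scale_search find_element)))"

definition zero_vector :: com where
  "zero_vector = Seq (set_var ''m'' (Cst 1)) (For ''e'' (var ''n'') (Assign ''dq'' (var ''e'') (Cst 1)))"

definition uniform_weights :: com where
  "uniform_weights =
     For ''j'' (var ''m'') (Seq (Assign ''pp'' (var ''j'') (Cst 1)) (Assign ''pq'' (var ''j'') (var ''m'')))"

text \<open>The test asks for both \<open>x\<close> and \<open>Bp\<close> to be positive: the
  dynamics need a positive scale, and the marks are distinct only for a positive budget.\<close>

definition algorithm :: com where
  "algorithm =
     Seq prepare
    (Seq (Cond (Mul (var ''x'') (var ''Bp'')) all_levels zero_vector)
    uniform_weights)"

definition algorithm_cost :: "nat \<Rightarrow> nat \<Rightarrow> nat" where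
  "algorithm_cost n L = L * 4 + (2 * L + n + 2) * (n * 11 + 20) + n * 9 + n * (level_cost n + 1)
     + n * (n ^ 11 * (4 * n)) * 6 + 50"

context machine_game
begin

lemma wp_find_element:
  assumes s: "bounded s" "inp s"
  shows "wp find_element (n * 5 + 3)
    (\<lambda>s'. bounded s' \<and> frame {''e'', ''f''} s s' \<and> (S \<noteq> {} \<longrightarrow> (\<exists>f\<in>S. s' ''f'' 0 = int f))) s"
    (is "wp _ _ ?post s")
proof -
  let ?X = "{''e'', ''f''}"
  let ?I = "\<lambda>j s'. frame ?X s s' \<and> ((\<exists>i\<in>S. i < j) \<longrightarrow> (\<exists>f\<in>S. s' ''f'' 0 = int f))"
  have "wp find_element (n * ((1 + 1) + 3) + 3) ?post s"
    unfolding find_element_def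
  proof (rule wp_For[where I = ?I])
    fix j s' v assume "?I j s'"
    then show "?I j (upd s' ''e'' 0 v)" using frame_upd[of ?X s s' "''e''" 0 v] by (simp add: upd_apply)
  next
    fix j s' assume "?I j s'"
    then show "aval s' (var ''n'') = int n" using frameD[of ?X s s' "''n''"] s(2) by (simp add: inp_def)
  next
    fix j s' assume j: "j < n" and b: "bounded s'" and I: "?I j s'" and e: "s' ''e'' 0 = int j"
    have Sj: "s' ''S'' (int j) = of_bool (j \<in> S)" using I frameD[of ?X s s' "''S''"] s(2) j by (simp add: inp_def)
    show "wp (Cond (Cell ''S'' (var ''e'')) (set_var ''f'' (var ''e'')) Skip) (1 + 1)
       (\<lambda>s''. bounded s'' \<and> s'' ''e'' 0 = int j \<and> ?I (Suc j) s'') s'"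
    proof (rule wp_Cond)
      assume "0 < aval s' (Cell ''S'' (var ''e''))"
      then have jS: "j \<in> S" using e Sj by (simp split: if_splits)
      show "wp (set_var ''f'' (var ''e'')) 1 (\<lambda>s''. bounded s'' \<and> s'' ''e'' 0 = int j \<and> ?I (Suc j) s'') s'"
      proof (rule wp_AssignI[where i = 0 and v = "int j"])
        have "frame ?X s (upd s' ''f'' 0 (int j))" using I by (intro frame_upd) auto
        then show "bounded (upd s' ''f'' 0 (int j)) \<Longrightarrow> bounded (upd s' ''f'' 0 (int j)) \<and>
            upd s' ''f'' 0 (int j) ''e'' 0 = int j \<and> ?I (Suc j) (upd s' ''f'' 0 (int j))"
          using jS e by (auto simp: upd_apply)
        show "\<bar>int j\<bar> \<le> 2 ^ W" using bounded_stateD[OF b, of "''e''" 0] e by simp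
      qed (use b e K_big in simp_all)
    next
      assume "\<not> 0 < aval s' (Cell ''S'' (var ''e''))"
      then have "j \<notin> S" using e Sj by (simp split: if_splits)
      then have "(\<exists>i\<in>S. i < Suc j) \<longleftrightarrow> (\<exists>i\<in>S. i < j)" by (auto simp: less_Suc_eq)
      then show "wp Skip 1 (\<lambda>s''. bounded s'' \<and> s'' ''e'' 0 = int j \<and> ?I (Suc j) s'') s'"
        using b e I by (intro wp_Skip) simp
    qed (use b K_big in simp_all)
  next
    fix s' assume I: "?I n s'" and b: "bounded s'"
    have "\<exists>i\<in>S. i < n" if "S \<noteq> {}" using that S_within by auto
    then show "?post s'" using I b by simp
  qed (rule loop_cost, use s n_W in simp_all)
  then show ?thesis by (rule wp_mono) (simp, assumption)
qed

lemma wp_prepare: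
  assumes s: "bounded s" "inp s"
  shows "wp prepare (L * 4 + (2 * L + n + 2) * (n * 11 + 20) + n * 5 + 25)
    (\<lambda>s'. bounded s' \<and> inp s' \<and> frame {''Z'', ''j'', ''D'', ''x'', ''y'', ''den'', ''e'', ''P'', ''Q'', ''T'', ''f''} s s' \<and>
       s' ''Z'' 0 = 2 ^ L \<and> s' ''D'' 0 = D \<and> fits 3 (s' ''x'' 0) \<and>
       scale_ok (s' ''x'' 0) \<and>
       (S \<noteq> {} \<longrightarrow> (\<exists>f\<in>S. s' ''f'' 0 = int f))) s"
    (is "wp _ _ ?post s")
proof -
  let ?X = "{''Z'', ''j''}"
  let ?A = "{''Z'', ''j'', ''D'', ''x'', ''y'', ''den'', ''e'', ''P'', ''Q'', ''T'', ''f''}"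
  let ?I = "\<lambda>j s'. frame ?X s s' \<and> s' ''Z'' 0 = 2 ^ j"
  define s1 where "s1 = upd s ''Z'' 0 1"
  have pow: "\<bar>2 ^ j\<bar> \<le> (2::int) ^ W" if "j \<le> L" for j
  proof -
    have "j \<le> W" using that by (simp add: W_def)
    then show ?thesis unfolding power_abs abs_numeral by (intro power_increasing) auto
  qed
  have rest: "wp (Seq (set_var ''D'' (Mul (Mul (Cst 2) (var ''n'')) (var ''Z'')))
    (Seq scale_search find_element)) (1 + (((2 * L + n + 2) * (n * 11 + 20) + 12) + (n * 5 + 3) + 1) + 1) ?post s2"
    if b2: "bounded s2" and I2: "?I L s2" for s2
  proof -
    have fr2: "frame ?X s s2" and Z2: "s2 ''Z'' 0 = 2 ^ L" using I2 by simp_all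
    have inp2: "inp s2" by (rule inp_frame[OF fr2 s(2)]) simp
    define s3 where "s3 = upd s2 ''D'' 0 D"
    have fr3: "frame {''D''} s2 s3" unfolding s3_def by (rule frame_upd) simp_all
    have inp3: "inp s3" by (rule inp_frame[OF fr3 inp2]) simp
    have v3: "s3 ''Z'' 0 = 2 ^ L" "s3 ''D'' 0 = D" using Z2 by (simp_all add: s3_def upd_apply)
    show ?thesis
    proof (rule wp_Seq, rule wp_AssignI[where i = 0 and v = D], unfold s3_def[symmetric])
      assume b3: "bounded s3"
      show "wp (Seq scale_search find_element) (((2 * L + n + 2) * (n * 11 + 20) + 12) + (n * 5 + 3) + 1) ?post s3"
      proof (rule wp_Seq, rule wp_mono[OF wp_scale_search[OF b3 inp3 v3] order_refl])
        fix s4 assume s4: "bounded s4 \<and> frame {''x'', ''y'', ''den'', ''j'', ''e'', ''P'', ''Q'', ''T''} s3 s4 \<and>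
          fits 3 (s4 ''x'' 0) \<and>
          scale_ok (s4 ''x'' 0)"
        then have b4: "bounded s4"
          and fr4: "frame {''x'', ''y'', ''den'', ''j'', ''e'', ''P'', ''Q'', ''T''} s3 s4" by simp_all
        have inp4: "inp s4" by (rule inp_frame[OF fr4 inp3]) simp
        show "wp find_element (n * 5 + 3) ?post s4"
        proof (rule wp_mono[OF wp_find_element[OF b4 inp4] order_refl])
          fix s5 assume s5: "bounded s5 \<and> frame {''e'', ''f''} s4 s5 \<and> (S \<noteq> {} \<longrightarrow> (\<exists>f\<in>S. s5 ''f'' 0 = int f))"
          then have fr5: "frame {''e'', ''f''} s4 s5" by simp
          have "inp s5" by (rule inp_frame[OF fr5 inp4]) simp
          moreover have "frame ?A s s3" by (rule frame_trans[OF fr2 fr3]) auto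
          then have "frame ?A s s4" by (rule frame_trans[OF _ fr4]) auto
          then have "frame ?A s s5" by (rule frame_trans[OF _ fr5]) auto
          moreover have "s5 ''Z'' 0 = 2 ^ L" "s5 ''D'' 0 = D" "s5 ''x'' 0 = s4 ''x'' 0"
            using v3 frameD[OF fr4, of "''Z''"] frameD[OF fr4, of "''D''"]
              frameD[OF fr5, of "''Z''"] frameD[OF fr5, of "''D''"] frameD[OF fr5, of "''x''"] by simp_all
          ultimately show "?post s5" using s4 s5 by simp
        qed
      qed
    qed (use b2 Z2 inp2 K_big fits_W[OF D_fits] in \<open>simp_all add: inp_def D_def\<close>)
  qed
  have "wp prepare (1 + ((L * (1 + 3) + 3) + (1 + (((2 * L + n + 2) * (n * 11 + 20) + 12) + (n * 5 + 3) + 1) + 1) + 1) + 1) ?post s"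
    unfolding prepare_def
  proof (rule wp_Seq, rule wp_AssignI[where i = 0 and v = 1], unfold s1_def[symmetric])
    assume b1: "bounded s1"
    show "wp (Seq (For ''j'' (var ''L'') (set_var ''Z'' (Mul (Cst 2) (var ''Z''))))
      (Seq (set_var ''D'' (Mul (Mul (Cst 2) (var ''n'')) (var ''Z''))) (Seq scale_search find_element)))
      ((L * (1 + 3) + 3) + (1 + (((2 * L + n + 2) * (n * 11 + 20) + 12) + (n * 5 + 3) + 1) + 1) + 1) ?post s1"
    proof (rule wp_Seq, rule wp_For[where I = ?I])
      show "?I 0 s1" using frame_upd[OF frame_refl, of "''Z''" ?X s 0 1] by (simp add: s1_def upd_apply)
    next
      fix j s' v assume "?I j s'"
      then show "?I j (upd s' ''j'' 0 v)" using frame_upd[of ?X s s' "''j''" 0 v] by (simp add: upd_apply)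
    next
      fix j s' assume "?I j s'"
      then show "aval s' (var ''L'') = int L" using frameD[of ?X s s' "''L''"] s(2) by (simp add: inp_def)
    next
      fix j s' assume j: "j < L" and b: "bounded s'" and I: "?I j s'" and jv: "s' ''j'' 0 = int j"
      show "wp (set_var ''Z'' (Mul (Cst 2) (var ''Z''))) 1
        (\<lambda>s''. bounded s'' \<and> s'' ''j'' 0 = int j \<and> ?I (Suc j) s'') s'"
      proof (rule wp_AssignI[where i = 0 and v = "2 ^ Suc j"])
        show "\<bar>2 ^ Suc j\<bar> \<le> (2::int) ^ W" using pow[of "Suc j"] j by simp
        have "frame ?X s (upd s' ''Z'' 0 (2 ^ Suc j))" using I by (intro frame_upd) auto
        then show "bounded (upd s' ''Z'' 0 (2 ^ Suc j)) \<Longrightarrow> bounded (upd s' ''Z'' 0 (2 ^ Suc j)) \<and>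
          upd s' ''Z'' 0 (2 ^ Suc j) ''j'' 0 = int j \<and> ?I (Suc j) (upd s' ''Z'' 0 (2 ^ Suc j))"
          using jv by (simp add: upd_apply)
      qed (use b I K_big in simp_all)
    next
      fix s' assume "?I L s'" "bounded s'"
      then show "wp (Seq (set_var ''D'' (Mul (Mul (Cst 2) (var ''n'')) (var ''Z''))) (Seq scale_search find_element))
         (1 + (((2 * L + n + 2) * (n * 11 + 20) + 12) + (n * 5 + 3) + 1) + 1) ?post s'"
        using rest by blast
    next
      show "cost_bound W (var ''L'') + value_bits W (var ''L'') + 4 * W + 40 \<le> K" by (rule loop_cost)
      show "int L \<le> 2 ^ W" using fits_W[OF fits_L] by simp
    qed (rule b1)
  qed (use s K_big in simp_all)
  then show ?thesis by (rule wp_mono) (simp, assumption)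
qed

lemma wp_zero_vector:
  assumes s: "bounded s" "inp s" and dp: "s ''dp'' = (\<lambda>_. 0)"
  shows "wp zero_vector (n * 4 + 5)
    (\<lambda>s'. bounded s' \<and> s' ''m'' 0 = 1 \<and> (\<forall>e<n. s' ''dp'' (int e) = 0 \<and> s' ''dq'' (int e) = 1)) s"
    (is "wp _ _ ?post s")
proof -
  let ?X = "{''m'', ''e'', ''dq''}"
  let ?I = "\<lambda>j s'. frame ?X s s' \<and> s' ''m'' 0 = 1 \<and> (\<forall>e<j. s' ''dq'' (int e) = 1)"
  define s1 where "s1 = upd s ''m'' 0 1"
  have "wp zero_vector (1 + (n * (1 + 3) + 3) + 1) ?post s"
    unfolding zero_vector_def
  proof (rule wp_Seq, rule wp_AssignI[where i = 0 and v = 1], unfold s1_def[symmetric])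
    assume b1: "bounded s1"
    show "wp (For ''e'' (var ''n'') (Assign ''dq'' (var ''e'') (Cst 1))) (n * (1 + 3) + 3) ?post s1"
    proof (rule wp_For[where I = ?I])
      show "?I 0 s1" using frame_upd[OF frame_refl, of "''m''" ?X s 0 1] by (simp add: s1_def upd_apply)
    next
      fix j s' v assume "?I j s'"
      then show "?I j (upd s' ''e'' 0 v)" using frame_upd[of ?X s s' "''e''" 0 v] by (simp add: upd_apply)
    next
      fix j s' assume "?I j s'"
      then show "aval s' (var ''n'') = int n" using frameD[of ?X s s' "''n''"] s(2) by (simp add: inp_def)
    next
      fix j s' assume b: "bounded s'" and I: "?I j s'" and e: "s' ''e'' 0 = int j"
      have "frame ?X s (upd s' ''dq'' (int j) 1)" using I by (intro frame_upd) auto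
      then show "wp (Assign ''dq'' (var ''e'') (Cst 1)) 1 (\<lambda>s''. bounded s'' \<and> s'' ''e'' 0 = int j \<and> ?I (Suc j) s'') s'"
        using b e I K_big by (intro wp_AssignI[where i = "int j" and v = 1]) (simp_all add: upd_apply less_Suc_eq)
    next
      fix s' assume "?I n s'" "bounded s'"
      then show "?post s'" using frameD[of ?X s s' "''dp''"] dp by simp
    qed (rule loop_cost, use b1 n_W in simp_all)
  qed (use s K_big in simp_all)
  then show ?thesis by (rule wp_mono) (simp, assumption)
qed

lemma wp_uniform_weights:
  assumes s: "bounded s" and m: "s ''m'' 0 = int m"
  shows "wp uniform_weights (m * 6 + 3)
    (\<lambda>s'. frame {''j'', ''pp'', ''pq''} s s' \<and> (\<forall>k<m. s' ''pp'' (int k) = 1 \<and> s' ''pq'' (int k) = int m)) s"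
    (is "wp _ _ ?post s")
proof -
  let ?X = "{''j'', ''pp'', ''pq''}"
  let ?I = "\<lambda>j s'. frame ?X s s' \<and> (\<forall>k<j. s' ''pp'' (int k) = 1 \<and> s' ''pq'' (int k) = int m)"
  have mW: "int m \<le> 2 ^ W" using bounded_stateD[OF s, of "''m''" 0] m by simp
  have "wp uniform_weights (m * ((1 + 1 + 1) + 3) + 3) ?post s"
    unfolding uniform_weights_def
  proof (rule wp_For[where I = ?I])
    fix j s' v assume "?I j s'"
    then show "?I j (upd s' ''j'' 0 v)" using frame_upd[of ?X s s' "''j''" 0 v] by (simp add: upd_apply)
  next
    fix j s' assume "?I j s'"
    then show "aval s' (var ''m'') = int m" using frameD[of ?X s s' "''m''"] m by simp
  next
    fix j s' assume b: "bounded s'" and I: "?I j s'" and jv: "s' ''j'' 0 = int j"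
    have m': "s' ''m'' 0 = int m" using I frameD[of ?X s s' "''m''"] m by simp
    define s1 where "s1 = upd s' ''pp'' (int j) 1"
    define s2 where "s2 = upd s1 ''pq'' (int j) (int m)"
    have fr2: "frame ?X s s2" unfolding s2_def s1_def using I by (intro frame_upd) auto
    show "wp (Seq (Assign ''pp'' (var ''j'') (Cst 1)) (Assign ''pq'' (var ''j'') (var ''m''))) (1 + 1 + 1)
      (\<lambda>s''. bounded s'' \<and> s'' ''j'' 0 = int j \<and> ?I (Suc j) s'') s'"
      apply (rule wp_Seq, rule wp_AssignI[where i = "int j" and v = 1])
           apply (use b jv K_big in simp_all)[5]
      apply (unfold s1_def[symmetric])
      apply (rule wp_AssignI[where i = "int j" and v = "int m"])
           apply assumption
          apply (use K_big in simp)
         apply (use jv in \<open>simp add: s1_def upd_apply\<close>)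
        apply (use m' in \<open>simp add: s1_def upd_apply\<close>)
       apply (use mW in simp)
      apply (unfold s2_def[symmetric])
      using fr2 I jv by (simp add: s2_def s1_def upd_apply less_Suc_eq)
  qed (rule loop_cost, use s mW in simp_all)
  then show ?thesis by (rule wp_mono) (simp, assumption)
qed

text \<open>The bound on \<open>m\<close> is kept for the cost of writing the probabilities.\<close>

definition produced :: "state \<Rightarrow> nat \<Rightarrow> bool" where
  "produced s m \<longleftrightarrow> s ''m'' 0 = int m \<and> m \<le> n * (n ^ 11 * (4 * n)) \<and>
     (\<forall>k<m. \<forall>e<n. 0 < s ''dq'' (int (k * n + e))) \<and>
     good_output n S w B m (\<lambda>k e. s ''dp'' (int (k * n + e)) / s ''dq'' (int (k * n + e)))"

lemma wp_vectors:
  assumes s: "bounded s" "inp s" and dp: "s ''dp'' = (\<lambda>_. 0)"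
    and ZD: "s ''Z'' 0 = 2 ^ L" "s ''D'' 0 = D" and x: "fits 3 (s ''x'' 0)"
      "scale_ok (s ''x'' 0)"
    and f: "S \<noteq> {} \<longrightarrow> (\<exists>f\<in>S. s ''f'' 0 = int f)"
  shows "wp (Cond (Mul (var ''x'') (var ''Bp'')) all_levels zero_vector) (n * (level_cost n + 1) + n * 4 + 6)
     (\<lambda>s'. bounded s' \<and> (\<exists>m. produced s' m)) s"
    (is "wp _ _ ?post s")
proof -
  have xBp: "aval s (Mul (var ''x'') (var ''Bp'')) = s ''x'' 0 * Bp" using s(2) by (simp add: inp_def)
  have "wp (Cond (Mul (var ''x'') (var ''Bp'')) all_levels zero_vector) ((n * (level_cost n + 1) + n * 4 + 5) + 1) ?post s"
  proof (rule wp_Cond)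
    assume "0 < aval s (Mul (var ''x'') (var ''Bp''))"
    then have pos: "0 < s ''x'' 0" "0 < Bp"
      using x(2) Bp_fits(2) xBp by (auto simp: scale_ok_def zero_less_mult_iff split: if_splits)
    interpret machine_run n L orc S Bp Bq w "s ''x'' 0"
      by unfold_locales (use pos x in \<open>simp_all add: scale_ok_def\<close>)
    have B_pos: "0 < B" using pos Bq_fits by (simp add: B_def)
    have "S \<noteq> {}"
    proof
      assume "S = {}"
      then show False using s_pos s_le U_empty by simp
    qed
    then obtain f where f: "f \<in> S" "s ''f'' 0 = int f" using f by blast
    then have fn: "f < n" using S_within by auto
    obtain N where N: "\<And>i. i < N \<Longrightarrow> level i < 4 * n" "4 * n \<le> level N"
      using level_count_exists[OF n_large] by blast
    have base: "base s" using s(2) ZD by (simp add: base_def)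
    show "wp all_levels (n * (level_cost n + 1) + n * 4 + 5) ?post s"
    proof (rule wp_mono[OF wp_all_levels[OF N s(1) base f(2) fn]])
      fix s' assume s': "bounded s' \<and> base s' \<and> emitted f (all_vecs B N) s'"
      let ?m = "length (all_vecs B N)"
      have "?m \<le> N * (rounds * (4 * n))" by (rule all_vecs_length_le[OF N(1) order_refl])
      also have "\<dots> \<le> n * (rounds * (4 * n))"
        using level_count_small[OF n_large N(1)] by (intro mult_right_mono) auto
      finally have "?m \<le> n * (n ^ 11 * (4 * n))" by (simp add: rounds_def)
      moreover have "good_output n S w B ?m (\<lambda>k e. s' ''dp'' (int (k * n + e)) / s' ''dq'' (int (k * n + e)))"
      proof (rule good_output_cong[OF good_output_marked[OF N B_pos f(1)] S_within])
        fix k e assume ke: "k < ?m" "e < n"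
        have "emitted f (all_vecs B N) s'" using s' by blast
        then have "s' ''dp'' (int (k * n + e)) / s' ''dq'' (int (k * n + e)) = marked B f k (all_vecs B N ! k) e"
          unfolding emitted_def using ke by blast
        then show "s' ''dp'' (int (k * n + e)) / s' ''dq'' (int (k * n + e)) = marked B f k (all_vecs B N ! k) e" .
      qed
      moreover have "s' ''m'' 0 = int ?m" "\<forall>k<?m. \<forall>e<n. 0 < s' ''dq'' (int (k * n + e))"
        using s' unfolding emitted_def by blast+
      ultimately have "produced s' ?m" unfolding produced_def by blast
      then show "?post s'" using s' by blast
    next
      have eq: "m + 5 \<le> m + n * 4 + 5" for m :: nat by simp
      show "n * (level_cost n + 1) + 5 \<le> n * (level_cost n + 1) + n * 4 + 5" by (rule eq)
    qed
  next
    assume "\<not> 0 < aval s (Mul (var ''x'') (var ''Bp''))"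
    then have "s ''x'' 0 = 0 \<or> Bp = 0"
      using x(2) Bp_fits(2) xBp by (auto simp: scale_ok_def zero_less_mult_iff split: if_splits)
    then have triv: "w S = 0 \<or> B = 0" using x(2) by (auto simp: B_def scale_ok_def)
    have B_nonneg: "0 \<le> B" using Bp_fits Bq_fits by (simp add: B_def)
    show "wp zero_vector (n * (level_cost n + 1) + n * 4 + 5) ?post s"
    proof (rule wp_mono[OF wp_zero_vector[OF s dp]])
      fix s' assume s': "bounded s' \<and> s' ''m'' 0 = 1 \<and> (\<forall>e<n. s' ''dp'' (int e) = 0 \<and> s' ''dq'' (int e) = 1)"
      have w0: "0 \<le> w A" if "A \<subseteq> S" for A using that S_within by (intro U_nonneg) auto
      have "good_output n S w B 1 (\<lambda>k e. s' ''dp'' (int (k * n + e)) / s' ''dq'' (int (k * n + e)))"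
        by (rule good_output_cong[OF good_output_zero[where S = S and w = w, OF n_large S_within w0 B_nonneg triv] S_within])
          (use s' in simp_all)
      moreover have "1 \<le> n * (n ^ 11 * (4 * n))" using n_large by simp
      ultimately have "produced s' 1" using s' by (simp add: produced_def)
      then show "?post s'" using s' by blast
    qed simp
  qed (use s K_big in simp_all)
  then show ?thesis by (rule wp_mono) simp_all
qed

lemma wp_algorithm:
  assumes s: "bounded s" "inp s" and dp: "s ''dp'' = (\<lambda>_. 0)"
  shows "wp algorithm (algorithm_cost n L)
     (\<lambda>s'. \<exists>m. produced s' m \<and> (\<forall>k<m. s' ''pp'' (int k) = 1 \<and> s' ''pq'' (int k) = int m)) s"
    (is "wp _ _ ?post s")
proof -
  let ?M = "n * (n ^ 11 * (4 * n))"
  have "wp algorithm ((L * 4 + (2 * L + n + 2) * (n * 11 + 20) + n * 5 + 25) +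
      ((n * (level_cost n + 1) + n * 4 + 6) + (?M * 6 + 3) + 1) + 1) ?post s"
    unfolding algorithm_def
  proof (rule wp_Seq, rule wp_mono[OF wp_prepare[OF s] order_refl])
    fix s1 assume s1: "bounded s1 \<and> inp s1 \<and>
       frame {''Z'', ''j'', ''D'', ''x'', ''y'', ''den'', ''e'', ''P'', ''Q'', ''T'', ''f''} s s1 \<and>
       s1 ''Z'' 0 = 2 ^ L \<and> s1 ''D'' 0 = D \<and> fits 3 (s1 ''x'' 0) \<and>
       scale_ok (s1 ''x'' 0) \<and>
       (S \<noteq> {} \<longrightarrow> (\<exists>f\<in>S. s1 ''f'' 0 = int f))"
    then have fr1: "frame {''Z'', ''j'', ''D'', ''x'', ''y'', ''den'', ''e'', ''P'', ''Q'', ''T'', ''f''} s s1" by simp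
    have dp1: "s1 ''dp'' = (\<lambda>_. 0)" using frameD[OF fr1, of "''dp''"] dp by simp
    have vec: "wp (Cond (Mul (var ''x'') (var ''Bp'')) all_levels zero_vector) (n * (level_cost n + 1) + n * 4 + 6)
       (\<lambda>s'. bounded s' \<and> (\<exists>m. produced s' m)) s1"
      by (rule wp_vectors) (use s1 dp1 in simp_all)
    show "wp (Seq (Cond (Mul (var ''x'') (var ''Bp'')) all_levels zero_vector) uniform_weights)
        ((n * (level_cost n + 1) + n * 4 + 6) + (?M * 6 + 3) + 1) ?post s1"
    proof (rule wp_Seq, rule wp_mono[OF vec order_refl])
      fix s2 assume "bounded s2 \<and> (\<exists>m. produced s2 m)"
      then obtain m where b2: "bounded s2" and p2: "produced s2 m" by blast
      have m: "s2 ''m'' 0 = int m" "m \<le> ?M" using p2 by (simp_all add: produced_def)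
      show "wp uniform_weights (?M * 6 + 3) ?post s2"
      proof (rule wp_mono[OF wp_uniform_weights[OF b2 m(1)]])
        show "m * 6 + 3 \<le> ?M * 6 + 3" by (intro add_right_mono mult_right_mono m(2)) simp
        fix s3 assume s3: "frame {''j'', ''pp'', ''pq''} s2 s3 \<and> (\<forall>k<m. s3 ''pp'' (int k) = 1 \<and> s3 ''pq'' (int k) = int m)"
        then have fr3: "frame {''j'', ''pp'', ''pq''} s2 s3" by simp
        have "produced s3 m"
          using p2 frameD[OF fr3, of "''m''"] frameD[OF fr3, of "''dp''"] frameD[OF fr3, of "''dq''"]
          by (simp add: produced_def)
        then show "?post s3" using s3 by blast
      qed
    qed
  qed
  then show ?thesis by (rule wp_mono) (simp add: algorithm_cost_def, assumption)
qed

end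

section \<open>Instances and polynomial time\<close>

definition poly_bounded :: "(nat \<Rightarrow> nat \<Rightarrow> nat) \<Rightarrow> bool" where
  "poly_bounded h \<longleftrightarrow> (\<exists>p :: nat poly. \<forall>n L. h n L \<le> poly p (n + L))"

lemma poly_bounded_const: "poly_bounded (\<lambda>n L. c)"
  unfolding poly_bounded_def by (rule exI[of _ "[:c:]"]) simp

lemma poly_bounded_fst: "poly_bounded (\<lambda>n L. n)" and poly_bounded_snd: "poly_bounded (\<lambda>n L. L)"
  unfolding poly_bounded_def by (rule exI[of _ "[:0, 1:]"], simp)+

lemma poly_bounded_add: "poly_bounded h \<Longrightarrow> poly_bounded h' \<Longrightarrow> poly_bounded (\<lambda>n L. h n L + h' n L)"
  unfolding poly_bounded_def by (metis add_mono poly_add)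

lemma poly_bounded_mult: "poly_bounded h \<Longrightarrow> poly_bounded h' \<Longrightarrow> poly_bounded (\<lambda>n L. h n L * h' n L)"
  unfolding poly_bounded_def by (metis mult_le_mono poly_mult)

lemma poly_bounded_power: "poly_bounded h \<Longrightarrow> poly_bounded (\<lambda>n L. h n L ^ i)"
  by (induction i) (simp_all add: poly_bounded_const poly_bounded_mult)

text \<open>The first factor is \<open>K\<close>, the cost of one unit of the cost logic, written
  out in \<open>n\<close> and \<open>L\<close>.\<close>

definition running_time :: "nat \<Rightarrow> nat \<Rightarrow> nat" where
  "running_time n L =
     (1000 * (60 * (n + L)) + 10000 + 2 * n * (60 * (n + L) + 3)) * algorithm_cost n L"

lemma poly_bounded_running_time: "poly_bounded running_time"
proof -
  have "poly_bounded (\<lambda>n L. running_time n L)"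
    unfolding running_time_def algorithm_cost_def level_cost_def
    by (intro poly_bounded_add poly_bounded_mult poly_bounded_power poly_bounded_const
        poly_bounded_fst poly_bounded_snd)
  then show ?thesis by simp
qed

section \<open>Transfer to arbitrary ground sets through a numbering\<close>

locale indexed_instance =
  fixes U :: "'a set" and v :: "'a set \<Rightarrow> real" and B :: real and S :: "'a set"
    and dem :: "('a \<Rightarrow> real) \<Rightarrow> 'a set" and u :: "nat \<Rightarrow> 'a"
  assumes fin_U: "finite U" and card_U: "8 \<le> card U"
    and v_nonneg: "\<forall>T\<subseteq>U. 0 \<le> v T" and v_mono: "mono_on (Pow U) v"
    and v_subadd: "subadditive_on U v" and v_empty: "v {} = 0"
    and B_nonneg: "0 \<le> B" and S_sub_U: "S \<subseteq> U"
    and dem: "demand_oracle U v dem" and u: "bij_betw u {..<card U} U"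
begin

abbreviation n :: nat where "n \<equiv> card U"

definition I :: "nat set" where "I = {i. i < n \<and> u i \<in> S}"

definition w :: "nat set \<Rightarrow> real" where "w A = v (u ` A)"

abbreviation orc :: "(nat \<Rightarrow> real) \<Rightarrow> nat set" where "orc \<equiv> index_oracle U u dem"

lemma u_inj: "inj_on u {..<n}" and u_image: "u ` {..<n} = U"
  using u by (auto simp: bij_betw_def)

lemma I_sub: "I \<subseteq> {..<n}"
  by (auto simp: I_def)

lemma image_sub: "A \<subseteq> {..<n} \<Longrightarrow> u ` A \<subseteq> U"
  using u_image by blast

lemma image_I: "u ` I = S"
  using u_image S_sub_U by (auto simp: I_def)

lemma index_vector_u: "i < n \<Longrightarrow> index_vector U u p (u i) = p i"
  using u_inj u_image by (auto simp: index_vector_def)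

lemma sum_index_vector: "A \<subseteq> {..<n} \<Longrightarrow> sum (index_vector U u p) (u ` A) = sum p A"
proof -
  assume A: "A \<subseteq> {..<n}"
  then have "inj_on u A" using u_inj inj_on_subset by blast
  then have "sum (index_vector U u p) (u ` A) = (\<Sum>i\<in>A. index_vector U u p (u i))"
    by (simp add: sum.reindex)
  also have "\<dots> = sum p A" using A by (intro sum.cong) (auto intro!: index_vector_u)
  finally show ?thesis .
qed

lemma index_vector_cong: "(\<And>i. i < n \<Longrightarrow> p i = q i) \<Longrightarrow> index_vector U u p = index_vector U u q"
proof
  fix e assume eq: "\<And>i. i < n \<Longrightarrow> p i = q i"
  show "index_vector U u p e = index_vector U u q e"
  proof (cases "e \<in> U")
    case True
    then obtain i where "i < n" "e = u i" using u_image by auto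
    then show ?thesis using eq by (simp add: index_vector_u)
  qed (simp add: index_vector_def)
qed

lemma index_vector_nonneg:
  assumes "\<And>i. i < n \<Longrightarrow> 0 \<le> p i" "e \<in> U"
  shows "0 \<le> index_vector U u p e"
proof -
  obtain i where "i < n" "e = u i" using assms(2) u_image by auto
  then show ?thesis using assms(1) by (simp add: index_vector_u)
qed

lemma image_orc: "dem (index_vector U u p) \<subseteq> U \<Longrightarrow> u ` orc p = dem (index_vector U u p)"
  using u_image by (auto simp: index_oracle_def)

lemma oracle_game: "oracle_game n w orc I Z" if Z: "v U < Z"
proof
  show "0 \<le> w A" if "A \<subseteq> {..<n}" for A using v_nonneg image_sub[OF that] by (simp add: w_def)
  show "w A \<le> w A'" if "A \<subseteq> A'" "A' \<subseteq> {..<n}" for A A'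
  proof -
    have "u ` A \<subseteq> u ` A'" using that by blast
    then show ?thesis
      unfolding w_def using image_sub[OF that(2)] by (intro mono_onD[OF v_mono]) auto
  qed
  show "w (A \<union> A') \<le> w A + w A'" if "A \<subseteq> {..<n}" "A' \<subseteq> {..<n}" for A A'
    using v_subadd image_sub[OF that(1)] image_sub[OF that(2)]
    by (simp add: subadditive_on_def w_def image_Un)
  show "w {} = 0" by (simp add: w_def v_empty)
  show "orc p \<subseteq> {..<n}" for p by (auto simp: index_oracle_def)
  show "I \<subseteq> {..<n}" by (rule I_sub)
  show "w {..<n} < Z" using Z by (simp add: w_def u_image)
  fix p :: "nat \<Rightarrow> real" and A assume p: "\<And>i. 0 \<le> p i" and A: "A \<subseteq> {..<n}"
  let ?P = "index_vector U u p"
  have "is_arg_max (\<lambda>S. v S - sum ?P S) (\<lambda>S. S \<subseteq> U) (dem ?P)"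
    using dem p index_vector_nonneg by (simp add: demand_oracle_def)
  then have d: "dem ?P \<subseteq> U" "\<And>X. X \<subseteq> U \<Longrightarrow> v X - sum ?P X \<le> v (dem ?P) - sum ?P (dem ?P)"
    by (auto simp: is_arg_max_def not_less)
  have "orc p \<subseteq> {..<n}" by (auto simp: index_oracle_def)
  then have "v (dem ?P) - sum ?P (dem ?P) = w (orc p) - sum p (orc p)"
    using image_orc[OF d(1)] sum_index_vector[of "orc p" p] by (simp add: w_def)
  then show "w A - sum p A \<le> w (orc p) - sum p (orc p)"
    using d(2)[OF image_sub[OF A]] sum_index_vector[OF A, of p] by (simp add: w_def)
qed

definition output_pmf :: "nat \<Rightarrow> (nat \<Rightarrow> nat \<Rightarrow> real) \<Rightarrow> ('a \<Rightarrow> real) pmf" where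
  "output_pmf m d = map_pmf (\<lambda>k. index_vector U u (d k)) (pmf_of_set {..<m})"

context
  fixes m :: nat and d :: "nat \<Rightarrow> nat \<Rightarrow> real"
  assumes good: "good_output n I w B m d"
begin

lemma m_pos: "0 < m"
  using good by (simp add: good_output_def)

lemma set_output_pmf: "set_pmf (output_pmf m d) = (\<lambda>k. index_vector U u (d k)) ` {..<m}"
  using m_pos by (simp add: output_pmf_def set_pmf_of_set lessThan_empty_iff)

text \<open>Without repetitions the image of the uniform distribution gives each vector weight
  \<open>1 / m\<close>, which is what the program writes.\<close>

lemma index_vectors_inj: "inj_on (\<lambda>k. index_vector U u (d k)) {..<m}"
proof (rule inj_onI)
  fix k k' assume k: "k \<in> {..<m}" "k' \<in> {..<m}" and eq: "index_vector U u (d k) = index_vector U u (d k')"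
  have "d k e = d k' e" if "e < n" for e
    using index_vector_u[OF that, of "d k"] index_vector_u[OF that, of "d k'"] eq by simp
  then show "k = k'" using good k by (auto simp: good_output_def)
qed

lemma output_lists_distribution:
  "lists_distribution (map (\<lambda>k. (index_vector U u (d k), 1 / m)) [0..<m]) (output_pmf m d)"
proof -
  have "pmf (output_pmf m d) (index_vector U u (d k)) = 1 / m" if "k < m" for k
  proof -
    have "set_pmf (pmf_of_set {..<m}) = {..<m}" using m_pos by (simp add: set_pmf_of_set lessThan_empty_iff)
    then have "pmf (output_pmf m d) (index_vector U u (d k)) = pmf (pmf_of_set {..<m}) k"
      unfolding output_pmf_def using that index_vectors_inj by (intro pmf_map_inj) auto
    also have "\<dots> = 1 / m" using that m_pos by (simp add: pmf_of_set lessThan_empty_iff)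
    finally show ?thesis .
  qed
  then have "(\<lambda>k. (index_vector U u (d k), 1 / m)) ` {..<m}
      = (\<lambda>d. (d, pmf (output_pmf m d') d)) ` set_pmf (output_pmf m d')" if "d' = d" for d'
    unfolding that set_output_pmf image_image by (intro image_cong) auto
  moreover have "inj_on (\<lambda>k. (index_vector U u (d k), 1 / real m)) {0..<m}"
    using index_vectors_inj by (auto simp: inj_on_def)
  ultimately show ?thesis
    by (simp add: lists_distribution_def distinct_map atLeast0LessThan)
qed

lemma output_budget: "set_pmf (output_pmf m d) \<subseteq> budget_simplex S B"
proof -
  have "index_vector U u (d k) \<in> budget_simplex S B" if k: "k < m" for k
  proof -
    have d: "\<And>e. e < n \<Longrightarrow> 0 \<le> d k e" "\<And>e. e < n \<Longrightarrow> e \<notin> I \<Longrightarrow> d k e = 0" "sum (d k) I \<le> B"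
      using good k by (auto simp: good_output_def)
    have "0 \<le> index_vector U u (d k) e" if "e \<in> S" for e
      using d(1) that S_sub_U by (intro index_vector_nonneg) auto
    moreover have "index_vector U u (d k) e = 0" if "e \<notin> S" for e
    proof (cases "e \<in> U")
      case True
      then obtain i where "i < n" "e = u i" using u_image by auto
      then show ?thesis using d(2)[of i] that by (simp add: index_vector_u I_def)
    qed (simp add: index_vector_def)
    moreover have "sum (index_vector U u (d k)) S \<le> B"
      using d(3) sum_index_vector[OF I_sub, of "d k"] by (simp add: image_I)
    ultimately show ?thesis by (simp add: budget_simplex_def)
  qed
  then show ?thesis unfolding set_output_pmf by auto
qed

lemma output_expectation:
  assumes c: "c \<in> budget_simplex S (B / (16 * log 2 (log 2 n)))"
  shows "v S / (16 * log 2 (log 2 n)) \<le> measure_pmf.expectation (output_pmf m d) (\<lambda>d. v {e \<in> S. c e \<le> d e})"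
proof -
  have "inj_on u I" using u_inj I_sub inj_on_subset by blast
  from sum.reindex[OF this, of c] have "sum (c \<circ> u) I = sum c S" by (simp add: image_I)
  then have c': "(\<forall>i\<in>I. 0 \<le> (c \<circ> u) i) \<and> sum (c \<circ> u) I \<le> B / (16 * log 2 (log 2 n))"
    using c image_I by (auto simp: budget_simplex_def)
  have sets: "{e \<in> S. c e \<le> index_vector U u (d k) e} = u ` {i \<in> I. (c \<circ> u) i \<le> d k i}" for k
  proof -
    have "index_vector U u (d k) (u i) = d k i" if "i \<in> I" for i
      using that by (intro index_vector_u) (simp add: I_def)
    then have "{e \<in> u ` I. c e \<le> index_vector U u (d k) e} = u ` {i \<in> I. (c \<circ> u) i \<le> d k i}"
      by auto
    then show ?thesis unfolding image_I .
  qed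
  have "v S / (16 * log 2 (log 2 n)) = w I / (16 * log 2 (log 2 n))" by (simp add: w_def image_I)
  also have "\<dots> \<le> (\<Sum>k<m. w {i \<in> I. (c \<circ> u) i \<le> d k i}) / m"
    using good c' unfolding good_output_def by blast
  also have "\<dots> = measure_pmf.expectation (output_pmf m d) (\<lambda>d. v {e \<in> S. c e \<le> d e})"
    using m_pos by (simp add: output_pmf_def integral_pmf_of_set lessThan_empty_iff sets w_def)
  finally show ?thesis .
qed

end

text \<open>A distribution is promised also for data without a rational encoding. Then no program
  runs: the dynamics start from the exact scale \<open>w I\<close>, and \<open>v U + 1\<close>
  serves as the prohibitive price.\<close>

lemma good_output_exists: "\<exists>m d. good_output n I w B m d"
proof -
  interpret oracle_game n w orc I "v U + 1" by (rule oracle_game) simp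
  show ?thesis
  proof (cases "w I = 0 \<or> B = 0")
    case True
    have "0 \<le> w A" if "A \<subseteq> I" for A using that I_sub by (intro U_nonneg) auto
    from good_output_zero[where S = I and w = w, OF card_U I_sub this B_nonneg True] show ?thesis by blast
  next
    case False
    have pos: "0 < w I" using False U_nonneg[OF I_sub] by simp
    interpret price_dynamics n I w demand "w I"
    proof (rule scaled_dynamics[OF card_U pos order_refl])
      have "1 * w I \<le> 2 * n * w I" using pos card_U by (intro mult_right_mono) auto
      then show "w I \<le> 2 * n * w I" by simp
    qed
    obtain N where N: "\<And>i. i < N \<Longrightarrow> level i < 4 * n" "4 * n \<le> level N"
      using level_count_exists[OF card_U] by blast
    have "I \<noteq> {}" using pos U_empty by auto
    then obtain f where f: "f \<in> I" by blast
    have "0 < B" using False B_nonneg by simp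
    from good_output_marked[OF N this f] show ?thesis by blast
  qed
qed

text \<open>Two consequences of the bit size drive the program: values lie below
  \<open>2 ^ L\<close>, the prohibitive price, and a positive value \<open>p / q\<close> is at least
  \<open>1 / q\<close>, which yields the gap used by the scale search.\<close>

lemma frac_code_bounds:
  assumes "frac_code L x p q"
  shows "0 \<le> p" "p < 2 ^ L" "0 < q" "q < 2 ^ L" "x = p / q" "x < 2 ^ L" "x = 0 \<or> 1 / 2 ^ L \<le> x"
proof -
  have bits: "k < 2 ^ L" if "bits k \<le> L" "0 \<le> k" for k :: int
  proof -
    have "floorlog 2 (nat k) \<le> L" using that by (simp add: bits_def)
    then have "nat k < 2 ^ L" using floorlog_leD[of 2 "nat k" L] by simp
    then have "int (nat k) < int (2 ^ L)" by (simp only: of_nat_less_iff)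
    then show ?thesis using that by simp
  qed
  show p0: "0 \<le> p" and q0: "0 < q" and x: "x = p / q" using assms by (simp_all add: frac_code_def)
  show pL: "p < 2 ^ L" by (rule bits) (use assms in \<open>simp_all add: frac_code_def\<close>)
  show qL: "q < 2 ^ L" by (rule bits) (use assms in \<open>simp_all add: frac_code_def\<close>)
  have pow: "real_of_int (2 ^ L) = 2 ^ L" by simp
  have "real_of_int p < real_of_int (2 ^ L)" using pL by (simp only: of_int_less_iff)
  moreover have "real_of_int p / q \<le> p / 1" using p0 q0 by (intro divide_left_mono) auto
  ultimately show "x < 2 ^ L" unfolding x pow by linarith
  show "x = 0 \<or> 1 / 2 ^ L \<le> x"
  proof (cases "p = 0")
    case False
    have "real_of_int q \<le> real_of_int (2 ^ L)" using qL by (simp only: of_int_le_iff)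
    then have "real_of_int q \<le> 2 ^ L" unfolding pow .
    then have "1 / 2 ^ L \<le> 1 / real_of_int q" using q0 by (intro divide_left_mono) auto
    also have "\<dots> \<le> p / q" using False p0 q0 by (intro divide_right_mono) auto
    finally show ?thesis by (simp add: x)
  qed (simp add: x)
qed

lemma algorithm_correct:
  assumes data: "numerical_data U v B L Bp Bq"
  shows "\<exists>m d. good_output n I w B m d \<and>
    computes_distribution algorithm (running_time n L) U dem u S L Bp Bq (output_pmf m d)"
proof -
  have Bc: "frac_code L B Bp Bq" and vc: "\<And>T. T \<subseteq> U \<Longrightarrow> \<exists>p q. frac_code L (v T) p q"
    using data by (auto simp: numerical_data_def)
  note Bb = frac_code_bounds[OF Bc]
  have vU: "v U < 2 ^ L" using vc[of U] frac_code_bounds(6) by blast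
  interpret og: oracle_game n w orc I "2 ^ L" by (rule oracle_game[OF vU])
  interpret machine n L orc I Bp Bq
  proof
    show "orc p = orc p'" if "\<And>i. i < n \<Longrightarrow> p i = p' i" for p p'
      using index_vector_cong[OF that] by (simp add: index_oracle_def)
  qed (rule card_U I_sub)+
  have fit: "fits 1 k" if "0 \<le> k" "k < 2 ^ L" for k
    by (rule fits_le[OF fits_2L]) (use that in simp_all)
  interpret machine_game n L orc I Bp Bq w
  proof
    show "w I = 0 \<or> 1 / 2 ^ L \<le> w I"
      using vc[OF S_sub_U] frac_code_bounds(7) unfolding w_def image_I by blast
  qed (use Bb fit in simp_all)
  have B: "B = machine_game.B Bp Bq" using Bb(5) by (simp add: B_def)
  let ?s = "input_state U u S L Bp Bq"
  have inp: "inp ?s" unfolding inp_def by (simp add: input_state_def scalar_def I_def)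
  have bnd: "bounded_state W ?s"
    unfolding bounded_state_def
  proof (intro allI)
    fix x i
    have "\<bar>int n\<bar> \<le> 2 ^ W" "\<bar>int L\<bar> \<le> 2 ^ W" "\<bar>Bp\<bar> \<le> 2 ^ W" "\<bar>Bq\<bar> \<le> 2 ^ W"
      using fits_W[OF fits_n] fits_W[OF fits_L] fits_W[OF fit[OF Bb(1,2)]]
        fits_W[OF fit[OF less_imp_le[OF Bb(3)] Bb(4)]] by simp_all
    then show "\<bar>?s x i\<bar> \<le> 2 ^ W"
      by (auto simp: input_state_def scalar_def)
  qed
  have dp: "?s ''dp'' = (\<lambda>_. 0)" by (simp add: input_state_def)
  from wp_algorithm[OF bnd inp dp] obtain t s m where
    ex: "exec n orc algorithm ?s t s" "t \<le> K * algorithm_cost n L" and pr: "produced s m"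
    and wt: "\<forall>k<m. s ''pp'' (int k) = 1 \<and> s ''pq'' (int k) = int m"
    unfolding wp_def by blast
  have "t \<le> running_time n L" using ex(2) by (simp add: running_time_def K_def W_def)
  define d where "d = (\<lambda>k e. s ''dp'' (int (k * n + e)) / s ''dq'' (int (k * n + e)) :: real)"
  have good: "good_output n I w B m d" and m: "s ''m'' 0 = int m"
    and dq: "\<forall>k<m. \<forall>e<n. 0 < s ''dq'' (int (k * n + e))"
    using pr unfolding produced_def d_def B by blast+
  have "output_ok n s" using m dq wt m_pos[OF good] by (simp add: output_ok_def del: of_nat_add of_nat_mult)
  moreover have "output_list U u s = map (\<lambda>k. (index_vector U u (d k), 1 / m)) [0..<m]"
    unfolding output_list_def using m wt by (simp add: d_def)
  ultimately have "computes_distribution algorithm (running_time n L) U dem u S L Bp Bq (output_pmf m d)"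
    unfolding computes_distribution_def using ex(1) \<open>t \<le> running_time n L\<close> output_lists_distribution[OF good] by (intro exI[of _ t] exI[of _ s]) simp
  then show ?thesis using good by blast
qed

end

theorem theorem3p1:
  shows "\<exists>(prog :: com) (time_bound :: nat poly).
    \<forall>(U :: 'a set) (v :: 'a set \<Rightarrow> real) (B :: real) (S :: 'a set) dem u L Bp Bq.
      finite U \<and> 8 \<le> card U \<and>
      (\<forall>T\<subseteq>U. 0 \<le> v T) \<and> mono_on (Pow U) v \<and> subadditive_on U v \<and> v {} = 0 \<and>
      0 \<le> B \<and> S \<subseteq> U \<and>
      demand_oracle U v dem \<and> bij_betw u {..<card U} U \<longrightarrow>
      (\<exists>D :: ('a \<Rightarrow> real) pmf.
         finite (set_pmf D) \<and> set_pmf D \<subseteq> budget_simplex S B \<and>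
         (\<forall>c \<in> budget_simplex S (B / (16 * log 2 (log 2 (card U)))).
            measure_pmf.expectation D (\<lambda>d. v {e \<in> S. c e \<le> d e})
              \<ge> v S / (16 * log 2 (log 2 (card U)))) \<and>
         (numerical_data U v B L Bp Bq \<longrightarrow>
            computes_distribution prog (poly time_bound (card U + L)) U dem u S L Bp Bq D))"
proof -
  obtain p :: "nat poly" where p: "\<And>n L. running_time n L \<le> poly p (n + L)"
    using poly_bounded_running_time unfolding poly_bounded_def by blast
  show ?thesis
  proof (intro exI[of _ algorithm] exI[of _ p] allI impI)
    fix U :: "'a set" and v :: "'a set \<Rightarrow> real" and B :: real and S dem u L Bp Bq
    assume "finite U \<and> 8 \<le> card U \<and>
      (\<forall>T\<subseteq>U. 0 \<le> v T) \<and> mono_on (Pow U) v \<and> subadditive_on U v \<and> v {} = 0 \<and>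
      0 \<le> B \<and> S \<subseteq> U \<and> demand_oracle U v dem \<and> bij_betw u {..<card U} U"
    then interpret indexed_instance U v B S dem u by unfold_locales simp_all
    \<comment> \<open>With encodable data the witness is the distribution that the program computes,
      otherwise the one from \<open>good_output_exists\<close>.\<close>
    obtain m d where good: "good_output n I w B m d"
      and comp: "numerical_data U v B L Bp Bq \<Longrightarrow>
         computes_distribution algorithm (running_time n L) U dem u S L Bp Bq (output_pmf m d)"
      using good_output_exists algorithm_correct by blast
    show "\<exists>D :: ('a \<Rightarrow> real) pmf.
         finite (set_pmf D) \<and> set_pmf D \<subseteq> budget_simplex S B \<and>
         (\<forall>c \<in> budget_simplex S (B / (16 * log 2 (log 2 (card U)))).
            measure_pmf.expectation D (\<lambda>d. v {e \<in> S. c e \<le> d e})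
              \<ge> v S / (16 * log 2 (log 2 (card U)))) \<and>
         (numerical_data U v B L Bp Bq \<longrightarrow>
            computes_distribution algorithm (poly p (card U + L)) U dem u S L Bp Bq D)"
    proof (intro exI[of _ "output_pmf m d"] conjI ballI impI)
      show "finite (set_pmf (output_pmf m d))" by (simp add: set_output_pmf[OF good])
      show "set_pmf (output_pmf m d) \<subseteq> budget_simplex S B" by (rule output_budget[OF good])
      show "v S / (16 * log 2 (log 2 (card U))) \<le> measure_pmf.expectation (output_pmf m d) (\<lambda>d. v {e \<in> S. c e \<le> d e})"
        if "c \<in> budget_simplex S (B / (16 * log 2 (log 2 (card U))))" for c
        by (rule output_expectation[OF good that])
      assume "numerical_data U v B L Bp Bq"
      from comp[OF this] show "computes_distribution algorithm (poly p (card U + L)) U dem u S L Bp Bq (output_pmf m d)"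
        using p[of n L] unfolding computes_distribution_def by (meson le_trans)
    qed
  qed
qed

end
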